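(* Let $\mathbb{K}$ be a field, let $\Gamma$ be a finite, connected, simple graph, and let $\mathsf{C}\neq\emptyset$ be a set of vertices of $\Gamma$. Then the zigzag algebra $Z^{\mathsf{C}}(\Gamma)$ over $\mathbb{K}$ with vertex condition for $\mathsf{C}$ is quasi-hereditary if and only if $\Gamma$ is a type $\mathsf{A}_n$ graph for some $n\geq 1$ and the vertex condition is imposed on one leaf, i.e. $\mathsf{C}=\{1\}$ or $\mathsf{C}=\{n\}$.
   Context: Graphs. The type $\mathsf{A}_n$ graph ($n\geq 1$) is the path with vertices $1,\dots,n$ and edges between $i$ and $i+1$. Zigzag algebra. Let $\Gamma$ be a finite, connected, simple graph. Let $Q$ be the double quiver of $\Gamma$: same vertices, and for each edge between $i$ and $j$ two arrows $i\to j$ and $j\to i$. Paths are composed from left to right, so $(i\to j)\cdot(j\to k)=(i\to j\to k)$; $e_i$ denotes the length-zero path at $i$. If $\Gamma$ has at least three vertices, $Z(\Gamma)$ is the quotient of the path algebra $\mathbb{K}Q$ by the relations $i\to j\to k=0$ for $i\neq k$, and $i\to j\to i=i\to k\to i$ for all neighbors $j,k$ of $i$. If $\Gamma$ has two vertices, $Z(\Gamma)$ is $\mathbb{K}Q$ modulo all paths of length three. In these cases put $x_i=i\to j\to i$ for any neighbor $j$ of $i$. If $\Gamma$ has one vertex $i$, $Z(\Gamma)=\mathbb{K}[x_i]/(x_i^2)$. In all cases $Z(\Gamma)$ has $\mathbb{K}$-basis consisting of all $e_i$, all $x_i$ and all arrows $i\to j$. For a non-empty set $\mathsf{C}$ of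 vertices, $Z^{\mathsf{C}}(\Gamma)$ is the quotient of $Z(\Gamma)$ by the ideal generated by (equivalently, the span of) the elements $x_c$, $c\in\mathsf{C}$. Quasi-hereditary. A two-sided ideal $J$ in a finite-dimensional algebra $R$ which is projective as a left $R$-module is called hereditary if $JJ=J$ and $J\,\mathrm{Rad}(R)\,J=0$, where $\mathrm{Rad}(R)$ is the Jacobson radical. A finite-dimensional algebra $R$ is quasi-hereditary if there is a chain of two-sided ideals $0=J_0\subset J_1\subset\dots\subset J_{k-1}\subset J_k=R$ (strict inclusions), for some $k\geq 1$, such that each $J_l/J_{l-1}$ is a hereditary ideal of $R/J_{l-1}$. *)

theory Defs
  imports
    "Graph_Theory.Vertex_Walk"
    "Graph_Theory.Digraph_Component"
    "HOL-Algebra.QuotRing"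
    "HOL-Algebra.Ideal_Product"
    "HOL-Algebra.Module"
begin

section \<open>Left modules\<close>

text \<open>The locale \<^locale>\<open>module\<close> of the library requires a commutative ring of scalars; here the
  scalars form an arbitrary ring. The library's \<^locale>\<open>submodule\<close> makes no such assumption and
  is used as it is. The multiplicative fields of the module record play no role.\<close>

locale left_module = R?: ring R + M?: abelian_group M
  for R :: "('a, 'r) ring_scheme" (structure) and M :: "('a, 'b, 'm) module_scheme" (structure) +
  assumes smult_closed:
      "\<lbrakk>a \<in> carrier R; x \<in> carrier M\<rbrakk> \<Longrightarrow> a \<odot>\<^bsub>M\<^esub> x \<in> carrier M"
    and smult_l_distr:
      "\<lbrakk>a \<in> carrier R; b \<in> carrier R; x \<in> carrier M\<rbrakk> \<Longrightarrow>
        (a \<oplus>\<^bsub>R\<^esub> b) \<odot>\<^bsub>M\<^esub> x = (a \<odot>\<^bsub>M\<^esub> x) \<oplus>\<^bsub>M\<^esub> (b \<odot>\<^bsub>M\<^esub> x)"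
    and smult_r_distr:
      "\<lbrakk>a \<in> carrier R; x \<in> carrier M; y \<in> carrier M\<rbrakk> \<Longrightarrow>
        a \<odot>\<^bsub>M\<^esub> (x \<oplus>\<^bsub>M\<^esub> y) = (a \<odot>\<^bsub>M\<^esub> x) \<oplus>\<^bsub>M\<^esub> (a \<odot>\<^bsub>M\<^esub> y)"
    and smult_assoc1:
      "\<lbrakk>a \<in> carrier R; b \<in> carrier R; x \<in> carrier M\<rbrakk> \<Longrightarrow>
        (a \<otimes>\<^bsub>R\<^esub> b) \<odot>\<^bsub>M\<^esub> x = a \<odot>\<^bsub>M\<^esub> (b \<odot>\<^bsub>M\<^esub> x)"
    and smult_one:
      "x \<in> carrier M \<Longrightarrow> \<one>\<^bsub>R\<^esub> \<odot>\<^bsub>M\<^esub> x = x"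

definition left_mult_module :: "('a, 'r) ring_scheme \<Rightarrow> 'a set \<Rightarrow> ('a, 'a) module" where
  "left_mult_module R J =
     \<lparr>carrier = J, mult = mult R, one = one R, zero = zero R, add = add R, smult = mult R\<rparr>"

text \<open>The free left module with basis indexed by \<open>X\<close>: finitely supported functions from \<open>X\<close> to \<open>R\<close>,
  extended by zero outside \<open>X\<close>.\<close>

definition free_left_module :: "('a, 'r) ring_scheme \<Rightarrow> 'b set \<Rightarrow> ('a, 'b \<Rightarrow> 'a) module" where
  "free_left_module R X =
     \<lparr>carrier = {f. (\<forall>x. f x \<in> carrier R) \<and> {x. f x \<noteq> \<zero>\<^bsub>R\<^esub>} \<subseteq> X \<and> finite {x. f x \<noteq> \<zero>\<^bsub>R\<^esub>}},
      mult = undefined, one = undefined,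
      zero = (\<lambda>x. \<zero>\<^bsub>R\<^esub>), add = (\<lambda>f g x. f x \<oplus>\<^bsub>R\<^esub> g x), smult = (\<lambda>r f x. r \<otimes>\<^bsub>R\<^esub> f x)\<rparr>"

definition left_module_iso ::
  "('a, 'r) ring_scheme \<Rightarrow> ('a, 'b, 'm) module_scheme \<Rightarrow> ('a, 'c, 'n) module_scheme \<Rightarrow> ('b \<Rightarrow> 'c) set"
where
  "left_module_iso R M N = {h. bij_betw h (carrier M) (carrier N) \<and>
     (\<forall>x\<in>carrier M. \<forall>y\<in>carrier M. h (x \<oplus>\<^bsub>M\<^esub> y) = h x \<oplus>\<^bsub>N\<^esub> h y) \<and>
     (\<forall>r\<in>carrier R. \<forall>x\<in>carrier M. h (r \<odot>\<^bsub>M\<^esub> x) = r \<odot>\<^bsub>N\<^esub> h x)}"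

text \<open>Projective means isomorphic to a direct summand of a free module. The index set \<open>X\<close> of the
  free module may be taken inside the element type of \<open>P\<close> without loss of generality: the carrier
  of \<open>P\<close> generates \<open>P\<close>, and a projective module is a direct summand of the free module on any
  generating set.\<close>

definition projective_left_module ::
  "('a, 'r) ring_scheme \<Rightarrow> ('a, 'b, 'm) module_scheme \<Rightarrow> bool" where
  "projective_left_module R P \<longleftrightarrow> left_module R P \<and>
     (\<exists>(X :: 'b set) A B h.
        submodule A R (free_left_module R X) \<and> submodule B R (free_left_module R X) \<and>
        A \<inter> B = {\<zero>\<^bsub>free_left_module R X\<^esub>} \<and>
        A <+>\<^bsub>free_left_module R X\<^esub> B = carrier (free_left_module R X) \<and>
        h \<in> left_module_iso R P ((free_left_module R X)\<lparr>carrier := A\<rparr>))"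


section \<open>Quasi-hereditary algebras\<close>

definition left_ideal :: "'a set \<Rightarrow> ('a, 'r) ring_scheme \<Rightarrow> bool" where
  "left_ideal I R \<longleftrightarrow> submodule I R (left_mult_module R (carrier R))"

definition maximal_left_ideal :: "'a set \<Rightarrow> ('a, 'r) ring_scheme \<Rightarrow> bool" where
  "maximal_left_ideal M R \<longleftrightarrow> left_ideal M R \<and> M \<noteq> carrier R \<and>
     (\<forall>I. left_ideal I R \<and> M \<subseteq> I \<longrightarrow> I = M \<or> I = carrier R)"

definition jacobson_radical :: "('a, 'r) ring_scheme \<Rightarrow> 'a set" where
  "jacobson_radical R = {x \<in> carrier R. \<forall>M. maximal_left_ideal M R \<longrightarrow> x \<in> M}"

definition hereditary_ideal :: "'a set \<Rightarrow> ('a, 'r) ring_scheme \<Rightarrow> bool" where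
  "hereditary_ideal J R \<longleftrightarrow> ideal J R \<and>
     projective_left_module R (left_mult_module R J) \<and>
     J \<cdot>\<^bsub>R\<^esub> J = J \<and>
     J \<cdot>\<^bsub>R\<^esub> jacobson_radical R \<cdot>\<^bsub>R\<^esub> J = {\<zero>\<^bsub>R\<^esub>}"

text \<open>The notion is used for finite-dimensional algebras, but the conditions involve only the
  underlying ring: in a unital algebra, ideals and submodules are automatically closed under
  scalars.\<close>

definition quasi_hereditary :: "('a, 'r) ring_scheme \<Rightarrow> bool" where
  "quasi_hereditary R \<longleftrightarrow> ring R \<and>
     (\<exists>(k::nat) (J :: nat \<Rightarrow> 'a set). k \<ge> 1 \<and> J 0 = {\<zero>\<^bsub>R\<^esub>} \<and> J k = carrier R \<and>
        (\<forall>l\<le>k. ideal (J l) R) \<and>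
        (\<forall>l\<in>{1..k}. J (l - 1) \<subset> J l \<and>
           hereditary_ideal ((\<lambda>a. J (l - 1) +>\<^bsub>R\<^esub> a) ` J l) (R Quot J (l - 1))))"


section \<open>Path algebras\<close>

text \<open>The ground field is the type \<open>'k\<close>. A quiver with at most one arrow from any vertex to any other is given by a
  \<^type>\<open>pair_pre_digraph\<close>, and its paths are the non-empty lists of successively visited vertices
  (\<^const>\<open>vwalk\<close>): \<open>[i]\<close> is the length-zero path at \<open>i\<close>, and \<open>[i, j, k]\<close> is
  the path going first from \<open>i\<close> to \<open>j\<close>, then from \<open>j\<close> to \<open>k\<close>. The ways to write \<open>p\<close> as a
  composition of two paths, the left factor being traversed first, are
  \<open>take (Suc l) p\<close>, \<open>drop l p\<close> for \<open>l < length p\<close>.\<close>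

definition path_algebra :: "'v pair_pre_digraph \<Rightarrow> ('v list \<Rightarrow> 'k::field) ring" where
  "path_algebra Q =
     \<lparr>carrier = {f. finite {p. f p \<noteq> 0} \<and> (\<forall>p. f p \<noteq> 0 \<longrightarrow> vwalk p (with_proj Q))},
      mult = (\<lambda>f g p. \<Sum>l<length p. f (take (Suc l) p) * g (drop l p)),
      one = (\<lambda>p. if \<exists>i\<in>pverts Q. p = [i] then 1 else 0),
      zero = (\<lambda>p. 0),
      add = (\<lambda>f g p. f p + g p)\<rparr>"

definition path_elem :: "'v list \<Rightarrow> 'v list \<Rightarrow> 'k::field" where
  "path_elem p = (\<lambda>q. if q = p then 1 else 0)"


section \<open>Zigzag algebras\<close>

text \<open>Graphs are symmetric digraphs, so a graph is its own double quiver. The algebra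
  \<open>K[x] / (x\<^sup>2)\<close> of the one-vertex graph is presented in the same way as the other cases: the
  polynomial ring in one variable is the path algebra of the quiver with one vertex \<open>i\<close> and one
  loop, the monomial \<open>x^m\<close> being the path that traverses the loop \<open>m\<close> times.\<close>

definition zigzag_quiver :: "'v pair_pre_digraph \<Rightarrow> 'v pair_pre_digraph" where
  "zigzag_quiver \<Gamma> =
     (if card (pverts \<Gamma>) = 1 then \<lparr>pverts = pverts \<Gamma>, parcs = {(i, i) | i. i \<in> pverts \<Gamma>}\<rparr>
      else \<Gamma>)"

definition zigzag_relations :: "'v pair_pre_digraph \<Rightarrow> ('v list \<Rightarrow> 'k::field) set" where
  "zigzag_relations \<Gamma> =
     (if card (pverts \<Gamma>) = 1 then {path_elem [i, i, i] | i. i \<in> pverts \<Gamma>}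
      else if card (pverts \<Gamma>) = 2 then
        {path_elem p | p. vwalk p (with_proj \<Gamma>) \<and> vwalk_length p = 3}
      else
        {path_elem [i, j, k] | i j k. (i, j) \<in> parcs \<Gamma> \<and> (j, k) \<in> parcs \<Gamma> \<and> i \<noteq> k} \<union>
        {path_elem [i, j, i] \<ominus>\<^bsub>path_algebra (zigzag_quiver \<Gamma>)\<^esub> path_elem [i, k, i]
          | i j k. (i, j) \<in> parcs \<Gamma> \<and> (i, k) \<in> parcs \<Gamma>})"

definition zigzag_ideal :: "'v pair_pre_digraph \<Rightarrow> ('v list \<Rightarrow> 'k::field) set" where
  "zigzag_ideal \<Gamma> = Idl\<^bsub>path_algebra (zigzag_quiver \<Gamma>)\<^esub> (zigzag_relations \<Gamma>)"

definition zigzag_algebra :: "'v pair_pre_digraph \<Rightarrow> ('v list \<Rightarrow> 'k::field) set ring" where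
  "zigzag_algebra \<Gamma> = path_algebra (zigzag_quiver \<Gamma>) Quot zigzag_ideal \<Gamma>"

text \<open>The classes of all paths \<open>[i, j, i]\<close> with \<open>j\<close> a neighbor of \<open>i\<close>, for \<open>i \<in> C\<close>. For fixed \<open>i\<close> they
  coincide by the relations, and are the element \<open>x\<^sub>i\<close>. For the one-vertex graph, \<open>x\<^sub>i\<close> is the class of
  the loop.\<close>

definition zigzag_x :: "'v pair_pre_digraph \<Rightarrow> 'v set \<Rightarrow> ('v list \<Rightarrow> 'k::field) set set" where
  "zigzag_x \<Gamma> C =
     (\<lambda>p. zigzag_ideal \<Gamma> +>\<^bsub>path_algebra (zigzag_quiver \<Gamma>)\<^esub> path_elem p) `
       (if card (pverts \<Gamma>) = 1 then {[i, i] | i. i \<in> C}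
        else {[i, j, i] | i j. i \<in> C \<and> (i, j) \<in> parcs \<Gamma>})"

definition zigzag_algebra_vertex_cond ::
  "'k::field itself \<Rightarrow> 'v pair_pre_digraph \<Rightarrow> 'v set \<Rightarrow> ('v list \<Rightarrow> 'k) set set ring" where
  "zigzag_algebra_vertex_cond K \<Gamma> C =
     zigzag_algebra \<Gamma> Quot (Idl\<^bsub>zigzag_algebra \<Gamma>\<^esub> (zigzag_x \<Gamma> C))"


section \<open>Type A graphs\<close>

definition type_A :: "nat \<Rightarrow> nat pair_pre_digraph" where
  "type_A n = \<lparr>pverts = {1..n},
     parcs = {(i, j). i \<in> {1..n} \<and> j \<in> {1..n} \<and> (j = i + 1 \<or> i = j + 1)}\<rparr>"

definition graph_iso :: "('u \<Rightarrow> 'v) \<Rightarrow> 'u pair_pre_digraph \<Rightarrow> 'v pair_pre_digraph \<Rightarrow> bool" where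
  "graph_iso f G H \<longleftrightarrow> bij_betw f (pverts G) (pverts H) \<and>
     (\<forall>u\<in>pverts G. \<forall>v\<in>pverts G. (u, v) \<in> parcs G \<longleftrightarrow> (f u, f v) \<in> parcs H)"

end

theory Submission
  imports Defs
begin

text \<open>Factoring the ideal generated by the idempotents \<open>e\<^sub>i\<close>, \<open>i \<in> T\<close>, out of \<open>Z\<^sup>D(\<Gamma>)\<close> gives again an
  algebra of this kind: the graph loses the vertices in \<open>T\<close>, and the vertex condition is imposed in
  addition on all their neighbors. An idempotent ideal \<open>J\<close> is generated by the \<open>e\<^sub>i\<close> it contains, and
  if \<open>J\<close> is moreover hereditary, then these vertices \<open>i\<close> are pairwise non-adjacent, each has at most
  one neighbor, no two share a neighbor, and the neighbors carry no vertex condition. Indeed,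
  projectivity provides a left linear map \<open>J \<rightarrow> R\<close> taking the arrow \<open>i \<rightarrow> j\<close> to an element with non-zero
  coefficient at \<open>e\<^sub>i\<close>, so that no product \<open>(k \<rightarrow> i) \<cdot> (i \<rightarrow> j)\<close> with \<open>k\<close> adjacent to \<open>i\<close> vanishes.

  Hence a heredity chain assigns a level to each vertex, namely the step at which it is removed, and
  adjacent vertices have different levels, each vertex has at most one neighbor of higher and at
  most one of lower level, and vertices in \<open>C\<close> have none of lower level. A connected graph of this
  kind is a path starting at the unique element of \<open>C\<close>. Conversely, removing the vertices of a path
  one by one from the end in \<open>C\<close> is a heredity chain.\<close>

text \<open>Each step of a heredity chain changes the ring and even the type of its elements. The
  argument therefore rests on an interface that survives quotients: the coefficients at e_i, arrows
  and x_i with their product rules. Removing T imposes the vertex condition on a neighbor m of t in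
  T because x_m = (m -> t)(t -> m) then vanishes. The same quotient lemma yields the algebra itself,
  since the relations and the x_c generate exactly the common kernel of the coefficients on the path
  algebra. Non-adjacency within a heredity layer comes from J Rad(R) J = 0, the degree conditions
  from projectivity. That there is at most one lower neighbor has two sources: vertices removed in
  the same step share no neighbor, and once a vertex is gone its neighbors carry a vertex condition,
  which forbids removing a second neighbor before them. For the converse, let x_v = 0 and let j be
  the only neighbor of v left, with x_j nonzero. Then R e_v R = R e_v + R (v -> j) is a direct sum
  of two copies of R e_v, since right multiplication by v -> j is injective on R e_v.\<close>

no_notation vwalk_join (infixr "\<oplus>" 65)

section \<open>Projectivity and dual bases\<close>

lemma free_left_module_simps:
  "f \<in> carrier (free_left_module R X) \<longleftrightarrow>
     (\<forall>x. f x \<in> carrier R) \<and> {x. f x \<noteq> \<zero>\<^bsub>R\<^esub>} \<subseteq> X \<and> finite {x. f x \<noteq> \<zero>\<^bsub>R\<^esub>}"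
  "f \<oplus>\<^bsub>free_left_module R X\<^esub> g = (\<lambda>x. f x \<oplus>\<^bsub>R\<^esub> g x)"
  "\<zero>\<^bsub>free_left_module R X\<^esub> = (\<lambda>x. \<zero>\<^bsub>R\<^esub>)"
  "r \<odot>\<^bsub>free_left_module R X\<^esub> f = (\<lambda>x. r \<otimes>\<^bsub>R\<^esub> f x)"
  by (auto simp: free_left_module_def)

lemma left_mult_module_simps [simp]:
  "carrier (left_mult_module R J) = J"
  "a \<oplus>\<^bsub>left_mult_module R J\<^esub> b = a \<oplus>\<^bsub>R\<^esub> b"
  "\<zero>\<^bsub>left_mult_module R J\<^esub> = \<zero>\<^bsub>R\<^esub>"
  "r \<odot>\<^bsub>left_mult_module R J\<^esub> a = r \<otimes>\<^bsub>R\<^esub> a"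
  by (simp_all add: left_mult_module_def)

lemma submoduleD:
  assumes "submodule A R M"
  shows "A \<subseteq> carrier M" "\<zero>\<^bsub>M\<^esub> \<in> A" "\<And>a b. a \<in> A \<Longrightarrow> b \<in> A \<Longrightarrow> a \<oplus>\<^bsub>M\<^esub> b \<in> A"
    "\<And>r a. r \<in> carrier R \<Longrightarrow> a \<in> A \<Longrightarrow> r \<odot>\<^bsub>M\<^esub> a \<in> A"
    "\<And>a. a \<in> A \<Longrightarrow> inv\<^bsub>add_monoid M\<^esub> a \<in> A"
proof -
  interpret S: submodule A R M by fact
  show "A \<subseteq> carrier M" "\<zero>\<^bsub>M\<^esub> \<in> A" "\<And>a b. a \<in> A \<Longrightarrow> b \<in> A \<Longrightarrow> a \<oplus>\<^bsub>M\<^esub> b \<in> A"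
    "\<And>r a. r \<in> carrier R \<Longrightarrow> a \<in> A \<Longrightarrow> r \<odot>\<^bsub>M\<^esub> a \<in> A"
    "\<And>a. a \<in> A \<Longrightarrow> inv\<^bsub>add_monoid M\<^esub> a \<in> A"
    using S.subset S.one_closed S.m_closed S.m_inv_closed S.smult_closed by auto
qed

text \<open>The elements of Hom(J, R). Projectivity is used and proved through them: a direct
  summand of a free module enters by its coordinate forms.\<close>

locale left_linear_form = ring R for R :: "('a, 'r) ring_scheme" (structure) +
  fixes J :: "'a set" and \<phi> :: "'a \<Rightarrow> 'a"
  assumes form_closed: "a \<in> J \<Longrightarrow> \<phi> a \<in> carrier R"
    and form_add: "\<lbrakk>a \<in> J; b \<in> J\<rbrakk> \<Longrightarrow> \<phi> (a \<oplus> b) = \<phi> a \<oplus> \<phi> b"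
    and form_mult: "\<lbrakk>r \<in> carrier R; a \<in> J\<rbrakk> \<Longrightarrow> \<phi> (r \<otimes> a) = r \<otimes> \<phi> a"

context ring
begin


lemma free_left_module_comm_group: "comm_group (add_monoid (free_left_module R X))"
proof (rule comm_groupI)
  fix f assume f: "f \<in> carrier (add_monoid (free_left_module R X))"
  have "{x. \<ominus> f x \<noteq> \<zero>} = {x. f x \<noteq> \<zero>}"
    using f by (auto simp: free_left_module_simps)
  then have "(\<lambda>x. \<ominus> f x) \<in> carrier (free_left_module R X)"
    using f by (auto simp: free_left_module_simps)
  moreover have "(\<lambda>x. \<ominus> f x) \<oplus>\<^bsub>free_left_module R X\<^esub> f = \<zero>\<^bsub>free_left_module R X\<^esub>"
    using f by (auto simp: free_left_module_simps l_neg)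
  ultimately show "\<exists>g\<in>carrier (add_monoid (free_left_module R X)).
      g \<otimes>\<^bsub>add_monoid (free_left_module R X)\<^esub> f = \<one>\<^bsub>add_monoid (free_left_module R X)\<^esub>"
    by auto
next
  fix f g assume f: "f \<in> carrier (add_monoid (free_left_module R X))"
    and g: "g \<in> carrier (add_monoid (free_left_module R X))"
  have "{x. f x \<oplus> g x \<noteq> \<zero>} \<subseteq> {x. f x \<noteq> \<zero>} \<union> {x. g x \<noteq> \<zero>}" by auto
  then show "f \<otimes>\<^bsub>add_monoid (free_left_module R X)\<^esub> g
      \<in> carrier (add_monoid (free_left_module R X))"
    using f g by (auto simp: free_left_module_simps intro: finite_subset)
qed (auto simp: free_left_module_simps a_ac)

text \<open>Dual basis argument: the coordinates of \<open>h\<close> are linear forms, and the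
  \<open>A\<close>-components of the unit vectors come from elements \<open>z x\<close> of J such
  that y is the sum of the products \<open>h y x\<close> times \<open>z x\<close>. If all of these
  lay in \<open>U\<close>, so would y.\<close>

lemma projective_left_ideal_form:
  assumes P: "projective_left_module R (left_mult_module R J)"
    and J: "J \<subseteq> carrier R"
    and y: "y \<in> J" and U: "\<zero> \<in> U" "\<And>a b. a \<in> U \<Longrightarrow> b \<in> U \<Longrightarrow> a \<oplus> b \<in> U" and yU: "y \<notin> U"
  obtains \<phi> z where "left_linear_form R J \<phi>" "z \<in> J" "\<phi> y \<otimes> z \<notin> U"
proof -
  from P obtain X :: "'a set" and A B h where A: "submodule A R (free_left_module R X)"
    and B: "submodule B R (free_left_module R X)"
    and AB: "A \<inter> B = {\<zero>\<^bsub>free_left_module R X\<^esub>}"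
      "A <+>\<^bsub>free_left_module R X\<^esub> B = carrier (free_left_module R X)"
    and h: "h \<in> left_module_iso R (left_mult_module R J) ((free_left_module R X)\<lparr>carrier := A\<rparr>)"
    and JM: "left_module R (left_mult_module R J)"
    unfolding projective_left_module_def by blast
  interpret JM: left_module R "left_mult_module R J" by fact
  interpret F: comm_group "add_monoid (free_left_module R X)"
    by (rule free_left_module_comm_group)
  note AD = submoduleD[OF A, simplified free_left_module_simps]
  note BD = submoduleD[OF B, simplified free_left_module_simps]
  have hbij: "bij_betw h J A"
    and hadd: "\<And>a b. a \<in> J \<Longrightarrow> b \<in> J \<Longrightarrow> h (a \<oplus> b) = (\<lambda>x. h a x \<oplus> h b x)"
    and hmult: "\<And>r a. r \<in> carrier R \<Longrightarrow> a \<in> J \<Longrightarrow> h (r \<otimes> a) = (\<lambda>x. r \<otimes> h a x)"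
    using h by (auto simp: left_module_iso_def free_left_module_def)
  have hA: "h a \<in> A" if "a \<in> J" for a using hbij that by (auto simp: bij_betw_def)
  have AF: "f x \<in> carrier R" if "f \<in> A" for f x
    using AD(1) that by (auto simp: free_left_module_simps)
  have BF: "f x \<in> carrier R" if "f \<in> B" for f x
    using BD(1) that by (auto simp: free_left_module_simps)
  have hR: "h a x \<in> carrier R" if "a \<in> J" for a x using AF hA that by blast
  have Jadd: "a \<oplus> b \<in> J" if "a \<in> J" "b \<in> J" for a b
    using JM.M.a_closed that by simp
  have Jmult: "r \<otimes> a \<in> J" if "r \<in> carrier R" "a \<in> J" for r a
    using JM.smult_closed that by simp
  have J0: "\<zero> \<in> J" using JM.M.zero_closed by simp
  have h0: "h \<zero> = (\<lambda>x. \<zero>)"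
  proof
    fix x show "h \<zero> x = \<zero>"
      using hmult[OF zero_closed J0] hR[OF J0, of x] by (metis J0 l_null zero_closed)
  qed
  have form: "left_linear_form R J (\<lambda>a. h a x)" for x
    by unfold_locales (auto simp: hR hadd hmult)
  have dec: "\<exists>u\<in>J. \<exists>b\<in>B. f = (\<lambda>x. h u x \<oplus> b x)" if "f \<in> carrier (free_left_module R X)" for f
  proof -
    from that have "f \<in> A <+>\<^bsub>free_left_module R X\<^esub> B" by (simp add: AB(2))
    then obtain a b where ab: "a \<in> A" "b \<in> B" "f = a \<oplus>\<^bsub>free_left_module R X\<^esub> b"
      by (auto simp: set_add_def set_mult_def)
    moreover from ab(1) hbij obtain u where "u \<in> J" "a = h u" by (auto simp: bij_betw_def)
    ultimately show ?thesis by (auto simp: free_left_module_simps)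
  qed
  define d :: "'a \<Rightarrow> 'a \<Rightarrow> 'a" where "d = (\<lambda>x t. if t = x then \<one> else \<zero>)"
  have dF: "d x \<in> carrier (free_left_module R X)" if "x \<in> X" for x
    using that by (auto simp: d_def free_left_module_simps)
  have "\<forall>x\<in>X. \<exists>z\<in>J. \<exists>b\<in>B. d x = (\<lambda>t. h z t \<oplus> b t)" using dec dF by blast
  then obtain z b where z: "\<And>x. x \<in> X \<Longrightarrow> z x \<in> J" and b: "\<And>x. x \<in> X \<Longrightarrow> b x \<in> B"
    and d: "\<And>x. x \<in> X \<Longrightarrow> d x = (\<lambda>t. h (z x) t \<oplus> b x t)"
    by metis
  have "\<exists>x\<in>X. h y x \<otimes> z x \<notin> U"
  proof (rule ccontr)
    assume "\<not> ?thesis"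
    then have yz: "\<And>x. x \<in> X \<Longrightarrow> h y x \<otimes> z x \<in> U" by blast
    \<comment> \<open>Induction on the support. The witness \<open>u\<close> is the sum of the
      \<open>f x\<close> times \<open>z x\<close>, and \<open>h u\<close> is the
      \<open>A\<close>-part of \<open>f\<close>.\<close>
    have *: "\<exists>u\<in>J \<inter> U. \<exists>b\<in>B. f = (\<lambda>x. h u x \<oplus> b x)"
      if "finite S" "\<And>x. f x \<in> carrier R" "{x. f x \<noteq> \<zero>} = S" "S \<subseteq> X"
        "\<And>x. x \<in> X \<Longrightarrow> f x \<otimes> z x \<in> U" for f S
      using that
    proof (induction S arbitrary: f rule: finite_induct)
      case empty
      then have "f = (\<lambda>x. \<zero>)" by auto
      then have "f = (\<lambda>x. h \<zero> x \<oplus> \<zero>)" by (simp add: h0)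
      then show ?case using J0 U(1) BD(2) by (intro bexI[of _ \<zero>] bexI[of _ "\<lambda>x. \<zero>"]) auto
    next
      case (insert x S)
      have xX: "x \<in> X" using insert by auto
      define g where "g = f(x := \<zero>)"
      have "\<exists>u\<in>J \<inter> U. \<exists>b\<in>B. g = (\<lambda>x. h u x \<oplus> b x)"
      proof (rule insert.IH)
        show "{t. g t \<noteq> \<zero>} = S" using insert.hyps insert.prems(2) by (auto simp: g_def)
        show "g t \<otimes> z t \<in> U" if "t \<in> X" for t
          using insert.prems(4)[OF that] U(1) z[OF that] J by (auto simp: g_def)
      qed (use insert in \<open>auto simp: g_def\<close>)
      then obtain u c where u: "u \<in> J" "u \<in> U" and c: "c \<in> B" and g: "g = (\<lambda>x. h u x \<oplus> c x)"
        by auto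
      have fx: "f x \<in> carrier R" using insert by auto
      let ?u = "u \<oplus> f x \<otimes> z x" and ?c = "\<lambda>t. c t \<oplus> f x \<otimes> b x t"
      have "f = (\<lambda>t. h ?u t \<oplus> ?c t)"
      proof
        fix t
        have "h ?u t = h u t \<oplus> f x \<otimes> h (z x) t"
          using hadd[OF u(1) Jmult[OF fx z[OF xX]]] hmult[OF fx z[OF xX]] by simp
        moreover have "f t = g t \<oplus> f x \<otimes> d x t"
          using insert.prems(1) by (auto simp: g_def d_def)
        ultimately show "f t = h ?u t \<oplus> ?c t"
          using hR[OF u(1), of t] hR[OF z[OF xX], of t] BF[OF c, of t] BF[OF b[OF xX], of t] fx
          by (simp add: g d[OF xX] r_distr a_ac)
      qed
      moreover have "?u \<in> J \<inter> U" using u Jadd Jmult fx z[OF xX] U(2) insert.prems(4)[OF xX] by auto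
      moreover have "?c \<in> B" using BD(3)[OF c BD(4)[OF fx b[OF xX]]] .
      ultimately show ?case by (intro bexI[of _ ?u] bexI[of _ ?c])
    qed
    have hy: "h y \<in> carrier (free_left_module R X)" using AD(1) hA[OF y] by auto
    obtain u c where u: "u \<in> J" "u \<in> U" and c: "c \<in> B" and hyu: "h y = (\<lambda>x. h u x \<oplus> c x)"
      using *[of "{x. h y x \<noteq> \<zero>}" "h y"] hR[OF y] hy yz by (auto simp: free_left_module_simps)
    \<comment> \<open>\<open>h y\<close> and \<open>h u\<close> lie in \<open>A\<close>, so their
      difference \<open>c\<close> lies in both \<open>A\<close> and \<open>B\<close> and is zero.
      The factor minus one replaces a subtraction, as \<open>h\<close> is known to respect sums and
      multiples.\<close>
    have "h (y \<oplus> \<ominus> \<one> \<otimes> u) = c"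
    proof
      fix t
      have 1: "\<ominus> \<one> \<otimes> u \<in> J" using Jmult u(1) by simp
      have "h (y \<oplus> \<ominus> \<one> \<otimes> u) t = h y t \<oplus> \<ominus> \<one> \<otimes> h u t"
        using hadd[OF y 1] hmult[of "\<ominus> \<one>" u] u(1) by simp
      also have "\<dots> = h u t \<oplus> c t \<oplus> \<ominus> (h u t)" using hyu hR[OF u(1), of t] by (simp add: l_minus)
      also have "\<dots> = c t" using hR[OF u(1), of t] BF[OF c, of t]
        by (metis a_comm add.inv_closed a_assoc r_neg r_zero)
      finally show "h (y \<oplus> \<ominus> \<one> \<otimes> u) t = c t" .
    qed
    then have "c \<in> A" using hA[OF Jadd[OF y Jmult[of "\<ominus> \<one>" u]]] u(1) by simp
    with c AB(1) have "c = (\<lambda>x. \<zero>)" by (auto simp: free_left_module_simps)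
    with hyu have "h y = h u" using hR[OF u(1)] by auto
    then have "y = u" using hbij y u(1) by (auto simp: bij_betw_def inj_on_def)
    with u(2) yU show False by simp
  qed
  then obtain x where "x \<in> X" "h y x \<otimes> z x \<notin> U" by blast
  then show ?thesis using that[OF form z] by blast
qed

lemma left_mult_module_ideal:
  assumes "ideal J R"
  shows "left_module R (left_mult_module R J)"
proof -
  interpret J: ideal J R by fact
  have "comm_group (add_monoid (left_mult_module R J))"
  proof (rule comm_groupI)
    fix a assume "a \<in> carrier (add_monoid (left_mult_module R J))"
    then show "\<exists>b\<in>carrier (add_monoid (left_mult_module R J)).
        b \<otimes>\<^bsub>add_monoid (left_mult_module R J)\<^esub> a = \<one>\<^bsub>add_monoid (left_mult_module R J)\<^esub>"
      by (intro bexI[of _ "\<ominus> a"]) (auto simp: l_neg)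
  qed (auto simp: a_ac)
  then have "abelian_group (left_mult_module R J)" by (rule comm_group_abelian_groupI)
  then show ?thesis
    by (auto intro!: left_module.intro ring_axioms left_module_axioms.intro
        simp: J.I_l_closed l_distr r_distr m_assoc)
qed

text \<open>The coordinate map \<open>\<iota>\<close> is a section of the evaluation map
  \<open>\<pi>\<close> from the free module on \<open>X\<close> to J, so the free module is the
  direct sum of the image of \<open>\<iota>\<close> and the kernel of \<open>\<pi>\<close>.\<close>

lemma projective_left_moduleI_dual_basis:
  assumes J: "ideal J R" and X: "finite X" "X \<subseteq> J"
    and form: "\<And>x. x \<in> X \<Longrightarrow> left_linear_form R J (\<phi> x)"
    and basis: "\<And>a. a \<in> J \<Longrightarrow> a = (\<Oplus>x\<in>X. \<phi> x a \<otimes> x)"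
  shows "projective_left_module R (left_mult_module R J)"
proof -
  interpret J: ideal J R by fact
  let ?F = "free_left_module R X"
  interpret F: comm_group "add_monoid ?F" by (rule free_left_module_comm_group)
  have XR: "x \<in> carrier R" if "x \<in> X" for x using X that by auto
  define \<iota> where "\<iota> a = (\<lambda>x. if x \<in> X then \<phi> x a else \<zero>)" for a
  define \<pi> where "\<pi> f = (\<Oplus>x\<in>X. f x \<otimes> x)" for f
  have fR: "f x \<in> carrier R" if "f \<in> carrier ?F" for f x
    using that by (auto simp: free_left_module_simps)
  have \<phi>R: "\<phi> x a \<in> carrier R" if "x \<in> X" "a \<in> J" for x a
    using left_linear_form.form_closed[OF form] that by auto
  have \<iota>F: "\<iota> a \<in> carrier ?F" if "a \<in> J" for a
    using X that by (auto simp: free_left_module_simps \<iota>_def \<phi>R intro: finite_subset)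
  have \<pi>R: "\<pi> f \<in> J" if "f \<in> carrier ?F" for f
  proof -
    have "(\<Oplus>x\<in>Y. f x \<otimes> x) \<in> J" if "finite Y" "Y \<subseteq> X" for Y
      using that
    proof (induction Y rule: finite_induct)
      case (insert y Y)
      then have "(\<Oplus>x\<in>insert y Y. f x \<otimes> x) = f y \<otimes> y \<oplus> (\<Oplus>x\<in>Y. f x \<otimes> x)"
        using fR[OF \<open>f \<in> _\<close>] XR by (intro finsum_insert) auto
      with insert show ?case using J.I_l_closed fR[OF \<open>f \<in> _\<close>] X by auto
    qed simp
    then show ?thesis using X(1) by (simp add: \<pi>_def)
  qed
  have \<iota>add: "\<iota> (a \<oplus> b) = (\<lambda>x. \<iota> a x \<oplus> \<iota> b x)" if "a \<in> J" "b \<in> J" for a b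
    using that by (auto simp: \<iota>_def left_linear_form.form_add[OF form])
  have \<iota>mult: "\<iota> (r \<otimes> a) = (\<lambda>x. r \<otimes> \<iota> a x)" if "r \<in> carrier R" "a \<in> J" for r a
    using that by (auto simp: \<iota>_def left_linear_form.form_mult[OF form])
  have \<pi>add: "\<pi> (\<lambda>x. f x \<oplus> g x) = \<pi> f \<oplus> \<pi> g" if "f \<in> carrier ?F" "g \<in> carrier ?F" for f g
  proof -
    have "\<pi> (\<lambda>x. f x \<oplus> g x) = (\<Oplus>x\<in>X. f x \<otimes> x \<oplus> g x \<otimes> x)"
      unfolding \<pi>_def using fR that XR by (intro finsum_cong') (auto simp: l_distr)
    also have "\<dots> = \<pi> f \<oplus> \<pi> g"
      unfolding \<pi>_def using fR that XR by (intro finsum_addf) auto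
    finally show ?thesis .
  qed
  have \<pi>mult: "\<pi> (\<lambda>x. r \<otimes> f x) = r \<otimes> \<pi> f" if "r \<in> carrier R" "f \<in> carrier ?F" for r f
  proof -
    have "\<pi> (\<lambda>x. r \<otimes> f x) = (\<Oplus>x\<in>X. r \<otimes> (f x \<otimes> x))"
      unfolding \<pi>_def using fR that XR by (intro finsum_cong') (auto simp: m_assoc)
    also have "\<dots> = r \<otimes> \<pi> f"
      unfolding \<pi>_def using fR that XR X(1) by (intro finsum_rdistr[symmetric]) auto
    finally show ?thesis .
  qed
  have \<pi>\<iota>: "\<pi> (\<iota> a) = a" if "a \<in> J" for a
  proof -
    have "\<pi> (\<iota> a) = (\<Oplus>x\<in>X. \<phi> x a \<otimes> x)"
      unfolding \<pi>_def using \<phi>R XR that by (intro finsum_cong') (auto simp: \<iota>_def)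
    then show ?thesis using basis[OF that] by simp
  qed
  have sub: "submodule S R ?F" if S: "S \<subseteq> carrier ?F" "S \<noteq> {}"
    "\<And>f g. f \<in> S \<Longrightarrow> g \<in> S \<Longrightarrow> (\<lambda>x. f x \<oplus> g x) \<in> S"
    "\<And>r f. r \<in> carrier R \<Longrightarrow> f \<in> S \<Longrightarrow> (\<lambda>x. r \<otimes> f x) \<in> S" for S
  proof -
    have "inv\<^bsub>add_monoid ?F\<^esub> f \<in> S" if f: "f \<in> S" for f
    proof -
      have fF: "f \<in> carrier ?F" using f \<open>S \<subseteq> _\<close> by auto
      let ?g = "\<lambda>x. \<ominus> \<one> \<otimes> f x"
      have g: "?g \<in> S" using S(4)[of "\<ominus> \<one>" f] f by auto
      have "?g \<otimes>\<^bsub>add_monoid ?F\<^esub> f = \<one>\<^bsub>add_monoid ?F\<^esub>"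
        using fR[OF fF] by (auto simp: free_left_module_simps l_minus l_neg)
      then have "inv\<^bsub>add_monoid ?F\<^esub> f = ?g"
        using F.inv_equality[of ?g f] g fF \<open>S \<subseteq> _\<close> by auto
      with g show ?thesis by simp
    qed
    then have "subgroup S (add_monoid ?F)"
      using that by (intro F.subgroupI) (auto simp: free_left_module_simps)
    then show ?thesis
      using that by (auto intro!: submodule.intro submodule_axioms.intro simp: free_left_module_simps)
  qed
  let ?A = "\<iota> ` J" and ?B = "{f \<in> carrier ?F. \<pi> f = \<zero>}"
  have J0: "\<zero> \<in> J" by simp
  have \<iota>0: "\<iota> \<zero> = (\<lambda>x. \<zero>)" using \<iota>mult[OF zero_closed J0] fR[OF \<iota>F[OF J0]] by auto
  have \<pi>0: "\<pi> (\<lambda>x. \<zero>) = \<zero>" using \<pi>\<iota>[OF J0] \<iota>0 by simp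
  have Fc: "(\<lambda>x. f x \<oplus> g x) \<in> carrier ?F" if "f \<in> carrier ?F" "g \<in> carrier ?F" for f g
    using F.m_closed[of f g] that by (simp add: free_left_module_simps)
  have Fm: "(\<lambda>x. r \<otimes> f x) \<in> carrier ?F" if "r \<in> carrier R" "f \<in> carrier ?F" for r f
  proof -
    have "{x. r \<otimes> f x \<noteq> \<zero>} \<subseteq> {x. f x \<noteq> \<zero>}" using that by auto
    then show ?thesis using that by (auto simp: free_left_module_simps intro: finite_subset)
  qed
  have F0: "(\<lambda>x. \<zero>) \<in> carrier ?F" by (simp add: free_left_module_simps)
  have A: "submodule ?A R ?F"
  proof (rule sub)
    fix f g assume "f \<in> ?A" "g \<in> ?A"
    then obtain a b where "a \<in> J" "b \<in> J" "f = \<iota> a" "g = \<iota> b" by blast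
    then show "(\<lambda>x. f x \<oplus> g x) \<in> ?A" using \<iota>add[of a b] by (intro image_eqI[of _ _ "a \<oplus> b"]) auto
  next
    fix r f assume "r \<in> carrier R" "f \<in> ?A"
    then obtain a where "r \<in> carrier R" "a \<in> J" "f = \<iota> a" by blast
    then show "(\<lambda>x. r \<otimes> f x) \<in> ?A"
      using \<iota>mult[of r a] by (intro image_eqI[of _ _ "r \<otimes> a"]) (auto simp: J.I_l_closed)
  qed (use \<iota>F J0 in blast)+
  have B: "submodule ?B R ?F"
    by (rule sub) (use F0 \<pi>0 in \<open>auto simp: \<pi>add \<pi>mult intro: Fc Fm\<close>)
  have "?A \<inter> ?B = {\<lambda>x. \<zero>}"
  proof -
    have "\<iota> a = (\<lambda>x. \<zero>)" if "a \<in> J" "\<pi> (\<iota> a) = \<zero>" for a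
      using \<pi>\<iota>[OF that(1)] that(2) \<iota>0 by simp
    moreover have "(\<lambda>x. \<zero>) \<in> ?A" using \<iota>0 J0 by (metis image_eqI)
    ultimately show ?thesis using F0 \<pi>0 by blast
  qed
  moreover have "f \<in> ?A <+>\<^bsub>?F\<^esub> ?B" if f: "f \<in> carrier ?F" for f
  proof -
    have \<pi>f: "\<pi> f \<in> J" using \<pi>R f .
    let ?g = "\<lambda>x. f x \<oplus> (\<ominus> \<one> \<otimes> \<iota> (\<pi> f) x)"
    have g: "?g \<in> carrier ?F" using Fc[OF f Fm[OF _ \<iota>F[OF \<pi>f]]] by simp
    have "\<pi> ?g = \<pi> f \<oplus> \<ominus> \<one> \<otimes> \<pi> f"
      using \<pi>add[OF f Fm[of "\<ominus> \<one>", OF _ \<iota>F[OF \<pi>f]]] \<pi>mult[of "\<ominus> \<one>", OF _ \<iota>F[OF \<pi>f]] \<pi>\<iota>[OF \<pi>f]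
      by simp
    also have "\<dots> = \<zero>" using \<pi>f by (simp add: l_minus r_neg)
    finally have "?g \<in> ?B" using g by simp
    moreover have "f = \<iota> (\<pi> f) \<oplus>\<^bsub>?F\<^esub> ?g"
    proof
      fix x
      have 1: "f x \<in> carrier R" "\<iota> (\<pi> f) x \<in> carrier R" using fR[OF f] fR[OF \<iota>F[OF \<pi>f]] by auto
      then have "\<iota> (\<pi> f) x \<oplus> (f x \<oplus> \<ominus> (\<iota> (\<pi> f) x)) = f x"
        by (metis a_lcomm add.inv_closed r_neg r_zero)
      then show "f x = (\<iota> (\<pi> f) \<oplus>\<^bsub>?F\<^esub> ?g) x" using 1 by (simp add: free_left_module_simps l_minus)
    qed
    ultimately show ?thesis using \<pi>f by (auto simp: set_add_def set_mult_def)
  qed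
  moreover have "?A <+>\<^bsub>?F\<^esub> ?B \<subseteq> carrier ?F"
    using \<iota>F Fc by (auto simp: set_add_def set_mult_def free_left_module_simps(2))
  moreover have "\<iota> \<in> left_module_iso R (left_mult_module R J) (?F\<lparr>carrier := ?A\<rparr>)"
  proof -
    have "inj_on \<iota> J" using \<pi>\<iota> by (metis inj_onI)
    then show ?thesis
      by (auto simp: left_module_iso_def free_left_module_def bij_betw_def \<iota>add \<iota>mult)
  qed
  ultimately show ?thesis
    unfolding projective_left_module_def using A B left_mult_module_ideal[OF J]
    by (intro conjI exI[of _ X] exI[of _ ?A] exI[of _ ?B] exI[of _ \<iota>])
      (auto simp only: free_left_module_simps(3))
qed

end

section \<open>Left ideals and the Jacobson radical\<close>

context ring
begin

lemma left_idealI: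
  assumes "I \<subseteq> carrier R" "\<zero> \<in> I" "\<And>a b. a \<in> I \<Longrightarrow> b \<in> I \<Longrightarrow> a \<oplus> b \<in> I"
    "\<And>r a. r \<in> carrier R \<Longrightarrow> a \<in> I \<Longrightarrow> r \<otimes> a \<in> I"
  shows "left_ideal I R"
proof -
  interpret M: left_module R "left_mult_module R (carrier R)"
    by (rule left_mult_module_ideal[OF oneideal])
  have "\<ominus>\<^bsub>left_mult_module R (carrier R)\<^esub> a \<in> I" if a: "a \<in> I" for a
  proof -
    have aR: "a \<in> carrier R" using a assms(1) by blast
    have m: "\<ominus> a \<in> I" using assms(4)[of "\<ominus> \<one>" a] a aR by (simp add: l_minus)
    have "\<ominus>\<^bsub>left_mult_module R (carrier R)\<^esub> a = \<ominus> a"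
      using aR by (intro M.minus_equality) (simp_all add: l_neg)
    with m show ?thesis by simp
  qed
  then have "subgroup I (add_monoid (left_mult_module R (carrier R)))"
    using assms(1-3) by (intro M.add.subgroupI) auto
  then show ?thesis
    unfolding left_ideal_def using assms(4)
    by (intro submodule.intro submodule_axioms.intro) simp_all
qed

lemma left_idealD:
  assumes "left_ideal I R"
  shows "I \<subseteq> carrier R" "\<zero> \<in> I" "\<And>a b. a \<in> I \<Longrightarrow> b \<in> I \<Longrightarrow> a \<oplus> b \<in> I"
    "\<And>r a. r \<in> carrier R \<Longrightarrow> a \<in> I \<Longrightarrow> r \<otimes> a \<in> I"
  using submoduleD[OF assms[unfolded left_ideal_def]] by simp_all

text \<open>If a maximal left ideal M misses x, then M + Rx is everything, so 1 = m + n with n in Rx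
  and n^3 = 0. Hence m = 1 - n has the left inverse 1 + n + n^2, which puts 1 into M.\<close>

lemma jacobson_radicalI_cube_zero:
  assumes x: "x \<in> carrier R"
    and nil: "\<And>r. r \<in> carrier R \<Longrightarrow> (r \<otimes> x) \<otimes> ((r \<otimes> x) \<otimes> (r \<otimes> x)) = \<zero>"
  shows "x \<in> jacobson_radical R"
proof -
  have "x \<in> M" if M: "maximal_left_ideal M R" for M
  proof (rule ccontr)
    assume xM: "x \<notin> M"
    have lM: "left_ideal M R" "M \<noteq> carrier R" using M by (auto simp: maximal_left_ideal_def)
    note MD = left_idealD[OF lM(1)]
    let ?I = "{m \<oplus> r \<otimes> x | m r. m \<in> M \<and> r \<in> carrier R}"
    have "left_ideal ?I R"
    proof (rule left_idealI)
      show "?I \<subseteq> carrier R" using MD(1) x by auto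
      have "\<zero> = \<zero> \<oplus> \<zero> \<otimes> x" using x by simp
      then show "\<zero> \<in> ?I" using MD(2) zero_closed by blast
    next
      fix a b assume "a \<in> ?I" "b \<in> ?I"
      then obtain m r n s where *: "m \<in> M" "r \<in> carrier R" "n \<in> M" "s \<in> carrier R"
        "a = m \<oplus> r \<otimes> x" "b = n \<oplus> s \<otimes> x" by blast
      then have "a \<oplus> b = (m \<oplus> n) \<oplus> (r \<oplus> s) \<otimes> x"
        using MD(1) x by (auto simp: l_distr a_ac subset_iff)
      then show "a \<oplus> b \<in> ?I" using * MD(3) by blast
    next
      fix t a assume t: "t \<in> carrier R" and "a \<in> ?I"
      then obtain m r where *: "m \<in> M" "r \<in> carrier R" "a = m \<oplus> r \<otimes> x" by blast
      then have "t \<otimes> a = t \<otimes> m \<oplus> (t \<otimes> r) \<otimes> x"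
        using MD(1) x t by (auto simp: r_distr m_assoc subset_iff)
      then show "t \<otimes> a \<in> ?I" using * MD(4) t by blast
    qed
    moreover have "M \<subseteq> ?I"
    proof
      fix m assume "m \<in> M"
      moreover from this have "m = m \<oplus> \<zero> \<otimes> x" using MD(1) x by auto
      ultimately show "m \<in> ?I" by blast
    qed
    moreover define N where "N = ?I"
    ultimately have "N = M \<or> N = carrier R" using M by (auto simp: maximal_left_ideal_def)
    moreover have "x = \<zero> \<oplus> \<one> \<otimes> x" using x by simp
    then have "x \<in> N" unfolding N_def using MD(2) one_closed by blast
    ultimately have "\<one> \<in> N" using xM by auto
    then have "\<exists>m r. \<one> = m \<oplus> r \<otimes> x \<and> m \<in> M \<and> r \<in> carrier R" unfolding N_def by simp
    then obtain m r where m: "m \<in> M" "r \<in> carrier R" "\<one> = m \<oplus> r \<otimes> x" by blast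
    define n where "n = r \<otimes> x"
    have n: "n \<in> carrier R" "n \<otimes> (n \<otimes> n) = \<zero>" using nil[OF m(2)] x m by (auto simp: n_def)
    have mR: "m \<in> carrier R" using m MD by auto
    have m1: "m = \<one> \<ominus> n"
      using m(3) n mR by (simp flip: n_def) algebra
    have nm: "n \<otimes> m = n \<ominus> n \<otimes> n" using n by (simp add: m1 minus_eq r_distr r_minus)
    have nnm: "(n \<otimes> n) \<otimes> m = n \<otimes> n"
      using n by (simp add: m1 minus_eq r_distr r_minus m_assoc)
    \<comment> \<open>With \<open>k = n \<otimes> n\<close> this becomes (1 + n + n^2)(1 - n) =
      1.\<close>
    have "\<one> \<ominus> n \<oplus> (n \<ominus> k) \<oplus> k = \<one>" if "k \<in> carrier R" for k
      using that n(1) by (simp add: minus_eq a_assoc l_neg)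
    from this[of "n \<otimes> n"] have "m \<oplus> n \<otimes> m \<oplus> (n \<otimes> n) \<otimes> m = \<one>"
      unfolding nm nnm using n(1) by (simp add: m1)
    moreover have "m \<oplus> n \<otimes> m \<oplus> (n \<otimes> n) \<otimes> m \<in> M" using MD n m by simp
    ultimately have "\<one> \<in> M" by simp
    then have "r \<in> M" if "r \<in> carrier R" for r using MD(4)[OF that] that by fastforce
    then show False using lM MD(1) by auto
  qed
  then show ?thesis using x by (simp add: jacobson_radical_def)
qed

end

section \<open>Rings with zigzag coefficients\<close>

text \<open>The functions \<open>ce\<close>, \<open>ca\<close>, \<open>cx\<close> are the coefficients of a ring element at the idempotents \<open>e\<^sub>i\<close>,
  the arrows and the \<open>x\<^sub>i\<close>; the set \<open>D\<close> contains the vertices with \<open>x\<^sub>i = 0\<close>. Only with the additional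
  axiom of \<open>zigzag_basis\<close> is the ring a zigzag algebra with vertex condition for \<open>D\<close>; without it,
  the path algebra is another instance.\<close>

locale zigzag_coeffs = ring R for R :: "('a, 'r) ring_scheme" (structure) +
  fixes V D :: "'v set" and E :: "('v \<times> 'v) set"
    and ce :: "'a \<Rightarrow> 'v \<Rightarrow> 'k::field" and ca :: "'a \<Rightarrow> 'v \<Rightarrow> 'v \<Rightarrow> 'k" and cx :: "'a \<Rightarrow> 'v \<Rightarrow> 'k"
  assumes finite_V: "finite V" and E_V: "E \<subseteq> V \<times> V" and sym_E: "sym E" and irrefl_E: "irrefl E"
    and ce_off: "\<lbrakk>a \<in> carrier R; i \<notin> V\<rbrakk> \<Longrightarrow> ce a i = 0"
    and ca_off: "\<lbrakk>a \<in> carrier R; (i, j) \<notin> E\<rbrakk> \<Longrightarrow> ca a i j = 0"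
    and cx_off: "\<lbrakk>a \<in> carrier R; i \<notin> V \<or> i \<in> D\<rbrakk> \<Longrightarrow> cx a i = 0"
    and ce_add: "\<lbrakk>a \<in> carrier R; b \<in> carrier R\<rbrakk> \<Longrightarrow> ce (a \<oplus> b) i = ce a i + ce b i"
    and ca_add: "\<lbrakk>a \<in> carrier R; b \<in> carrier R\<rbrakk> \<Longrightarrow> ca (a \<oplus> b) i j = ca a i j + ca b i j"
    and cx_add: "\<lbrakk>a \<in> carrier R; b \<in> carrier R\<rbrakk> \<Longrightarrow> cx (a \<oplus> b) i = cx a i + cx b i"
    and ce_mult: "\<lbrakk>a \<in> carrier R; b \<in> carrier R\<rbrakk> \<Longrightarrow> ce (a \<otimes> b) i = ce a i * ce b i"
    and ca_mult: "\<lbrakk>a \<in> carrier R; b \<in> carrier R\<rbrakk> \<Longrightarrow>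
      ca (a \<otimes> b) i j = ce a i * ca b i j + ca a i j * ce b j"
    and cx_mult: "\<lbrakk>a \<in> carrier R; b \<in> carrier R; i \<notin> D\<rbrakk> \<Longrightarrow>
      cx (a \<otimes> b) i = ce a i * cx b i + cx a i * ce b i + (\<Sum>j\<in>V. ca a i j * ca b j i)"
    and ce_one: "i \<in> V \<Longrightarrow> ce \<one> i = 1" and ca_one: "ca \<one> i j = 0" and cx_one: "cx \<one> i = 0"
    and coeffs_surj: "\<lbrakk>\<And>i. i \<notin> V \<Longrightarrow> e i = 0; \<And>i j. (i, j) \<notin> E \<Longrightarrow> f i j = 0;
      \<And>i. i \<notin> V \<or> i \<in> D \<Longrightarrow> x i = 0\<rbrakk> \<Longrightarrow> \<exists>a\<in>carrier R. ce a = e \<and> ca a = f \<and> cx a = x"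

locale zigzag_basis = zigzag_coeffs +
  assumes coeffs_inj: "\<lbrakk>a \<in> carrier R; b \<in> carrier R; ce a = ce b; ca a = ca b; cx a = cx b\<rbrakk> \<Longrightarrow> a = b"

text \<open>For \<open>a\<close> ranging over a zigzag algebra, this is the ideal generated by the idempotents
  \<open>e\<^sub>i\<close>, \<open>i \<in> T\<close>.\<close>

definition zigzag_kern ::
  "('a, 'r) ring_scheme \<Rightarrow> ('v \<times> 'v) set \<Rightarrow> ('a \<Rightarrow> 'v \<Rightarrow> 'k::field) \<Rightarrow> ('a \<Rightarrow> 'v \<Rightarrow> 'v \<Rightarrow> 'k) \<Rightarrow>
    ('a \<Rightarrow> 'v \<Rightarrow> 'k) \<Rightarrow> 'v set \<Rightarrow> 'a set" where
  "zigzag_kern R E ce ca cx T = {a \<in> carrier R. (\<forall>i. i \<notin> T \<longrightarrow> ce a i = 0) \<and>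
     (\<forall>i j. i \<notin> T \<longrightarrow> j \<notin> T \<longrightarrow> ca a i j = 0) \<and> (\<forall>i. i \<notin> T \<longrightarrow> i \<notin> E `` T \<longrightarrow> cx a i = 0)}"

section \<open>The ideals \<open>kern T\<close> and their quotients\<close>

context zigzag_coeffs
begin

abbreviation kern :: "'v set \<Rightarrow> 'a set" where
  "kern \<equiv> zigzag_kern R E ce ca cx"

lemma EV: "(i, j) \<in> E \<Longrightarrow> i \<in> V" "(i, j) \<in> E \<Longrightarrow> j \<in> V"
  and E_sym: "(i, j) \<in> E \<Longrightarrow> (j, i) \<in> E"
  and E_neq: "(i, j) \<in> E \<Longrightarrow> i \<noteq> j"
  using E_V sym_E irrefl_E by (auto simp: sym_def irrefl_def)

lemma coeffs_zero: "ce \<zero> i = 0" "ca \<zero> i j = 0" "cx \<zero> i = 0"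
  using ce_add[of \<zero> \<zero> i] ca_add[of \<zero> \<zero> i j] cx_add[of \<zero> \<zero> i]
  by (simp_all only: l_zero zero_closed add_cancel_right_right)

lemma coeffs_minus:
  assumes "a \<in> carrier R"
  shows "ce (\<ominus> a) i = - ce a i" "ca (\<ominus> a) i j = - ca a i j" "cx (\<ominus> a) i = - cx a i"
  using assms ce_add[of a "\<ominus> a" i] ca_add[of a "\<ominus> a" i j] cx_add[of a "\<ominus> a" i]
  by (auto simp: r_neg coeffs_zero add_eq_0_iff)

lemma ce_one_if: "ce \<one> i = (if i \<in> V then 1 else 0)"
  using ce_one ce_off by auto

text \<open>The critical coefficient of a product is that at x_i for i outside T and not adjacent to
  T: every detour i -> j -> i then has j outside T as well, where the arrow coefficients of an
  element of \<open>kern T\<close> vanish. At a neighbor of T the detour through T exists, so there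
  the coefficient has to stay free.\<close>

lemma kern_ideal: "ideal (kern T) R"
proof (rule idealI)
  show "ring R" by (rule ring_axioms)
  show "subgroup (kern T) (add_monoid R)"
    by (intro add.subgroupI)
      (auto simp: zigzag_kern_def ce_add ca_add cx_add coeffs_zero coeffs_minus
        simp flip: a_inv_def intro!: exI[of _ \<zero>])
next
  fix a r assume a: "a \<in> kern T" and r: "r \<in> carrier R"
  have aR: "a \<in> carrier R" using a by (simp add: zigzag_kern_def)
  have z: "ca r i j = 0 \<or> ca a j i = 0" "ca a i j = 0 \<or> ca r j i = 0" if "i \<notin> T" "i \<notin> E `` T" for i j
  proof -
    have "(i, j) \<notin> E \<or> j \<notin> T" using that(2) E_sym by blast
    then show "ca r i j = 0 \<or> ca a j i = 0" "ca a i j = 0 \<or> ca r j i = 0"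
      using a that(1) ca_off[OF r] ca_off[OF aR] by (auto simp: zigzag_kern_def)
  qed
  have "cx (r \<otimes> a) i = 0" if "i \<notin> T" "i \<notin> E `` T" for i
    using a r aR that z(1)[OF that] cx_off[of "r \<otimes> a" i]
    by (cases "i \<in> D") (auto simp: zigzag_kern_def cx_mult intro!: sum.neutral)
  then show "r \<otimes> a \<in> kern T" using a r by (auto simp: zigzag_kern_def ce_mult ca_mult)
  have "cx (a \<otimes> r) i = 0" if "i \<notin> T" "i \<notin> E `` T" for i
    using a r aR that z(2)[OF that] cx_off[of "a \<otimes> r" i]
    by (cases "i \<in> D") (auto simp: zigzag_kern_def cx_mult intro!: sum.neutral)
  then show "a \<otimes> r \<in> kern T" using a r by (auto simp: zigzag_kern_def ce_mult ca_mult)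
qed

lemma kern_V: "kern V = carrier R"
  using ce_off cx_off EV by (auto simp: zigzag_kern_def intro!: ca_off)

end

context zigzag_basis
begin

lemma kern_empty: "kern {} = {\<zero>}"
  by (auto simp: zigzag_kern_def coeffs_zero fun_eq_iff intro!: coeffs_inj)

end

text \<open>The image takes over the coefficients of any preimage, with those that
  \<open>kern T\<close> leaves free set to zero; \<open>ker\<close> makes this independent of the
  preimage. With T = {} this leads from the path algebra to the zigzag algebra, with general T to
  the quotients in a heredity chain.\<close>

lemma (in zigzag_coeffs) zigzag_basis_hom_image:
  assumes S: "ring S" and h: "h \<in> ring_hom R S" and surj: "h ` carrier R = carrier S"
    and ker: "\<And>a. a \<in> carrier R \<Longrightarrow> h a = \<zero>\<^bsub>S\<^esub> \<longleftrightarrow> a \<in> kern T"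
  obtains ce' ca' cx' where
    "zigzag_basis S (V - T) (D \<union> E `` T) (E \<inter> (V - T) \<times> (V - T)) ce' ca' cx'"
    "\<And>a i. a \<in> carrier R \<Longrightarrow> ce' (h a) i = (if i \<in> T then 0 else ce a i)"
    "\<And>a i j. a \<in> carrier R \<Longrightarrow> ca' (h a) i j = (if i \<in> T \<or> j \<in> T then 0 else ca a i j)"
    "\<And>a i. a \<in> carrier R \<Longrightarrow> cx' (h a) i = (if i \<in> T \<or> i \<in> E `` T then 0 else cx a i)"
proof -
  interpret S: ring S by fact
  interpret h: ring_hom_ring R S h
    by (rule ring_hom_ringI2[OF ring_axioms S h])
  have same: "h a = h b \<longleftrightarrow> (\<forall>i. i \<notin> T \<longrightarrow> ce a i = ce b i) \<and>
      (\<forall>i j. i \<notin> T \<longrightarrow> j \<notin> T \<longrightarrow> ca a i j = ca b i j) \<and>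
      (\<forall>i. i \<notin> T \<longrightarrow> i \<notin> E `` T \<longrightarrow> cx a i = cx b i)" (is "_ \<longleftrightarrow> ?C")
    if ab: "a \<in> carrier R" "b \<in> carrier R" for a b
  proof -
    have "h a = h b \<longleftrightarrow> h a \<oplus>\<^bsub>S\<^esub> \<ominus>\<^bsub>S\<^esub> h b = \<zero>\<^bsub>S\<^esub>"
      using ab S.r_neg1 S.r_neg by (metis S.add.inv_closed S.minus_minus S.minus_equality h.hom_closed)
    also have "\<dots> \<longleftrightarrow> h (a \<oplus> \<ominus> b) = \<zero>\<^bsub>S\<^esub>" using ab by simp
    also have "\<dots> \<longleftrightarrow> a \<oplus> \<ominus> b \<in> kern T" using ab by (intro ker) simp
    also have "\<dots> \<longleftrightarrow> ?C"
      using ab by (simp add: zigzag_kern_def ce_add ca_add cx_add coeffs_minus)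
    finally show ?thesis .
  qed
  define rep where "rep b = (SOME a. a \<in> carrier R \<and> h a = b)" for b
  have rep: "rep (h a) \<in> carrier R \<and> h (rep (h a)) = h a" if "a \<in> carrier R" for a
    unfolding rep_def by (rule someI[of _ a]) (use that in simp)
  define ce' where "ce' b i = (if i \<in> T then 0 else ce (rep b) i)" for b i
  define ca' where "ca' b i j = (if i \<in> T \<or> j \<in> T then 0 else ca (rep b) i j)" for b i j
  define cx' where "cx' b i = (if i \<in> T \<or> i \<in> E `` T then 0 else cx (rep b) i)" for b i
  have ce': "ce' (h a) i = (if i \<in> T then 0 else ce a i)"
    and ca': "ca' (h a) i j = (if i \<in> T \<or> j \<in> T then 0 else ca a i j)"
    and cx': "cx' (h a) i = (if i \<in> T \<or> i \<in> E `` T then 0 else cx a i)"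
    if "a \<in> carrier R" for a i j
    using iffD1[OF same[of "rep (h a)" a]] rep[OF that] that by (simp_all add: ce'_def ca'_def cx'_def)
  have S_elim: "\<exists>a\<in>carrier R. s = h a" if "s \<in> carrier S" for s using surj that by blast
  have "zigzag_basis S (V - T) (D \<union> E `` T) (E \<inter> (V - T) \<times> (V - T)) ce' ca' cx'"
  proof unfold_locales
    show "sym (E \<inter> (V - T) \<times> (V - T))" "irrefl (E \<inter> (V - T) \<times> (V - T))"
      using sym_E irrefl_E by (auto simp: sym_def irrefl_def)
  next
    fix s i assume "s \<in> carrier S" "i \<notin> V - T"
    then show "ce' s i = 0" using S_elim[of s] by (auto simp: ce' ce_off)
  next
    fix s i j assume "s \<in> carrier S" "(i, j) \<notin> E \<inter> (V - T) \<times> (V - T)"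
    moreover from this obtain a where "a \<in> carrier R" "s = h a" using S_elim by blast
    ultimately show "ca' s i j = 0" using ca_off[of a i j] EV[of i j] by (auto simp: ca')
  next
    fix s i assume s: "s \<in> carrier S" and i: "i \<notin> V - T \<or> i \<in> D \<union> E `` T"
    from s obtain a where a: "a \<in> carrier R" "s = h a" using S_elim by blast
    show "cx' s i = 0"
    proof (cases "i \<in> T \<or> i \<in> E `` T")
      case True
      then show ?thesis unfolding a(2) cx'[OF a(1)] by simp
    next
      case False
      with i have "i \<notin> V \<or> i \<in> D" by blast
      with False cx_off[OF a(1) this] show ?thesis unfolding a(2) cx'[OF a(1)] by simp
    qed
  next
    fix s t i j assume st: "s \<in> carrier S" "t \<in> carrier S"
    obtain a b where ab: "a \<in> carrier R" "b \<in> carrier R" "s = h a" "t = h b"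
      using S_elim[OF st(1)] S_elim[OF st(2)] by blast
    have st: "s \<oplus>\<^bsub>S\<^esub> t = h (a \<oplus> b)" "s \<otimes>\<^bsub>S\<^esub> t = h (a \<otimes> b)" using ab by simp_all
    have R: "a \<oplus> b \<in> carrier R" "a \<otimes> b \<in> carrier R" using ab by simp_all
    show "ce' (s \<oplus>\<^bsub>S\<^esub> t) i = ce' s i + ce' t i" "ca' (s \<oplus>\<^bsub>S\<^esub> t) i j = ca' s i j + ca' t i j"
      "cx' (s \<oplus>\<^bsub>S\<^esub> t) i = cx' s i + cx' t i" "ce' (s \<otimes>\<^bsub>S\<^esub> t) i = ce' s i * ce' t i"
      "ca' (s \<otimes>\<^bsub>S\<^esub> t) i j = ce' s i * ca' t i j + ca' s i j * ce' t j"
      unfolding st using ab R by (simp_all add: ce' ca' cx' ce_add ca_add cx_add ce_mult ca_mult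
          del: h.hom_add h.hom_mult)
    show "cx' (s \<otimes>\<^bsub>S\<^esub> t) i = ce' s i * cx' t i + cx' s i * ce' t i + (\<Sum>j\<in>V - T. ca' s i j * ca' t j i)"
      if i: "i \<notin> D \<union> E `` T"
    proof (cases "i \<in> T")
      case True
      then show ?thesis unfolding st using ab R by (simp add: ce' ca' cx' del: h.hom_mult)
    next
      case False
      \<comment> \<open>Detours through T contribute nothing, because i has no neighbor in
        T.\<close>
      have "(\<Sum>j\<in>V. ca a i j * ca b j i) = (\<Sum>j\<in>V - T. ca a i j * ca b j i)"
      proof (rule sum.mono_neutral_right)
        show "\<forall>j\<in>V - (V - T). ca a i j * ca b j i = 0"
        proof
          fix j assume "j \<in> V - (V - T)"
          then have "(i, j) \<notin> E" using i E_sym by blast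
          then show "ca a i j * ca b j i = 0" using ca_off ab by simp
        qed
      qed (use finite_V in auto)
      also have "\<dots> = (\<Sum>j\<in>V - T. ca' s i j * ca' t j i)"
        using False ab by (intro sum.cong) (auto simp: ca')
      finally show ?thesis unfolding st using False i ab R by (simp add: ce' cx' cx_mult del: h.hom_mult)
    qed
  next
    fix i j
    have S1: "\<one>\<^bsub>S\<^esub> = h \<one>" by simp
    show "ce' \<one>\<^bsub>S\<^esub> i = 1" if "i \<in> V - T" unfolding S1 using that by (simp add: ce' ce_one del: h.hom_one)
    show "ca' \<one>\<^bsub>S\<^esub> i j = 0" "cx' \<one>\<^bsub>S\<^esub> i = 0"
      unfolding S1 by (simp_all add: ca' cx' ca_one cx_one del: h.hom_one)
  next
    fix e x :: "'v \<Rightarrow> 'k" and f :: "'v \<Rightarrow> 'v \<Rightarrow> 'k"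
    assume e: "\<And>i. i \<notin> V - T \<Longrightarrow> e i = 0" and f: "\<And>i j. (i, j) \<notin> E \<inter> (V - T) \<times> (V - T) \<Longrightarrow> f i j = 0"
      and x: "\<And>i. i \<notin> V - T \<or> i \<in> D \<union> E `` T \<Longrightarrow> x i = 0"
    obtain a where "a \<in> carrier R" "ce a = e" "ca a = f" "cx a = x"
      using coeffs_surj[of e f x] e f x by auto
    then show "\<exists>s\<in>carrier S. ce' s = e \<and> ca' s = f \<and> cx' s = x"
      using e f x by (intro bexI[of _ "h a"]) (auto simp: ce' ca' cx' fun_eq_iff)
  next
    fix s t
    assume st: "s \<in> carrier S" "t \<in> carrier S" and eq: "ce' s = ce' t" "ca' s = ca' t" "cx' s = cx' t"
    obtain a b where ab: "a \<in> carrier R" "b \<in> carrier R" "s = h a" "t = h b"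
      using S_elim[OF st(1)] S_elim[OF st(2)] by blast
    have "i \<notin> T \<Longrightarrow> ce a i = ce b i" for i
      using fun_cong[OF eq(1), of i] ab by (simp add: ce')
    moreover have "i \<notin> T \<Longrightarrow> j \<notin> T \<Longrightarrow> ca a i j = ca b i j" for i j
      using fun_cong[OF fun_cong[OF eq(2), of i], of j] ab by (simp add: ca')
    moreover have "i \<notin> T \<Longrightarrow> i \<notin> E `` T \<Longrightarrow> cx a i = cx b i" for i
      using fun_cong[OF eq(3), of i] ab by (simp add: cx')
    ultimately have "h a = h b" unfolding same[OF ab(1,2)] by blast
    then show "s = t" using ab by simp
  qed (use finite_V in auto)
  then show ?thesis by (rule that[OF _ ce' ca' cx'])
qed

text \<open>For vertices outside T, deleting T does not change whether they are adjacent to T', and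
  at neighbors of T the x-coefficients of the image vanish anyway. This matches ideals of the
  quotient with ideals above \<open>kern T\<close>.\<close>

lemma (in zigzag_coeffs) zigzag_kern_vimage:
  assumes "T' \<subseteq> V - T" "h ` carrier R \<subseteq> carrier S"
    and "\<And>a i. a \<in> carrier R \<Longrightarrow> ce' (h a) i = (if i \<in> T then 0 else ce a i)"
    and "\<And>a i j. a \<in> carrier R \<Longrightarrow> ca' (h a) i j = (if i \<in> T \<or> j \<in> T then 0 else ca a i j)"
    and "\<And>a i. a \<in> carrier R \<Longrightarrow> cx' (h a) i = (if i \<in> T \<or> i \<in> E `` T then 0 else cx a i)"
    and a: "a \<in> carrier R"
  shows "h a \<in> zigzag_kern S (E \<inter> (V - T) \<times> (V - T)) ce' ca' cx' T' \<longleftrightarrow> a \<in> kern (T \<union> T')"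
proof -
  have "i \<in> (E \<inter> (V - T) \<times> (V - T)) `` T' \<longleftrightarrow> i \<in> E `` T'" if "i \<notin> T" for i
    using assms(1) that EV by blast
  then have "(\<forall>i. i \<notin> T' \<longrightarrow> i \<notin> (E \<inter> (V - T) \<times> (V - T)) `` T' \<longrightarrow> cx' (h a) i = 0) \<longleftrightarrow>
      (\<forall>i. i \<notin> T \<union> T' \<longrightarrow> i \<notin> E `` (T \<union> T') \<longrightarrow> cx a i = 0)"
    using a by (auto simp: assms(5) Image_Un)
  moreover have "h a \<in> carrier S" using a assms(2) by blast
  moreover have "(\<forall>i. i \<notin> T' \<longrightarrow> ce' (h a) i = 0) \<longleftrightarrow> (\<forall>i. i \<notin> T \<union> T' \<longrightarrow> ce a i = 0)"
    "(\<forall>i j. i \<notin> T' \<longrightarrow> j \<notin> T' \<longrightarrow> ca' (h a) i j = 0) \<longleftrightarrow>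
      (\<forall>i j. i \<notin> T \<union> T' \<longrightarrow> j \<notin> T \<union> T' \<longrightarrow> ca a i j = 0)"
    using a by (auto simp: assms(3,4))
  ultimately show ?thesis using a unfolding zigzag_kern_def by simp
qed

section \<open>Basis elements and multiplication by them\<close>

context zigzag_coeffs
begin

text \<open>Truncating the arguments to the admissible supports makes the choice possible for all
  \<open>e\<close>, \<open>f\<close>, \<open>x\<close>, which avoids side conditions. Uniqueness is
  guaranteed only in \<open>zigzag_basis\<close>.\<close>

definition coeff_elem :: "('v \<Rightarrow> 'k) \<Rightarrow> ('v \<Rightarrow> 'v \<Rightarrow> 'k) \<Rightarrow> ('v \<Rightarrow> 'k) \<Rightarrow> 'a" where
  "coeff_elem e f x = (SOME a. a \<in> carrier R \<and>
     ce a = (\<lambda>i. if i \<in> V then e i else 0) \<and> ca a = (\<lambda>i j. if (i, j) \<in> E then f i j else 0) \<and>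
     cx a = (\<lambda>i. if i \<in> V - D then x i else 0))"

lemma coeff_elem:
  shows coeff_elem_closed [simp]: "coeff_elem e f x \<in> carrier R"
    and ce_coeff_elem: "ce (coeff_elem e f x) i = (if i \<in> V then e i else 0)"
    and ca_coeff_elem: "ca (coeff_elem e f x) i j = (if (i, j) \<in> E then f i j else 0)"
    and cx_coeff_elem: "cx (coeff_elem e f x) i = (if i \<in> V - D then x i else 0)"
proof -
  have "\<exists>a\<in>carrier R. ce a = (\<lambda>i. if i \<in> V then e i else 0) \<and>
      ca a = (\<lambda>i j. if (i, j) \<in> E then f i j else 0) \<and> cx a = (\<lambda>i. if i \<in> V - D then x i else 0)"
    by (rule coeffs_surj) auto
  then have *: "coeff_elem e f x \<in> carrier R \<and>
     ce (coeff_elem e f x) = (\<lambda>i. if i \<in> V then e i else 0) \<and>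
     ca (coeff_elem e f x) = (\<lambda>i j. if (i, j) \<in> E then f i j else 0) \<and>
     cx (coeff_elem e f x) = (\<lambda>i. if i \<in> V - D then x i else 0)"
    unfolding coeff_elem_def by (rule someI_ex[OF iffD1[OF Bex_def]])
  then show "coeff_elem e f x \<in> carrier R" "ce (coeff_elem e f x) i = (if i \<in> V then e i else 0)"
    "ca (coeff_elem e f x) i j = (if (i, j) \<in> E then f i j else 0)"
    "cx (coeff_elem e f x) i = (if i \<in> V - D then x i else 0)" by simp_all
qed

definition vertex :: "'v \<Rightarrow> 'a" where
  "vertex k = coeff_elem (\<lambda>i. if i = k then 1 else 0) (\<lambda>i j. 0) (\<lambda>i. 0)"

definition arrow :: "'v \<Rightarrow> 'v \<Rightarrow> 'a" where
  "arrow k l = coeff_elem (\<lambda>i. 0) (\<lambda>i j. if i = k \<and> j = l then 1 else 0) (\<lambda>i. 0)"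

definition loop :: "'v \<Rightarrow> 'a" where
  "loop k = coeff_elem (\<lambda>i. 0) (\<lambda>i j. 0) (\<lambda>i. if i = k then 1 else 0)"

lemma vertex_coeffs [simp]:
  "vertex k \<in> carrier R" "ce (vertex k) i = (if i = k \<and> k \<in> V then 1 else 0)"
  "ca (vertex k) i j = 0" "cx (vertex k) i = 0"
  by (auto simp: vertex_def ce_coeff_elem ca_coeff_elem cx_coeff_elem)

lemma arrow_coeffs [simp]:
  "arrow k l \<in> carrier R" "ce (arrow k l) i = 0"
  "ca (arrow k l) i j = (if i = k \<and> j = l \<and> (k, l) \<in> E then 1 else 0)" "cx (arrow k l) i = 0"
  by (auto simp: arrow_def ce_coeff_elem ca_coeff_elem cx_coeff_elem)

lemma loop_coeffs [simp]:
  "loop k \<in> carrier R" "ce (loop k) i = 0" "ca (loop k) i j = 0"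
  "cx (loop k) i = (if i = k \<and> k \<in> V \<and> k \<notin> D then 1 else 0)"
  by (auto simp: loop_def ce_coeff_elem ca_coeff_elem cx_coeff_elem)

end

context zigzag_coeffs
begin

text \<open>Plays the part of c times the unit: the locale sees the algebra as a ring, so field
  elements act through left multiplication by this element.\<close>

definition scalar :: "'k \<Rightarrow> 'a" where
  "scalar c = coeff_elem (\<lambda>i. c) (\<lambda>i j. 0) (\<lambda>i. 0)"

lemma scalar_mult_coeffs [simp]:
  assumes "a \<in> carrier R"
  shows "scalar c \<in> carrier R" "ce (scalar c \<otimes> a) i = c * ce a i"
    "ca (scalar c \<otimes> a) i j = c * ca a i j" "cx (scalar c \<otimes> a) i = c * cx a i"
proof -
  show c: "scalar c \<in> carrier R" by (simp add: scalar_def)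
  show "ce (scalar c \<otimes> a) i = c * ce a i"
    using assms c ce_off[of a i] by (simp add: ce_mult scalar_def ce_coeff_elem)
  show "ca (scalar c \<otimes> a) i j = c * ca a i j"
    using assms c ca_off[of a i j] EV(1)[of i j]
    by (auto simp add: ca_mult scalar_def ce_coeff_elem ca_coeff_elem)
  show "cx (scalar c \<otimes> a) i = c * cx a i"
    using assms c cx_off[of a i] cx_off[of "scalar c \<otimes> a" i]
    by (cases "i \<in> V \<and> i \<notin> D")
      (auto simp add: cx_mult scalar_def ce_coeff_elem ca_coeff_elem cx_coeff_elem)
qed

lemma vertex_mult_coeffs [simp]:
  assumes "a \<in> carrier R"
  shows "ce (vertex k \<otimes> a) i = (if i = k then ce a i else 0)"
    "ca (vertex k \<otimes> a) i j = (if i = k then ca a i j else 0)"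
    "cx (vertex k \<otimes> a) i = (if i = k then cx a i else 0)"
    "ce (a \<otimes> vertex k) i = (if i = k then ce a i else 0)"
    "ca (a \<otimes> vertex k) i j = (if j = k then ca a i j else 0)"
    "cx (a \<otimes> vertex k) i = (if i = k then cx a i else 0)"
proof -
  note z = assms ce_off[of a k] ca_off[of a i j] EV[of i j] cx_off[of a i]
    cx_off[of "vertex k \<otimes> a" i] cx_off[of "a \<otimes> vertex k" i]
  show "ce (vertex k \<otimes> a) i = (if i = k then ce a i else 0)"
    "ce (a \<otimes> vertex k) i = (if i = k then ce a i else 0)"
    using z by (auto simp: ce_mult)
  show "ca (vertex k \<otimes> a) i j = (if i = k then ca a i j else 0)"
    "ca (a \<otimes> vertex k) i j = (if j = k then ca a i j else 0)"
    using z by (auto simp: ca_mult)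
  show "cx (vertex k \<otimes> a) i = (if i = k then cx a i else 0)"
    "cx (a \<otimes> vertex k) i = (if i = k then cx a i else 0)"
    using z by (cases "i \<in> D"; auto simp: cx_mult)+
qed

lemma arrow_mult_coeffs [simp]:
  assumes a: "a \<in> carrier R" and kl: "(k, l) \<in> E"
  shows "ce (arrow k l \<otimes> a) i = 0" "ce (a \<otimes> arrow k l) i = 0"
    "ca (arrow k l \<otimes> a) i j = (if i = k \<and> j = l then ce a l else 0)"
    "ca (a \<otimes> arrow k l) i j = (if i = k \<and> j = l then ce a k else 0)"
    "cx (arrow k l \<otimes> a) i = (if i = k \<and> i \<notin> D then ca a l k else 0)"
    "cx (a \<otimes> arrow k l) i = (if i = l \<and> i \<notin> D then ca a l k else 0)"
proof -
  show "ce (arrow k l \<otimes> a) i = 0" "ce (a \<otimes> arrow k l) i = 0"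
    using a by (simp_all add: ce_mult)
  show "ca (arrow k l \<otimes> a) i j = (if i = k \<and> j = l then ce a l else 0)"
    "ca (a \<otimes> arrow k l) i j = (if i = k \<and> j = l then ce a k else 0)"
    using a kl by (auto simp add: ca_mult)
  have "(\<Sum>j\<in>V. ca (arrow k l) i j * ca a j i) = (\<Sum>j\<in>V. if j = l then (if i = k then ca a l i else 0) else 0)"
    using kl by (intro sum.cong) auto
  then have 1: "(\<Sum>j\<in>V. ca (arrow k l) i j * ca a j i) = (if i = k then ca a l i else 0)"
    using finite_V EV(2)[OF kl] by simp
  have "(\<Sum>j\<in>V. ca a i j * ca (arrow k l) j i) = (\<Sum>j\<in>V. if j = k then (if i = l then ca a i k else 0) else 0)"
    using kl by (intro sum.cong) auto
  then have 2: "(\<Sum>j\<in>V. ca a i j * ca (arrow k l) j i) = (if i = l then ca a i k else 0)"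
    using finite_V EV(1)[OF kl] by simp
  show "cx (arrow k l \<otimes> a) i = (if i = k \<and> i \<notin> D then ca a l k else 0)"
    using a 1 cx_off[of "arrow k l \<otimes> a" i]
    by (cases "i \<in> D") (auto simp: cx_mult simp del: arrow_coeffs(3))
  show "cx (a \<otimes> arrow k l) i = (if i = l \<and> i \<notin> D then ca a l k else 0)"
    using a 2 cx_off[of "a \<otimes> arrow k l" i]
    by (cases "i \<in> D") (auto simp: cx_mult simp del: arrow_coeffs(3))
qed

end

section \<open>Jacobson radical and idempotent ideals\<close>

context zigzag_basis
begin

lemma coeffs_eqI:
  assumes "a \<in> carrier R" "b \<in> carrier R" "\<And>i. ce a i = ce b i" "\<And>i j. ca a i j = ca b i j"
    "\<And>i. cx a i = cx b i"
  shows "a = b"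
  using assms by (intro coeffs_inj ext)

text \<open>Multiples of \<open>a\<close> again have no part at the e_i; a product of two such
  elements only has coefficients at the x_i, and a product of three is zero.\<close>

lemma nilpotent_in_jacobson_radical:
  assumes a: "a \<in> carrier R" and ce: "\<And>i. ce a i = 0"
  shows "a \<in> jacobson_radical R"
proof (rule jacobson_radicalI_cube_zero[OF a])
  fix r assume r: "r \<in> carrier R"
  define n where "n = r \<otimes> a"
  have n: "n \<in> carrier R" "\<And>i. ce n i = 0" using a r by (auto simp: n_def ce ce_mult)
  have nn: "ce (n \<otimes> n) i = 0" "ca (n \<otimes> n) i j = 0" for i j
    using n by (auto simp: ce_mult ca_mult)
  show "(r \<otimes> a) \<otimes> ((r \<otimes> a) \<otimes> (r \<otimes> a)) = \<zero>"
    unfolding n_def[symmetric]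
  proof (rule coeffs_eqI)
    fix i show "cx (n \<otimes> (n \<otimes> n)) i = cx \<zero> i"
      using n nn cx_off[of "n \<otimes> (n \<otimes> n)" i] by (cases "i \<in> D") (auto simp: cx_mult coeffs_zero)
  qed (use n nn in \<open>auto simp: ce_mult ca_mult coeffs_zero\<close>)
qed

text \<open>Taking the coefficient at e_i is a ring homomorphism onto a field, so its kernel is a
  maximal left ideal.\<close>

lemma jacobson_radical_ce:
  assumes r: "r \<in> jacobson_radical R"
  shows "ce r i = 0"
proof (cases "i \<in> V")
  case True
  let ?M = "{a \<in> carrier R. ce a i = 0}"
  have "left_ideal ?M R" by (rule left_idealI) (auto simp: ce_add ce_mult coeffs_zero)
  moreover have "\<one> \<notin> ?M" using ce_one[OF True] by simp
  then have "?M \<noteq> carrier R" using one_closed by blast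
  moreover have "I = carrier R" if I: "left_ideal I R" "?M \<subseteq> I" "I \<noteq> ?M" for I
  proof -
    note ID = left_idealD[OF I(1)]
    obtain a where a: "a \<in> I" "a \<in> carrier R" "ce a i \<noteq> 0" using I ID(1) by blast
    \<comment> \<open>Scaled so that 1 - \<open>?b\<close> has coefficient zero at e_i and lies in
      \<open>?M\<close>; a left ideal containing both contains 1.\<close>
    let ?b = "scalar (1 / ce a i) \<otimes> a"
    have b: "?b \<in> I" "?b \<in> carrier R" "ce ?b i = 1" using ID(4) a by auto
    have "\<one> \<oplus> \<ominus> ?b \<in> ?M"
      using a b True by (simp add: ce_add coeffs_minus ce_one del: scalar_mult_coeffs)
    then have "\<one> \<oplus> \<ominus> ?b \<in> I" using I(2) by blast
    then have "(\<one> \<oplus> \<ominus> ?b) \<oplus> ?b \<in> I" using ID(3) b(1) by blast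
    then have "\<one> \<in> I" using b(2) by (simp add: a_assoc l_neg)
    then show ?thesis using ID(1) ID(4)[of _ \<one>] by auto
  qed
  ultimately have "maximal_left_ideal ?M R" unfolding maximal_left_ideal_def by blast
  with r show ?thesis by (auto simp: jacobson_radical_def)
next
  case False
  with r show ?thesis by (auto simp: jacobson_radical_def ce_off)
qed

text \<open>Peirce decomposition: \<open>a\<close> is the sum of all e_i a e_j because the e_i sum
  to 1. The partial sums \<open>e T\<close> of idempotents permit induction over the vertices on
  either side.\<close>

lemma mem_by_vertices:
  assumes a: "a \<in> carrier R" and U: "\<zero> \<in> U" "\<And>b c. b \<in> U \<Longrightarrow> c \<in> U \<Longrightarrow> b \<oplus> c \<in> U"
    and mem: "\<And>i j. i \<in> V \<Longrightarrow> j \<in> V \<Longrightarrow> vertex i \<otimes> a \<otimes> vertex j \<in> U"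
  shows "a \<in> U"
proof -
  define e where "e T = coeff_elem (\<lambda>i. if i \<in> T then 1 else 0) (\<lambda>i j. 0) (\<lambda>i. 0)" for T
  have e_carr: "e T \<in> carrier R" for T by (simp add: e_def)
  have e_empty: "e {} = \<zero>"
    by (rule coeffs_eqI) (auto simp: e_def ce_coeff_elem ca_coeff_elem cx_coeff_elem coeffs_zero)
  have e_insert: "e (insert i T) = vertex i \<oplus> e T" if "i \<notin> T" "i \<in> V" for i T
    using that
    by (intro coeffs_eqI)
      (auto simp: e_def ce_coeff_elem ca_coeff_elem cx_coeff_elem ce_add ca_add cx_add)
  have e_V: "e V = \<one>"
    by (rule coeffs_eqI)
      (auto simp: e_def ce_coeff_elem ca_coeff_elem cx_coeff_elem ce_one_if ca_one cx_one)
  have 1: "vertex i \<otimes> a \<otimes> e T \<in> U" if i: "i \<in> V" and "finite T" "T \<subseteq> V" for i T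
    using that(2,3)
  proof (induction T rule: finite_induct)
    case empty
    then show ?case using a U(1) by (simp add: e_empty)
  next
    case (insert j T)
    then show ?case using a e_carr U(2) mem[OF i, of j] by (simp add: e_insert r_distr)
  qed
  have 2: "e T \<otimes> a \<in> U" if "finite T" "T \<subseteq> V" for T
    using that
  proof (induction T rule: finite_induct)
    case empty
    then show ?case using a U(1) by (simp add: e_empty)
  next
    case (insert j T)
    have "vertex j \<otimes> a \<in> U" using 1[of j V] insert.prems finite_V a by (simp add: e_V)
    then show ?case using insert a e_carr U(2) by (simp add: e_insert l_distr)
  qed
  from 2[of V] show ?thesis using finite_V a by (simp add: e_V)
qed

text \<open>An element of J with nonzero coefficient at e_i gives a unit of the local ring e_i R
  e_i, hence e_i lies in J. At all other vertices the e-coefficients vanish on J, and J = JJ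
  propagates this: products have no arrows between such vertices, and by J = JJ again no part at x_i
  unless i is in \<open>?S\<close> or adjacent to it.\<close>

lemma idempotent_ideal_eq_kern:
  assumes J: "ideal J R" and JJ: "J \<cdot> J = J"
  shows "J = kern {i \<in> V. vertex i \<in> J}"
proof -
  interpret J: ideal J R by fact
  let ?S = "{i \<in> V. vertex i \<in> J}"
  have ceJ: "ce a i = 0" if a: "a \<in> J" and i: "i \<notin> ?S" for a i
  proof (rule ccontr)
    assume c: "ce a i \<noteq> 0"
    have aR: "a \<in> carrier R" using a by simp
    then have iV: "i \<in> V" using c ce_off by blast
    let ?b = "vertex i \<otimes> a \<otimes> vertex i"
    \<comment> \<open>Inverse of \<open>?b\<close> = \<alpha> e_i + \<beta> x_i in e_i R e_i, where
      x_i squares to zero: (1/\<alpha>) e_i - (\<beta>/\<alpha>^2) x_i.\<close>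
    let ?c = "coeff_elem (\<lambda>k. if k = i then 1 / ce a i else 0) (\<lambda>k l. 0)
      (\<lambda>k. if k = i then - cx a i / (ce a i * ce a i) else 0)"
    have b: "?b \<in> carrier R" using aR by simp
    have "?b \<otimes> ?c = vertex i"
    proof (rule coeffs_eqI)
      fix k l
      show "ce (?b \<otimes> ?c) k = ce (vertex i) k"
        using b aR c iV by (auto simp: ce_mult ce_coeff_elem)
      show "ca (?b \<otimes> ?c) k l = ca (vertex i) k l"
        using b aR c E_neq ca_off[OF aR, of i i]
        by (auto simp: ca_mult ce_coeff_elem ca_coeff_elem)
      show "cx (?b \<otimes> ?c) k = cx (vertex i) k"
        using b aR c iV cx_off[of "?b \<otimes> ?c" k]
        by (cases "k \<in> D") (auto simp: cx_mult ce_coeff_elem ca_coeff_elem cx_coeff_elem divide_simps)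
    qed (use b in auto)
    moreover have "?b \<otimes> ?c \<in> J" using a by (simp add: J.I_l_closed J.I_r_closed)
    ultimately show False using i iV by simp
  qed
  have JR: "b \<in> carrier R" if "b \<in> J" for b using that by simp
  have ca_prod: "s \<in> carrier R \<and> ca s i j = 0" if "s \<in> J \<cdot> J" and ij: "i \<notin> ?S" "j \<notin> ?S" for s i j
    using that(1)
  proof (induction s rule: ideal_prod.induct)
    case (prod b c)
    then show ?case using ceJ[OF prod(1) ij(1)] ceJ[OF prod(2) ij(2)] JR by (simp add: ca_mult)
  qed (simp add: ca_add)
  have cx_prod: "s \<in> carrier R \<and> cx s i = 0"
    if "s \<in> J \<cdot> J" and i: "i \<notin> ?S" "i \<notin> E `` ?S" for s i
    using that(1)
  proof (induction s rule: ideal_prod.induct)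
    case (prod b c)
    have bc: "b \<in> carrier R" "c \<in> carrier R" using prod JR by blast+
    have "ca b i j * ca c j i = 0" for j
    proof (cases "j \<in> ?S")
      case True
      then have "(i, j) \<notin> E" using i(2) E_sym by blast
      then show ?thesis using ca_off bc by simp
    next
      case False
      \<comment> \<open>Second use of J = JJ: the factor \<open>b\<close> is itself a sum of
        products, so \<open>ca_prod\<close> applies to it.\<close>
      then have "ca b i j = 0" using ca_prod[of b i j] i(1) prod(1) JJ by simp
      then show ?thesis by simp
    qed
    then have "(\<Sum>j\<in>V. ca b i j * ca c j i) = 0" by (intro sum.neutral) blast
    then show ?case using bc ceJ[OF prod(1) i(1)] ceJ[OF prod(2) i(1)]
      by (cases "i \<in> D") (simp_all add: cx_mult cx_off)
  qed (simp add: cx_add)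
  have "a \<in> kern ?S" if "a \<in> J" for a
    using ceJ[OF that] ca_prod[of a] cx_prod[of a] JR[OF that] that JJ
    unfolding zigzag_kern_def by blast
  moreover have "a \<in> J" if a: "a \<in> kern ?S" for a
  proof (rule mem_by_vertices)
    show aR: "a \<in> carrier R" using a by (simp add: zigzag_kern_def)
    fix i j assume ij: "i \<in> V" "j \<in> V"
    show "vertex i \<otimes> a \<otimes> vertex j \<in> J"
    proof (cases "i \<in> ?S \<or> j \<in> ?S")
      case True
      then show ?thesis using aR by (auto simp: J.I_l_closed J.I_r_closed)
    next
      case False
      then have z: "ce a i = 0" "ca a i j = 0" using a by (auto simp: zigzag_kern_def)
      show ?thesis
      proof (cases "i = j \<and> i \<in> E `` ?S \<and> i \<notin> D")
        case True
        then obtain k where k: "k \<in> ?S" "(k, i) \<in> E" by blast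
        \<comment> \<open>The remaining piece is a multiple of x_i, which factors through e_k as (i
          -> k) e_k (k -> i).\<close>
        have "vertex i \<otimes> a \<otimes> vertex j = scalar (cx a i) \<otimes> (arrow i k \<otimes> (vertex k \<otimes> arrow k i))"
        proof (rule coeffs_eqI)
          fix l m
          show "ca (vertex i \<otimes> a \<otimes> vertex j) l m
              = ca (scalar (cx a i) \<otimes> (arrow i k \<otimes> (vertex k \<otimes> arrow k i))) l m"
            using aR z True k E_sym[OF k(2)] by simp
          from True have "i = j" "i \<notin> D" by blast+
          then show "cx (vertex i \<otimes> a \<otimes> vertex j) l
              = cx (scalar (cx a i) \<otimes> (arrow i k \<otimes> (vertex k \<otimes> arrow k i))) l"
            using aR z k E_sym[OF k(2)] by simp
        qed (use aR z True k E_sym[OF k(2)] in auto)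
        also have "\<dots> \<in> J"
          using k scalar_mult_coeffs(1)[OF zero_closed] by (intro J.I_l_closed J.I_r_closed) auto
        finally show ?thesis .
      next
        case F: False
        have "vertex i \<otimes> a \<otimes> vertex j = \<zero>"
        proof (rule coeffs_eqI)
          fix l
          show "cx (vertex i \<otimes> a \<otimes> vertex j) l = cx \<zero> l"
            using aR F False a cx_off[OF aR, of i] by (auto simp: coeffs_zero zigzag_kern_def)
        qed (use aR z in \<open>auto simp: coeffs_zero\<close>)
        then show ?thesis by simp
      qed
    qed
  qed (use J.a_closed in auto)
  ultimately show ?thesis by blast
qed

end

section \<open>Hereditary ideals\<close>

context zigzag_basis
begin

lemma hereditary_ideal_necessary:
  assumes "hereditary_ideal J R"
  obtains S where "S \<subseteq> V" "J = kern S"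
    "\<And>i j. i \<in> S \<Longrightarrow> (i, j) \<in> E \<Longrightarrow> j \<notin> S \<and> j \<notin> D"
    "\<And>i j k. i \<in> S \<Longrightarrow> (i, j) \<in> E \<Longrightarrow> (i, k) \<in> E \<Longrightarrow> k = j"
    "\<And>i i' j. i \<in> S \<Longrightarrow> i' \<in> S \<Longrightarrow> (i, j) \<in> E \<Longrightarrow> (i', j) \<in> E \<Longrightarrow> i = i'"
proof -
  from assms have J: "ideal J R" and proj: "projective_left_module R (left_mult_module R J)"
    and JJ: "J \<cdot> J = J" and JNJ: "J \<cdot> jacobson_radical R \<cdot> J = {\<zero>}"
    by (auto simp: hereditary_ideal_def)
  interpret J: ideal J R by fact
  define S where "S = {i \<in> V. vertex i \<in> J}"
  have SV: "S \<subseteq> V" by (auto simp: S_def)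
  have JS: "J = kern S" unfolding S_def by (rule idempotent_ideal_eq_kern[OF J JJ])
  have sandwich: "vertex i \<otimes> n \<otimes> vertex j = \<zero>"
    if "i \<in> S" "j \<in> S" "n \<in> carrier R" "\<And>k. ce n k = 0" for i j n
  proof -
    have "vertex i \<in> J" "vertex j \<in> J" using that by (auto simp: S_def)
    then have "vertex i \<otimes> n \<otimes> vertex j \<in> J \<cdot> jacobson_radical R \<cdot> J"
      using nilpotent_in_jacobson_radical[OF that(3,4)] by (intro ideal_prod.prod)
    then show ?thesis using JNJ by simp
  qed
  \<comment> \<open>An arrow between two vertices of \<open>S\<close> would be a nonzero element e_i
    (i -> j) e_j of J Rad(R) J.\<close>
  have indep: "j \<notin> S" if i: "i \<in> S" and ij: "(i, j) \<in> E" for i j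
  proof
    assume j: "j \<in> S"
    have "ca (vertex i \<otimes> arrow i j \<otimes> vertex j) i j = 0"
      using sandwich[OF i j, of "arrow i j"] by (simp add: coeffs_zero del: vertex_mult_coeffs)
    then show False using ij EV[OF ij] by simp
  qed
  have arrow_J: "arrow i j \<in> J" if "i \<in> S" for i j
    unfolding JS using that by (auto simp: zigzag_kern_def)
  text \<open>A projective module has enough linear forms to detect \<open>arrow i j\<close>; such a form takes
    it to an element with non-zero coefficient at \<open>e\<^sub>i\<close>.\<close>
  have form: "\<exists>\<phi>. left_linear_form R J \<phi> \<and> ce (\<phi> (arrow i j)) i \<noteq> 0"
    if i: "i \<in> S" and ij: "(i, j) \<in> E" for i j
  proof -
    \<comment> \<open>With this \<open>U\<close>, the coefficient of
      \<open>\<phi> (arrow i j) \<otimes> z\<close> at i -> j is nonzero. Since \<open>z\<close> has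
      no coefficient at e_j, it must come from e_i in the first factor.\<close>
    let ?U = "{r \<in> carrier R. ca r i j = 0}"
    obtain \<phi> z where \<phi>: "left_linear_form R J \<phi>" and z: "z \<in> J" and U: "\<phi> (arrow i j) \<otimes> z \<notin> ?U"
    proof (rule projective_left_ideal_form[OF proj, of "arrow i j" ?U])
      show "J \<subseteq> carrier R" by auto
      show "arrow i j \<notin> ?U" using ij by simp
    qed (use arrow_J[OF i] in \<open>auto simp: ca_add coeffs_zero\<close>)
    have "\<phi> (arrow i j) \<in> carrier R" "z \<in> carrier R"
      using left_linear_form.form_closed[OF \<phi> arrow_J[OF i]] z by auto
    moreover have "ce z j = 0" using z indep[OF i ij] unfolding JS zigzag_kern_def by blast
    ultimately show ?thesis using U \<phi> by (auto simp: ca_mult)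
  qed
  have nonzero: "arrow k i \<otimes> arrow i j \<noteq> \<zero>" if i: "i \<in> S" and ij: "(i, j) \<in> E" and ik: "(i, k) \<in> E" for i j k
  proof
    assume 0: "arrow k i \<otimes> arrow i j = \<zero>"
    obtain \<phi> where \<phi>: "left_linear_form R J \<phi>" and ne: "ce (\<phi> (arrow i j)) i \<noteq> 0"
      using form[OF i ij] by blast
    interpret \<phi>: left_linear_form R J \<phi> by fact
    have "arrow k i \<otimes> \<phi> (arrow i j) = \<phi> (\<zero> \<otimes> arrow i j)"
      using \<phi>.form_mult[of "arrow k i" "arrow i j"] arrow_J[OF i] 0 by simp
    also have "\<dots> = \<zero>"
      using \<phi>.form_mult[of \<zero> "arrow i j"] \<phi>.form_closed arrow_J[OF i] by simp
    finally have "ca (arrow k i \<otimes> \<phi> (arrow i j)) k i = 0" by (simp only: coeffs_zero)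
    then show False
      using ne E_sym[OF ik] \<phi>.form_closed[OF arrow_J[OF i]] by simp
  qed
  have degree: "k = j \<and> j \<notin> D" if "i \<in> S" "(i, j) \<in> E" "(i, k) \<in> E" for i j k
  proof (rule ccontr)
    assume F: "\<not> (k = j \<and> j \<notin> D)"
    \<comment> \<open>For k \<noteq> j the two-step path is zero, and for k = j it is x_j, which
      vanishes if j is in D.\<close>
    have "arrow k i \<otimes> arrow i j = \<zero>"
    proof (rule coeffs_eqI)
      fix l show "cx (arrow k i \<otimes> arrow i j) l = cx \<zero> l"
        using that F E_sym[OF that(3)] by (auto simp: coeffs_zero)
    qed (use that E_sym[OF that(3)] in \<open>auto simp: coeffs_zero\<close>)
    with nonzero[OF that] show False by simp
  qed
  have unique: "i = i'" if iS: "i \<in> S" "i' \<in> S" and ij: "(i, j) \<in> E" and ij': "(i', j) \<in> E" for i i' j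
  proof (rule ccontr)
    assume ne: "i \<noteq> i'"
    obtain \<phi> where \<phi>: "left_linear_form R J \<phi>" and c: "ce (\<phi> (arrow i j)) i \<noteq> 0"
      using form[OF iS(1) ij] by blast
    interpret \<phi>: left_linear_form R J \<phi> by fact
    \<comment> \<open>Both products are x_j, or zero for j in D. Under \<open>\<phi>\<close> this
      becomes an equation whose left side can only involve the arrow j -> i and whose right side
      only j -> i'.\<close>
    have "arrow j i \<otimes> arrow i j = arrow j i' \<otimes> arrow i' j"
      by (rule coeffs_eqI) (use ij ij' E_sym[OF ij] E_sym[OF ij'] in auto)
    then have "arrow j i \<otimes> \<phi> (arrow i j) = arrow j i' \<otimes> \<phi> (arrow i' j)"
      using \<phi>.form_mult[of "arrow j i" "arrow i j"] \<phi>.form_mult[of "arrow j i'" "arrow i' j"]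
        arrow_J iS by simp
    then have "ca (arrow j i \<otimes> \<phi> (arrow i j)) j i = ca (arrow j i' \<otimes> \<phi> (arrow i' j)) j i" by simp
    then show False
      using c ne E_sym[OF ij] E_sym[OF ij'] \<phi>.form_closed arrow_J iS by simp
  qed
  show ?thesis
    using SV JS indep degree unique by (intro that[of S]) blast+
qed

text \<open>The ideal is the sum of R e_i and R (i -> j), and the dual basis reads off the two
  components. If j is a neighbor, (j -> i)(i -> j) = x_j is nonzero, so x_j belongs to the second
  summand; x_i = 0 makes e_i Rad(R) e_i vanish. If i is isolated, j is arbitrary and the arrow is
  zero.\<close>

lemma hereditary_ideal_sufficient:
  assumes i: "i \<in> V" "i \<in> D" and nb: "\<And>k. (i, k) \<in> E \<Longrightarrow> k = j \<and> j \<notin> D"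
  shows "hereditary_ideal (kern {i}) R"
proof -
  let ?J = "kern {i}"
  have JD: "y \<in> carrier R" "k \<noteq> i \<Longrightarrow> ce y k = 0" "k \<noteq> i \<Longrightarrow> l \<noteq> i \<Longrightarrow> ca y k l = 0"
    "k \<noteq> i \<Longrightarrow> (i, k) \<notin> E \<Longrightarrow> cx y k = 0" if "y \<in> ?J" for y k l
    using that by (simp_all add: zigzag_kern_def)
  have ca_i: "ca y i k = 0" "ca y k i = 0" if "y \<in> carrier R" "k \<noteq> j" for y k
  proof -
    have "(i, k) \<notin> E" using nb[of k] that(2) by metis
    then have "(i, k) \<notin> E" "(k, i) \<notin> E" using E_sym[of k i] by metis+
    then show "ca y i k = 0" "ca y k i = 0" using ca_off that(1) by simp_all
  qed
  have vertex_J: "vertex i \<in> ?J" and arrow_J: "arrow i j \<in> ?J"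
    by (auto simp: zigzag_kern_def)
  \<comment> \<open>An element y of the ideal is y e_i plus a rest c (i -> j) + d x_j, and the rest
    equals (c e_i + d (j -> i)) (i -> j); \<open>\<psi> y\<close> is the left factor.\<close>
  define \<psi> where "\<psi> y = coeff_elem (\<lambda>k. if k = i then ca y i j else 0)
    (\<lambda>k l. if k = j \<and> l = i then cx y j else 0) (\<lambda>k. 0)" for y
  have \<psi>R: "\<psi> y \<in> carrier R" for y by (simp add: \<psi>_def)
  have ce_\<psi>: "ce (\<psi> y) k = (if k = i then ca y i j else 0)"
    and ca_\<psi>: "ca (\<psi> y) k l = (if k = j \<and> l = i \<and> (i, j) \<in> E then cx y j else 0)"
    and cx_\<psi>: "cx (\<psi> y) k = 0" for y k l
    using i(1) E_sym[of i j] E_sym[of j i]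
    by (auto simp: \<psi>_def ce_coeff_elem ca_coeff_elem cx_coeff_elem)
  have \<psi>J: "\<psi> y \<in> ?J" for y
    using \<psi>R by (auto simp: zigzag_kern_def ce_\<psi> ca_\<psi> cx_\<psi>)
  have J: "ideal ?J R" by (rule kern_ideal)
  interpret J: ideal ?J R by fact
  \<comment> \<open>\<open>vertex i\<close> occurs twice because y e_i is the value of a form and
    e_i the basis element it multiplies. The same formula later shows that y lies in the square of
    the ideal.\<close>
  have decomp: "y = (y \<otimes> vertex i) \<otimes> vertex i \<oplus> \<psi> y \<otimes> arrow i j" if y: "y \<in> ?J" for y
  proof (cases "(i, j) \<in> E")
    case True
    show ?thesis
    proof (rule coeffs_eqI)
      fix k l
      show "ce y k = ce (y \<otimes> vertex i \<otimes> vertex i \<oplus> \<psi> y \<otimes> arrow i j) k"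
        using JD[OF y] True \<psi>R by (simp add: ce_add)
      show "ca y k l = ca (y \<otimes> vertex i \<otimes> vertex i \<oplus> \<psi> y \<otimes> arrow i j) k l"
        using JD(1)[OF y] JD(3)[OF y, of k l] True \<psi>R E_neq[OF True] ca_i(1)[OF JD(1)[OF y], of l]
        by (cases "k = i") (auto simp: ca_add ce_\<psi>)
      show "cx y k = cx (y \<otimes> vertex i \<otimes> vertex i \<oplus> \<psi> y \<otimes> arrow i j) k"
      proof (cases "k = i \<or> k = j")
        case False
        then have "(i, k) \<notin> E" using nb[of k] by metis
        then show ?thesis using False JD(1)[OF y] JD(2)[OF y, of k] JD(4)[OF y, of k] True \<psi>R by (simp add: cx_add)
      qed (use JD(1)[OF y] True \<psi>R E_neq[OF True] nb[OF True] in \<open>auto simp: cx_add ca_\<psi>\<close>)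
    qed (use JD(1)[OF y] \<psi>R in auto)
  next
    case False
    then have E0: "(i, k) \<notin> E" for k using nb[of k] by metis
    then have E0': "(k, i) \<notin> E" for k using E_sym[of k i] by metis
    have a0: "arrow i j = \<zero>" using False by (intro coeffs_eqI) (auto simp: coeffs_zero)
    have c0: "ca y i k = 0" "ca y k i = 0" for k using ca_off[OF JD(1)[OF y]] E0 E0' by auto
    have "y = (y \<otimes> vertex i) \<otimes> vertex i"
    proof (rule coeffs_eqI)
      fix k l
      show "ca y k l = ca (y \<otimes> vertex i \<otimes> vertex i) k l"
        using JD(1)[OF y] JD(3)[OF y, of k l] c0[of k] c0[of l] by (cases "k = i"; cases "l = i") auto
    qed (use JD[OF y] E0 in auto)
    then show ?thesis using a0 \<psi>R JD(1)[OF y] by simp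
  qed
  have "projective_left_module R (left_mult_module R ?J)"
  proof (rule projective_left_moduleI_dual_basis[OF J])
    let ?\<phi> = "\<lambda>x y. if x = vertex i then y \<otimes> vertex i else \<psi> y"
    show "finite {vertex i, arrow i j}" "{vertex i, arrow i j} \<subseteq> ?J"
      using vertex_J arrow_J by auto
    have 1: "left_linear_form R ?J (\<lambda>y. y \<otimes> vertex i)"
      using JD(1) by unfold_locales (auto simp: l_distr m_assoc)
    have 2: "left_linear_form R ?J \<psi>"
    proof (unfold_locales; (rule \<psi>R)?)
      fix a b assume ab: "a \<in> ?J" "b \<in> ?J"
      show "\<psi> (a \<oplus> b) = \<psi> a \<oplus> \<psi> b"
        using JD(1)[OF ab(1)] JD(1)[OF ab(2)] \<psi>R
        by (intro coeffs_eqI) (auto simp: ce_\<psi> ca_\<psi> cx_\<psi> ce_add ca_add cx_add)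
    next
      fix r y assume r: "r \<in> carrier R" and y: "y \<in> ?J"
      have yR: "y \<in> carrier R" using JD(1)[OF y] .
      show "\<psi> (r \<otimes> y) = r \<otimes> \<psi> y"
      proof (rule coeffs_eqI)
        fix k l
        have yj: "ca r i j * ce y j = 0"
          using JD(2)[OF y, of j] ca_off[OF r, of i j] E_neq[of i j] by auto
        show "ce (\<psi> (r \<otimes> y)) k = ce (r \<otimes> \<psi> y) k"
          using r yR \<psi>R yj by (simp add: ce_\<psi> ce_mult ca_mult)
        show "ca (\<psi> (r \<otimes> y)) k l = ca (r \<otimes> \<psi> y) k l"
        proof (cases "k = j \<and> l = i \<and> (i, j) \<in> E")
          case True
          then have "j \<noteq> i" "j \<notin> D" "i \<in> V" using E_neq nb i by blast+
          \<comment> \<open>An arrow of y that ends in j starts in i.\<close>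
          have "(\<Sum>m\<in>V. ca r j m * ca y m j) = (\<Sum>m\<in>V. if m = i then ca r j i * ca y i j else 0)"
            using JD(3)[OF y _ \<open>j \<noteq> i\<close>] by (intro sum.cong) auto
          then have "cx (r \<otimes> y) j = ce r j * cx y j + ca r j i * ca y i j"
            using \<open>j \<notin> D\<close> r yR JD(2)[OF y \<open>j \<noteq> i\<close>] finite_V \<open>i \<in> V\<close> by (simp add: cx_mult)
          then show ?thesis using True r \<psi>R by (simp add: ca_mult ca_\<psi> ce_\<psi>)
        next
          case False
          have "ca r k l = 0 \<or> ce (\<psi> y) l = 0"
            using False ca_off[OF r, of k l] nb[of k] E_sym[of k l] by (auto simp: ce_\<psi>)
          then show ?thesis using False r \<psi>R by (auto simp: ca_mult ca_\<psi>)
        qed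
        show "cx (\<psi> (r \<otimes> y)) k = cx (r \<otimes> \<psi> y) k"
        proof (cases "k \<in> D")
          case True
          then show ?thesis using r \<psi>R by (simp add: cx_\<psi> cx_off)
        next
          case False
          then have "k \<noteq> i" using i by blast
          then show ?thesis using False r \<psi>R by (simp add: cx_mult cx_\<psi> ce_\<psi> ca_\<psi>)
        qed
      qed (use r \<psi>R in auto)
    qed
    show "left_linear_form R ?J (?\<phi> x)" if "x \<in> {vertex i, arrow i j}" for x
      using 1 2 by (cases "x = vertex i") simp_all
    have ne: "arrow i j \<noteq> vertex i"
    proof
      assume "arrow i j = vertex i"
      then have "ce (arrow i j) i = ce (vertex i) i" by (simp only:)
      then show False using i by simp
    qed
    show "y = (\<Oplus>x\<in>{vertex i, arrow i j}. ?\<phi> x y \<otimes> x)" if y: "y \<in> ?J" for y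
    proof -
      have "(\<Oplus>x\<in>{vertex i, arrow i j}. ?\<phi> x y \<otimes> x)
          = ?\<phi> (vertex i) y \<otimes> vertex i \<oplus> (\<Oplus>x\<in>{arrow i j}. ?\<phi> x y \<otimes> x)"
        using ne JD(1)[OF y] \<psi>R by (intro finsum_insert) auto
      also have "(\<Oplus>x\<in>{arrow i j}. ?\<phi> x y \<otimes> x) = \<psi> y \<otimes> arrow i j"
        using ne \<psi>R by (subst finsum_insert) auto
      finally show ?thesis using decomp[OF y] by simp
    qed
  qed
  moreover have "?J \<cdot> ?J = ?J"
  proof
    show "?J \<cdot> ?J \<subseteq> ?J" using ideal_prod_inter[OF J J] by blast
    show "?J \<subseteq> ?J \<cdot> ?J"
    proof
      fix y assume y: "y \<in> ?J"
      have "(y \<otimes> vertex i) \<otimes> vertex i \<oplus> \<psi> y \<otimes> arrow i j \<in> ?J \<cdot> ?J"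
        using \<psi>J J.I_r_closed[OF y, of "vertex i"] vertex_J arrow_J
        by (intro ideal_prod.intros) auto
      then show "y \<in> ?J \<cdot> ?J" using decomp[OF y] by simp
    qed
  qed
  moreover have "?J \<cdot> jacobson_radical R \<cdot> ?J = {\<zero>}"
  proof -
    let ?N = "jacobson_radical R"
    \<comment> \<open>A product of J and Rad(R) has no e_k and no arrow but i -> j. A further factor
      from J has no coefficient at e_j, so the arrow disappears, and a part at x_k would need k = i,
      where x_i = 0.\<close>
    let ?W = "{a \<in> carrier R. (\<forall>k. ce a k = 0) \<and> (\<forall>k l. l \<noteq> j \<longrightarrow> ca a k l = 0)
      \<and> (\<forall>k l. k \<noteq> i \<longrightarrow> ca a k l = 0)}"
    have W: "s \<in> ?W" if "s \<in> ?J \<cdot> ?N" for s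
      using that
    proof (induction s rule: ideal_prod.induct)
      case (prod b r)
      have r: "r \<in> carrier R" "\<And>k. ce r k = 0"
        using prod(2) jacobson_radical_ce by (auto simp: jacobson_radical_def)
      have "ce b k * ca r k l = 0" if "l \<noteq> j \<or> k \<noteq> i" for k l
        using JD(2)[OF prod(1), of k] ca_i(1)[OF r(1), of l] that by (cases "k = i") auto
      then show ?case using JD(1)[OF prod(1)] r by (simp add: ce_mult ca_mult)
    qed (auto simp: ce_add ca_add)
    have "s = \<zero>" if "s \<in> ?J \<cdot> ?N \<cdot> ?J" for s
      using that
    proof (induction s rule: ideal_prod.induct)
      case (prod b d)
      have b: "b \<in> carrier R" "\<And>k. ce b k = 0" "\<And>k l. l \<noteq> j \<or> k \<noteq> i \<Longrightarrow> ca b k l = 0"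
        using W[OF prod(1)] by auto
      have d: "d \<in> carrier R" using JD(1)[OF prod(2)] .
      have bd: "ca b k l * ce d l = 0" for k l
      proof (cases "l = j \<and> k = i")
        case True
        then show ?thesis using ca_off[OF b(1), of k l] E_neq[of k l] JD(2)[OF prod(2), of l] by auto
      qed (use b(3) in auto)
      have *: "cx (b \<otimes> d) k = cx \<zero> k" for k
      proof (cases "k \<in> D")
        case False
        then have "k \<noteq> i" using i by blast
        then have "cx (b \<otimes> d) k = cx b k * ce d k" using False b d by (simp add: cx_mult)
        then show ?thesis using JD(2)[OF prod(2) \<open>k \<noteq> i\<close>] by (simp add: coeffs_zero)
      qed (use b d in \<open>simp add: cx_off\<close>)
      show ?case
        by (rule coeffs_eqI) (use b d bd * in \<open>auto simp: ce_mult ca_mult coeffs_zero\<close>)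
    qed simp
    moreover have "\<zero> \<in> ?N"
      by (rule nilpotent_in_jacobson_radical) (simp_all add: coeffs_zero)
    then have "\<zero> \<otimes> \<zero> \<otimes> \<zero> \<in> ?J \<cdot> ?N \<cdot> ?J" using J.zero_closed by (intro ideal_prod.prod)
    then have "\<zero> \<in> ?J \<cdot> ?N \<cdot> ?J" by simp
    ultimately show ?thesis by blast
  qed
  ultimately show ?thesis using J by (simp add: hereditary_ideal_def)
qed

end

section \<open>Heredity chains and filtrations of the vertex set\<close>

context zigzag_basis
begin

lemma vertices_kern:
  assumes "T \<subseteq> V"
  shows "{i \<in> V. vertex i \<in> kern T} = T"
proof -
  have "vertex i \<in> kern T \<longleftrightarrow> i \<in> T" if "i \<in> V" for i
    using that by (auto simp: zigzag_kern_def)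
  then show ?thesis using assms by blast
qed

text \<open>The elements of the quotient are cosets, so it needs coefficient functions of its own;
  the second conclusion ties its ideals back to those of \<open>R\<close>.\<close>

lemma quotient_kern:
  assumes T: "T \<subseteq> V"
  obtains ce' :: "'a set \<Rightarrow> 'c \<Rightarrow> 'd" and ca' cx' where
    "zigzag_basis (R Quot kern T) (V - T) (D \<union> E `` T) (E \<inter> (V - T) \<times> (V - T)) ce' ca' cx'"
    "\<And>T' a. T' \<subseteq> V - T \<Longrightarrow> a \<in> carrier R \<Longrightarrow>
      kern T +> a \<in> zigzag_kern (R Quot kern T) (E \<inter> (V - T) \<times> (V - T)) ce' ca' cx' T' \<longleftrightarrow>
      a \<in> kern (T \<union> T')"
proof -
  have K: "ideal (kern T) R" by (rule kern_ideal)
  then interpret K: ideal "kern T" R .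
  have hom: "(+>) (kern T) \<in> ring_hom R (R Quot kern T)" by (rule K.rcos_ring_hom)
  have surj: "(+>) (kern T) ` carrier R = carrier (R Quot kern T)"
    by (auto simp: FactRing_def A_RCOSETS_def')
  have ker: "kern T +> a = \<zero>\<^bsub>R Quot kern T\<^esub> \<longleftrightarrow> a \<in> kern T" if "a \<in> carrier R" for a
    using that K.a_rcos_const K.a_rcos_self[of a] by (auto simp: FactRing_def)
  obtain ce' ca' cx' where Q: "zigzag_basis (R Quot kern T) (V - T) (D \<union> E `` T)
      (E \<inter> (V - T) \<times> (V - T)) ce' ca' cx'"
    and coeffs: "\<And>a i. a \<in> carrier R \<Longrightarrow> ce' (kern T +> a) i = (if i \<in> T then 0 else ce a i)"
    "\<And>a i j. a \<in> carrier R \<Longrightarrow> ca' (kern T +> a) i j = (if i \<in> T \<or> j \<in> T then 0 else ca a i j)"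
    "\<And>a i. a \<in> carrier R \<Longrightarrow> cx' (kern T +> a) i = (if i \<in> T \<or> i \<in> E `` T then 0 else cx a i)"
    by (rule zigzag_basis_hom_image[OF K.quotient_is_ring hom surj ker]) (assumption, (rule that; assumption))
  show ?thesis
  proof (rule that[OF Q])
    fix T' a assume "T' \<subseteq> V - T" "a \<in> carrier R"
    then show "kern T +> a \<in> zigzag_kern (R Quot kern T) (E \<inter> (V - T) \<times> (V - T)) ce' ca' cx' T' \<longleftrightarrow>
        a \<in> kern (T \<union> T')"
      using zigzag_kern_vimage[where h = "(+>) (kern T)" and S = "R Quot kern T",
          OF _ _ coeffs] surj by blast
  qed
qed

text \<open>\<open>T l\<close> collects the vertices whose idempotents lie in the l-th ideal. By
  induction this ideal is \<open>kern (T l)\<close>: modulo it, the next ideal is some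
  \<open>kern S\<close> by \<open>hereditary_ideal_necessary\<close>, applied to the graph without
  \<open>T l\<close> and with the vertex condition extended to the neighbors of
  \<open>T l\<close>.\<close>

lemma quasi_hereditary_filtration:
  assumes "quasi_hereditary R"
  obtains k and T :: "nat \<Rightarrow> 'c set" where "T 0 = {}" "T k = V" "\<And>l. l \<le> k \<Longrightarrow> T l \<subseteq> V"
    "\<And>l. l < k \<Longrightarrow> T l \<subseteq> T (Suc l)"
    "\<And>l i j. l < k \<Longrightarrow> i \<in> T (Suc l) - T l \<Longrightarrow> j \<in> V - T l \<Longrightarrow> (i, j) \<in> E \<Longrightarrow>
      j \<notin> T (Suc l) \<and> j \<notin> D \<and> j \<notin> E `` T l"
    "\<And>l i j j'. l < k \<Longrightarrow> i \<in> T (Suc l) - T l \<Longrightarrow> j \<in> V - T l \<Longrightarrow> j' \<in> V - T l \<Longrightarrow>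
      (i, j) \<in> E \<Longrightarrow> (i, j') \<in> E \<Longrightarrow> j = j'"
    "\<And>l i i' j. l < k \<Longrightarrow> i \<in> T (Suc l) - T l \<Longrightarrow> i' \<in> T (Suc l) - T l \<Longrightarrow> j \<in> V - T l \<Longrightarrow>
      (i, j) \<in> E \<Longrightarrow> (i', j) \<in> E \<Longrightarrow> i = i'"
proof -
  obtain k and J :: "nat \<Rightarrow> 'a set" where J0: "J 0 = {\<zero>}" and Jk: "J k = carrier R"
    and ideal: "\<And>l. l \<le> k \<Longrightarrow> ideal (J l) R"
    and step: "\<And>l. l < k \<Longrightarrow> J l \<subset> J (Suc l) \<and>
      hereditary_ideal ((\<lambda>a. J l +> a) ` J (Suc l)) (R Quot J l)"
  proof -
    obtain k and J :: "nat \<Rightarrow> 'a set" where *: "J 0 = {\<zero>}" "J k = carrier R" "\<forall>l\<le>k. ideal (J l) R"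
      "\<forall>l\<in>{1..k}. J (l - 1) \<subset> J l \<and> hereditary_ideal ((\<lambda>a. J (l - 1) +> a) ` J l) (R Quot J (l - 1))"
      using assms unfolding quasi_hereditary_def by blast
    moreover have "J l \<subset> J (Suc l) \<and> hereditary_ideal ((\<lambda>a. J l +> a) ` J (Suc l)) (R Quot J l)"
      if "l < k" for l
      using bspec[OF *(4), of "Suc l"] that by simp
    ultimately show ?thesis using that by blast
  qed
  define T where "T l = {i \<in> V. vertex i \<in> J l}" for l
  have TV: "T l \<subseteq> V" for l by (auto simp: T_def)
  have next_step: "\<exists>S \<subseteq> V - T l. J (Suc l) = kern (T l \<union> S) \<and>
      (\<forall>i j. i \<in> S \<longrightarrow> j \<in> V - T l \<longrightarrow> (i, j) \<in> E \<longrightarrow> j \<notin> S \<and> j \<notin> D \<and> j \<notin> E `` T l) \<and>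
      (\<forall>i j j'. i \<in> S \<longrightarrow> j \<in> V - T l \<longrightarrow> j' \<in> V - T l \<longrightarrow> (i, j) \<in> E \<longrightarrow> (i, j') \<in> E \<longrightarrow> j = j') \<and>
      (\<forall>i i' j. i \<in> S \<longrightarrow> i' \<in> S \<longrightarrow> j \<in> V - T l \<longrightarrow> (i, j) \<in> E \<longrightarrow> (i', j) \<in> E \<longrightarrow> i = i')"
    if l: "l < k" and Jl: "J l = kern (T l)" for l
  proof -
    obtain ce' :: "'a set \<Rightarrow> 'c \<Rightarrow> 'd" and ca' cx' where Q: "zigzag_basis (R Quot kern (T l)) (V - T l) (D \<union> E `` T l)
        (E \<inter> (V - T l) \<times> (V - T l)) ce' ca' cx'"
      and vimage: "\<And>T' a. T' \<subseteq> V - T l \<Longrightarrow> a \<in> carrier R \<Longrightarrow> kern (T l) +> a \<in>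
        zigzag_kern (R Quot kern (T l)) (E \<inter> (V - T l) \<times> (V - T l)) ce' ca' cx' T' \<longleftrightarrow>
        a \<in> kern (T l \<union> T')"
      by (rule quotient_kern[OF TV]) (rule that; assumption)
    interpret Q: zigzag_basis "R Quot kern (T l)" "V - T l" "D \<union> E `` T l"
      "E \<inter> (V - T l) \<times> (V - T l)" ce' ca' cx' by (rule Q)
    have hered: "hereditary_ideal ((\<lambda>a. kern (T l) +> a) ` J (Suc l)) (R Quot kern (T l))"
      using step[OF l] Jl by simp
    obtain S where S: "S \<subseteq> V - T l" "(\<lambda>a. kern (T l) +> a) ` J (Suc l) = Q.kern S"
      "\<And>i j. i \<in> S \<Longrightarrow> (i, j) \<in> E \<inter> (V - T l) \<times> (V - T l) \<Longrightarrow> j \<notin> S \<and> j \<notin> D \<union> E `` T l"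
      "\<And>i j k. i \<in> S \<Longrightarrow> (i, j) \<in> E \<inter> (V - T l) \<times> (V - T l) \<Longrightarrow>
        (i, k) \<in> E \<inter> (V - T l) \<times> (V - T l) \<Longrightarrow> k = j"
      "\<And>i i' j. i \<in> S \<Longrightarrow> i' \<in> S \<Longrightarrow> (i, j) \<in> E \<inter> (V - T l) \<times> (V - T l) \<Longrightarrow>
        (i', j) \<in> E \<inter> (V - T l) \<times> (V - T l) \<Longrightarrow> i = i'"
      by (rule Q.hereditary_ideal_necessary[OF hered]) (rule that; assumption)
    interpret J': ideal "J (Suc l)" R using ideal[of "Suc l"] l by simp
    interpret K: ideal "kern (T l)" R by (rule kern_ideal)
    \<comment> \<open>\<open>J (Suc l)\<close> contains \<open>kern (T l)\<close>, so it is a union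
      of cosets and is determined by its image.\<close>
    have "a \<in> J (Suc l) \<longleftrightarrow> kern (T l) +> a \<in> (\<lambda>a. kern (T l) +> a) ` J (Suc l)"
      if a: "a \<in> carrier R" for a
    proof
      assume "kern (T l) +> a \<in> (\<lambda>a. kern (T l) +> a) ` J (Suc l)"
      then obtain b where b: "b \<in> J (Suc l)" "kern (T l) +> a = kern (T l) +> b" by blast
      then have "a \<in> kern (T l) +> b" using K.a_rcos_self[OF a] by simp
      then obtain h where h: "h \<in> kern (T l)" "a = h \<oplus> b" by (auto simp: a_r_coset_def')
      then have "h \<in> J (Suc l)" using step[OF l] Jl by blast
      then show "a \<in> J (Suc l)" using b h J'.a_closed by blast
    qed blast
    then have "a \<in> J (Suc l) \<longleftrightarrow> a \<in> kern (T l \<union> S)" if "a \<in> carrier R" for a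
      using that vimage[OF S(1) that] unfolding S(2) by blast
    moreover have "kern (T l \<union> S) \<subseteq> carrier R" unfolding zigzag_kern_def by blast
    ultimately have "J (Suc l) = kern (T l \<union> S)"
      using J'.a_subset by blast
    then show ?thesis using S(1,3-5) by (intro exI[of _ S] conjI) blast+
  qed
  have T_0: "T 0 = {}"
    unfolding T_def J0 kern_empty[symmetric] by (rule vertices_kern) simp
  have Jl: "l \<le> k \<Longrightarrow> J l = kern (T l)" for l
  proof (induction l)
    case 0
    show ?case by (simp only: T_0 J0 kern_empty)
  next
    case (Suc l)
    then obtain S where S: "S \<subseteq> V - T l" "J (Suc l) = kern (T l \<union> S)"
      using next_step[of l] by auto
    then have "T (Suc l) = T l \<union> S" unfolding T_def[of "Suc l"] S(2) using TV by (intro vertices_kern) blast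
    with S show ?case by simp
  qed
  have T: "T (Suc l) - T l = S" "T (Suc l) = T l \<union> S"
    if "S \<subseteq> V - T l" "J (Suc l) = kern (T l \<union> S)" for l S
  proof -
    show "T (Suc l) = T l \<union> S"
      unfolding T_def[of "Suc l"] that(2) using TV that(1) by (intro vertices_kern) blast
    then show "T (Suc l) - T l = S" using that(1) by blast
  qed
  show ?thesis
  proof (rule that[of T k])
    show "T 0 = {}" by (rule T_0)
    show "T k = V" by (auto simp: T_def Jk)
    show "T l \<subseteq> V" if "l \<le> k" for l by (rule TV)
  next
    fix l assume l: "l < k"
    then obtain S where S: "S \<subseteq> V - T l" "J (Suc l) = kern (T l \<union> S)"
      "\<And>i j. i \<in> S \<Longrightarrow> j \<in> V - T l \<Longrightarrow> (i, j) \<in> E \<Longrightarrow> j \<notin> S \<and> j \<notin> D \<and> j \<notin> E `` T l"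
      "\<And>i j j'. i \<in> S \<Longrightarrow> j \<in> V - T l \<Longrightarrow> j' \<in> V - T l \<Longrightarrow> (i, j) \<in> E \<Longrightarrow> (i, j') \<in> E \<Longrightarrow> j = j'"
      "\<And>i i' j. i \<in> S \<Longrightarrow> i' \<in> S \<Longrightarrow> j \<in> V - T l \<Longrightarrow> (i, j) \<in> E \<Longrightarrow> (i', j) \<in> E \<Longrightarrow> i = i'"
      using next_step[OF l Jl[OF less_imp_le[OF l]]] by blast
    note TS = T[OF S(1,2)]
    show "T l \<subseteq> T (Suc l)" using TS by blast
    show "j \<notin> T (Suc l) \<and> j \<notin> D \<and> j \<notin> E `` T l"
      if "i \<in> T (Suc l) - T l" "j \<in> V - T l" "(i, j) \<in> E" for i j
      using S(3)[of i j] that TS by blast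
    show "j = j'"
      if "i \<in> T (Suc l) - T l" "j \<in> V - T l" "j' \<in> V - T l" "(i, j) \<in> E" "(i, j') \<in> E" for i j j'
      using S(4)[of i j j'] that TS by blast
    show "i = i'" if "i \<in> T (Suc l) - T l" "i' \<in> T (Suc l) - T l" "j \<in> V - T l"
      "(i, j) \<in> E" "(i', j) \<in> E" for i i' j
      using S(5)[of i i' j] that TS by blast
  qed
qed

text \<open>In the current quotient the removed vertex \<open>v\<close> carries a vertex condition
  and has at most one neighbor left, which carries none: the situation of
  \<open>hereditary_ideal_sufficient\<close>. If no neighbor is left, \<open>j\<close> is
  arbitrary.\<close>

lemma quasi_hereditary_of_filtration:
  assumes k: "k \<ge> 1" and T0: "T 0 = {}" and Tk: "T k = V"
    and step: "\<And>l. l < k \<Longrightarrow> \<exists>v j. v \<in> V - T l \<and> T (Suc l) = insert v (T l) \<and> v \<in> D \<union> E `` T l \<and>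
      (\<forall>m. (v, m) \<in> E \<longrightarrow> m \<notin> T l \<longrightarrow> m = j \<and> m \<notin> D \<union> E `` T l)"
  shows "quasi_hereditary R"
proof -
  have TV: "l \<le> k \<Longrightarrow> T l \<subseteq> V" for l
  proof (induction l)
    case (Suc l)
    then show ?case using step[of l] by auto
  qed (simp add: T0)
  have "kern (T l) \<subset> kern (T (Suc l)) \<and>
      hereditary_ideal ((\<lambda>a. kern (T l) +> a) ` kern (T (Suc l))) (R Quot kern (T l))"
    if l: "l < k" for l
  proof -
    obtain v j where v: "v \<in> V - T l" and Tv: "T (Suc l) = insert v (T l)"
      and vD: "v \<in> D \<union> E `` T l"
      and nb: "\<And>m. (v, m) \<in> E \<Longrightarrow> m \<notin> T l \<Longrightarrow> m = j \<and> m \<notin> D \<union> E `` T l"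
      using step[OF l] by blast
    have Tl: "T l \<subseteq> V" using TV l by simp
    obtain ce' :: "'a set \<Rightarrow> 'c \<Rightarrow> 'd" and ca' cx' where Q: "zigzag_basis (R Quot kern (T l)) (V - T l) (D \<union> E `` T l)
        (E \<inter> (V - T l) \<times> (V - T l)) ce' ca' cx'"
      and vimage: "\<And>T' a. T' \<subseteq> V - T l \<Longrightarrow> a \<in> carrier R \<Longrightarrow> kern (T l) +> a \<in>
        zigzag_kern (R Quot kern (T l)) (E \<inter> (V - T l) \<times> (V - T l)) ce' ca' cx' T' \<longleftrightarrow>
        a \<in> kern (T l \<union> T')"
      by (rule quotient_kern[OF Tl]) (rule that; assumption)
    interpret Q: zigzag_basis "R Quot kern (T l)" "V - T l" "D \<union> E `` T l"
      "E \<inter> (V - T l) \<times> (V - T l)" ce' ca' cx' by (rule Q)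
    have vim: "kern (T l) +> a \<in> Q.kern {v} \<longleftrightarrow> a \<in> kern (T (Suc l))" if "a \<in> carrier R" for a
      using vimage[of "{v}" a] v that Tv by simp
    have "(\<lambda>a. kern (T l) +> a) ` kern (T (Suc l)) = Q.kern {v}"
    proof
      show "(\<lambda>a. kern (T l) +> a) ` kern (T (Suc l)) \<subseteq> Q.kern {v}"
        using vim by (auto simp: zigzag_kern_def[of R])
      show "Q.kern {v} \<subseteq> (\<lambda>a. kern (T l) +> a) ` kern (T (Suc l))"
      proof
        fix s assume s: "s \<in> Q.kern {v}"
        then have "s \<in> carrier (R Quot kern (T l))" by (simp add: zigzag_kern_def)
        then obtain a where "a \<in> carrier R" "s = kern (T l) +> a"
          by (auto simp: FactRing_def A_RCOSETS_def')
        with s vim show "s \<in> (\<lambda>a. kern (T l) +> a) ` kern (T (Suc l))" by blast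
      qed
    qed
    moreover have "hereditary_ideal (Q.kern {v}) (R Quot kern (T l))"
      by (rule Q.hereditary_ideal_sufficient[of v j]) (use v vD nb in auto)
    moreover have "kern (T l) \<subseteq> kern (T (Suc l))"
      unfolding Tv by (auto simp: zigzag_kern_def)
    \<comment> \<open>The ideals determine their vertex sets, and these differ by
      \<open>v\<close>.\<close>
    moreover have "kern (T l) \<noteq> kern (T (Suc l))"
    proof
      assume eq: "kern (T l) = kern (T (Suc l))"
      have "T (Suc l) = T l"
        using vertices_kern[OF TV[OF Suc_leI[OF l]]] unfolding eq[symmetric] vertices_kern[OF Tl]
        by (rule sym)
      then show False using v Tv by blast
    qed
    ultimately show ?thesis by auto
  qed
  note * = this
  have "\<forall>l\<in>{1..k}. kern (T (l - 1)) \<subset> kern (T l) \<and>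
      hereditary_ideal ((\<lambda>a. kern (T (l - 1)) +> a) ` kern (T l)) (R Quot kern (T (l - 1)))"
  proof
    fix l assume "l \<in> {1..k}"
    then obtain m where "l = Suc m" "m < k" by (cases l) auto
    then show "kern (T (l - 1)) \<subset> kern (T l) \<and>
        hereditary_ideal ((\<lambda>a. kern (T (l - 1)) +> a) ` kern (T l)) (R Quot kern (T (l - 1)))"
      using *[of m] by simp
  qed
  then show ?thesis
    unfolding quasi_hereditary_def using k T0 Tk ring_axioms
    by (intro conjI exI[of _ k] exI[of _ "\<lambda>l. kern (T l)"])
      (auto simp only: kern_empty kern_V intro: kern_ideal)
qed

end

section \<open>Graphs with levels\<close>

text \<open>Climb from some c in C to neighbors of higher level as long as possible; levels
  increase, so finiteness ends the climb. A neighbor of a vertex on the climb is its unique upper or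
  its unique lower one, hence its successor or predecessor, and c has no lower one. So the climb is
  closed under adjacency and, by connectedness, exhausts V. Each vertex but c is entered from below
  and so lies outside C.\<close>

lemma path_of_levels:
  fixes level :: "'v \<Rightarrow> nat"
  assumes fin: "finite V" and EV: "E \<subseteq> V \<times> V" and sym: "sym E"
    and conn: "\<And>u v. u \<in> V \<Longrightarrow> v \<in> V \<Longrightarrow> (u, v) \<in> E\<^sup>*"
    and C: "C \<subseteq> V" "C \<noteq> {}"
    and level_neq: "\<And>u v. (u, v) \<in> E \<Longrightarrow> level u \<noteq> level v"
    and not_C: "\<And>u v. (u, v) \<in> E \<Longrightarrow> level u < level v \<Longrightarrow> v \<notin> C"
    and upper: "\<And>u v w. (u, v) \<in> E \<Longrightarrow> (u, w) \<in> E \<Longrightarrow> level u < level v \<Longrightarrow> level u < level w \<Longrightarrow> v = w"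
    and lower: "\<And>u v w. (u, w) \<in> E \<Longrightarrow> (v, w) \<in> E \<Longrightarrow> level u < level w \<Longrightarrow> level v < level w \<Longrightarrow> u = v"
  obtains f and n :: nat where "n \<ge> 1" "bij_betw f {1..n} V"
    "\<And>a b. a \<in> {1..n} \<Longrightarrow> b \<in> {1..n} \<Longrightarrow> (f a, f b) \<in> E \<longleftrightarrow> b = a + 1 \<or> a = b + 1" "C = {f 1}"
proof -
  obtain c where c: "c \<in> C" using C by blast
  define up where "up v = (SOME w. (v, w) \<in> E \<and> level v < level w)" for v
  have up: "(v, up v) \<in> E" "level v < level (up v)" if "(v, w) \<in> E" "level v < level w" for v w
    using someI[of "\<lambda>w. (v, w) \<in> E \<and> level v < level w" w] that by (auto simp: up_def)
  define g where "g m = (up ^^ m) c" for m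
  have g_Suc: "g (Suc m) = up (g m)" for m by (simp add: g_def)
  let ?top = "\<lambda>m. \<forall>w. (g m, w) \<in> E \<longrightarrow> \<not> level (g m) < level w"
  have g_up: "(g m, g (Suc m)) \<in> E \<and> level (g m) < level (g (Suc m))" if "\<not> ?top m" for m
    using that up by (auto simp: g_Suc)
  have "\<exists>m. ?top m"
  proof (rule ccontr)
    assume "\<nexists>m. ?top m"
    then have *: "(g m, g (Suc m)) \<in> E" "level (g m) < level (g (Suc m))" for m
      using g_up by blast+
    have "strict_mono (\<lambda>m. level (g m))" using *(2) by (simp add: strict_mono_Suc_iff)
    then have "inj (\<lambda>m. level (g m))" by (rule strict_mono_imp_inj_on)
    then have "inj g" by (auto simp: inj_on_def)
    moreover have "range g \<subseteq> V" using *(1) EV by blast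
    ultimately show False using fin by (meson finite_subset finite_imageD infinite_UNIV_nat)
  qed
  \<comment> \<open>\<open>up\<close> is a meaningless choice at a vertex without upper neighbor, so
    the climb is cut at the first such vertex.\<close>
  define n where "n = (LEAST m. ?top m)"
  have top: "?top n" unfolding n_def using \<open>\<exists>m. ?top m\<close> by (rule LeastI_ex)
  have edge: "(g m, g (Suc m)) \<in> E" "level (g m) < level (g (Suc m))" if "m < n" for m
    using not_less_Least[of m ?top] that g_up[of m] unfolding n_def by blast+
  have mono: "level (g a) < level (g b)" if "a < b" "b \<le> n" for a b
    using that
  proof (induction b)
    case (Suc b)
    then show ?case using edge(2)[of b] by (cases "a = b") auto
  qed simp
  have inj: "inj_on g {..n}"
  proof (rule inj_onI)
    fix a b assume "a \<in> {..n}" "b \<in> {..n}" "g a = g b"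
    then show "a = b" using mono[of a b] mono[of b a] by (cases a b rule: linorder_cases) auto
  qed
  have g0: "g 0 = c" by (simp add: g_def)
  have nb: "\<exists>b\<le>n. (b = Suc a \<or> a = Suc b) \<and> u = g b" if "a \<le> n" and u: "(g a, u) \<in> E" for a u
  proof (cases "level (g a) < level u")
    case True
    then have "a \<noteq> n" using top u by blast
    then have "a < n" using that by simp
    then have "u = g (Suc a)" using upper[OF u edge(1)] True edge(2) by blast
    then show ?thesis using \<open>a < n\<close> by (intro exI[of _ "Suc a"]) simp
  next
    case False
    then have lt: "level u < level (g a)" using level_neq[OF u] by simp
    have ua: "(u, g a) \<in> E" using u sym by (auto simp: sym_def)
    have "a \<noteq> 0" using not_C[OF ua lt] g0 c by metis
    then obtain b where b: "a = Suc b" by (cases a) auto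
    then have "u = g b" using lower[OF ua edge(1)[of b, folded b]] lt edge(2)[of b] that by simp
    then show ?thesis using b that by (intro exI[of _ b]) simp
  qed
  have V: "V = g ` {..n}"
  proof
    show "g ` {..n} \<subseteq> V"
    proof
      fix v assume "v \<in> g ` {..n}"
      then obtain m where "m \<le> n" "v = g m" by auto
      then show "v \<in> V" using edge(1)[of "m - 1"] EV g0 c C by (cases m) auto
    qed
    show "V \<subseteq> g ` {..n}"
    proof
      fix v assume "v \<in> V"
      then have "(c, v) \<in> E\<^sup>*" using conn c C by blast
      then show "v \<in> g ` {..n}"
      proof (induction rule: rtrancl_induct)
        case base
        then show ?case using g0 by (intro image_eqI[of _ _ 0]) auto
      next
        case (step u v)
        then show ?case using nb by auto
      qed
    qed
  qed
  \<comment> \<open>Shifts the indices 0..n of the climb to 1..n+1.\<close>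
  define f where "f a = g (a - 1)" for a
  show ?thesis
  proof (rule that[of "Suc n" f])
    have "bij_betw (\<lambda>a. a - 1) {1..Suc n} {..n}"
      by (rule bij_betw_byWitness[of _ Suc]) auto
    moreover have "bij_betw g {..n} V" using inj V by (simp add: bij_betw_def)
    ultimately have "bij_betw (g \<circ> (\<lambda>a. a - 1)) {1..Suc n} V" by (rule bij_betw_trans)
    then show "bij_betw f {1..Suc n} V" by (simp add: f_def[abs_def] comp_def)
    show "(f a, f b) \<in> E \<longleftrightarrow> b = a + 1 \<or> a = b + 1"
      if ab: "a \<in> {1..Suc n}" "b \<in> {1..Suc n}" for a b
    proof
      assume "(f a, f b) \<in> E"
      then have "(g (a - 1), g (b - 1)) \<in> E" "a - 1 \<le> n" using ab by (auto simp: f_def)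
      then obtain b' where b': "b' \<le> n" "b' = Suc (a - 1) \<or> a - 1 = Suc b'" "g (b - 1) = g b'"
        using nb by blast
      then have "b - 1 = b'" using inj ab by (auto simp: inj_on_def)
      with b' ab show "b = a + 1 \<or> a = b + 1" by auto
    next
      assume "b = a + 1 \<or> a = b + 1"
      then show "(f a, f b) \<in> E"
        using edge(1)[of "a - 1"] edge(1)[of "b - 1"] ab sym by (auto simp: f_def sym_def)
    qed
    have "v = c" if v: "v \<in> C" for v
    proof -
      obtain m where m: "m \<le> n" "v = g m" using v C V by auto
      show ?thesis
      proof (cases m)
        case (Suc l)
        then have "(g l, g m) \<in> E" "level (g l) < level (g m)" using m edge[of l] by simp_all
        then have "v \<notin> C" unfolding m(2) by (rule not_C)
        then show ?thesis using v by simp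
      qed (use m g0 in simp)
    qed
    then have "C = {c}" using c by blast
    then show "C = {f 1}" by (simp add: f_def g0)
  qed simp
qed

section \<open>Quasi-heredity and paths, both directions\<close>

context zigzag_basis
begin

lemma quasi_hereditary_imp_path:
  assumes "quasi_hereditary R" and D: "D \<subseteq> V" "D \<noteq> {}"
    and conn: "\<And>u v. u \<in> V \<Longrightarrow> v \<in> V \<Longrightarrow> (u, v) \<in> E\<^sup>*"
  obtains f and n :: nat where "n \<ge> 1" "bij_betw f {1..n} V"
    "\<And>a b. a \<in> {1..n} \<Longrightarrow> b \<in> {1..n} \<Longrightarrow> (f a, f b) \<in> E \<longleftrightarrow> b = a + 1 \<or> a = b + 1" "D = {f 1}"
proof -
  obtain k and T :: "nat \<Rightarrow> 'c set" where T0: "T 0 = {}" and Tk: "T k = V"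
    and T_mono1: "\<And>l. l < k \<Longrightarrow> T l \<subseteq> T (Suc l)"
    and T1: "\<And>l i j. l < k \<Longrightarrow> i \<in> T (Suc l) - T l \<Longrightarrow> j \<in> V - T l \<Longrightarrow> (i, j) \<in> E \<Longrightarrow>
      j \<notin> T (Suc l) \<and> j \<notin> D \<and> j \<notin> E `` T l"
    and T2: "\<And>l i j j'. l < k \<Longrightarrow> i \<in> T (Suc l) - T l \<Longrightarrow> j \<in> V - T l \<Longrightarrow> j' \<in> V - T l \<Longrightarrow>
      (i, j) \<in> E \<Longrightarrow> (i, j') \<in> E \<Longrightarrow> j = j'"
    and T3: "\<And>l i i' j. l < k \<Longrightarrow> i \<in> T (Suc l) - T l \<Longrightarrow> i' \<in> T (Suc l) - T l \<Longrightarrow> j \<in> V - T l \<Longrightarrow>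
      (i, j) \<in> E \<Longrightarrow> (i', j) \<in> E \<Longrightarrow> i = i'"
    by (rule quasi_hereditary_filtration[OF assms(1)]) (rule that; assumption)
  \<comment> \<open>Since \<open>T 0\<close> is empty, levels are positive, and
    \<open>level v = Suc l\<close> says that v is removed in the step from \<open>T l\<close> to
    \<open>T (Suc l)\<close>.\<close>
  define level where "level v = (LEAST l. v \<in> T l)" for v
  have T_mono: "a \<le> b \<Longrightarrow> b \<le> k \<Longrightarrow> T a \<subseteq> T b" for a b
  proof (induction b)
    case (Suc b)
    then show ?case using T_mono1[of b] by (cases "a = Suc b") auto
  qed simp
  have level: "v \<in> T (level v)" "level v \<le> k" if "v \<in> V" for v
  proof -
    have "v \<in> T k" using that Tk by simp
    then show "v \<in> T (level v)" "level v \<le> k"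
      unfolding level_def by (rule LeastI, rule Least_le)
  qed
  have mem_T: "v \<in> T l \<longleftrightarrow> level v \<le> l" if "v \<in> V" "l \<le> k" for v l
  proof
    show "v \<in> T l \<Longrightarrow> level v \<le> l" unfolding level_def by (rule Least_le)
    show "level v \<le> l \<Longrightarrow> v \<in> T l" using T_mono[of "level v" l] level[OF that(1)] that by blast
  qed
  have stage: "\<exists>l<k. level v = Suc l \<and> v \<in> T (Suc l) - T l" if v: "v \<in> V" for v
  proof (cases "level v")
    case 0
    then show ?thesis using level(1)[OF v] T0 by simp
  next
    case (Suc l)
    then have "l < k" using level(2)[OF v] by simp
    then show ?thesis using Suc mem_T[OF v, of l] mem_T[OF v, of "Suc l"] by auto
  qed
  have above: "v \<in> V - T l" if "v \<in> V" "l < k" "l < level v" for v l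
    using that mem_T[of v l] by auto
  have le_iff: "level u = Suc l \<Longrightarrow> level v = Suc l \<Longrightarrow> v \<in> V \<Longrightarrow> l < k \<Longrightarrow> v \<in> T (Suc l) - T l" for u v l
    using mem_T[of v l] mem_T[of v "Suc l"] by auto
  \<comment> \<open>If u is removed before v, then w, a neighbor of u, carries a vertex condition
    when v is removed; a remaining neighbor of v must not.\<close>
  have lower_lt: False
    if uw: "(u, w) \<in> E" and vw: "(v, w) \<in> E" and lt: "level u < level v" "level v < level w" for u v w
  proof -
    obtain l where l: "l < k" "level v = Suc l" "v \<in> T (Suc l) - T l" using stage[OF EV(1)[OF vw]] by blast
    have "w \<in> V - T l" using above[OF EV(2)[OF vw] l(1)] lt l(2) by simp
    then have "w \<notin> E `` T l" using T1[OF l(1,3) _ vw] by blast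
    moreover have "u \<in> T l" using mem_T[OF EV(1)[OF uw], of l] lt l by simp
    ultimately show False using uw by blast
  qed
  show ?thesis
  proof (rule path_of_levels[OF finite_V E_V sym_E conn D, of level, OF _ _ _ _ _ _ that])
    show "level u \<noteq> level v" if uv: "(u, v) \<in> E" for u v
    proof
      assume eq: "level u = level v"
      obtain l where l: "l < k" "level u = Suc l" "u \<in> T (Suc l) - T l" using stage[OF EV(1)[OF uv]] by blast
      have "v \<in> T (Suc l) - T l" using le_iff[OF l(2)] eq l EV(2)[OF uv] by simp
      then show False using T1[OF l(1,3) _ uv] EV(2)[OF uv] by blast
    qed
    show "v \<notin> D" if uv: "(u, v) \<in> E" and lt: "level u < level v" for u v
    proof -
      obtain l where l: "l < k" "level u = Suc l" "u \<in> T (Suc l) - T l" using stage[OF EV(1)[OF uv]] by blast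
      have "v \<in> V - T l" using above[OF EV(2)[OF uv] l(1)] lt l(2) by simp
      then show ?thesis using T1[OF l(1,3) _ uv] by blast
    qed
    show "v = w" if uv: "(u, v) \<in> E" and uw: "(u, w) \<in> E" and lt: "level u < level v" "level u < level w"
      for u v w
    proof -
      obtain l where l: "l < k" "level u = Suc l" "u \<in> T (Suc l) - T l" using stage[OF EV(1)[OF uv]] by blast
      have "v \<in> V - T l" "w \<in> V - T l"
        using above[OF EV(2)[OF uv] l(1)] above[OF EV(2)[OF uw] l(1)] lt l(2) by simp_all
      then show ?thesis using T2[OF l(1,3) _ _ uv uw] by blast
    qed
    show "u = v" if uw: "(u, w) \<in> E" and vw: "(v, w) \<in> E" and lt: "level u < level w" "level v < level w"
      for u v w
    proof -
      \<comment> \<open>Neither of the two can be removed first, so both go in the same step, where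
        \<open>T3\<close> applies.\<close>
      have eq: "level u = level v"
        using lower_lt[OF uw vw _ lt(2)] lower_lt[OF vw uw _ lt(1)] by (metis linorder_neqE_nat)
      obtain l where l: "l < k" "level u = Suc l" "u \<in> T (Suc l) - T l" using stage[OF EV(1)[OF uw]] by blast
      have "w \<in> V - T l" using above[OF EV(2)[OF uw] l(1)] lt l(2) by simp
      moreover have "v \<in> T (Suc l) - T l" using le_iff[OF l(2)] eq l EV(1)[OF vw] by simp
      ultimately show ?thesis using T3[OF l(1,3) _ _ uw vw] by blast
    qed
  qed assumption+
qed

text \<open>The vertices are removed in the order f 1, f 2, and so on: f 1 lies in D, and each later
  vertex is adjacent to the one removed just before it, so its x has become zero.\<close>

lemma quasi_hereditary_of_path:
  fixes f :: "nat \<Rightarrow> 'c"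
  assumes n: "n \<ge> 1" and bij: "bij_betw f {1..n} V"
    and edge: "\<And>a b. a \<in> {1..n} \<Longrightarrow> b \<in> {1..n} \<Longrightarrow> (f a, f b) \<in> E \<longleftrightarrow> b = a + 1 \<or> a = b + 1"
    and D: "D = {f 1}"
  shows "quasi_hereditary R"
proof (rule quasi_hereditary_of_filtration[OF n, of "\<lambda>l. f ` {1..l}"])
  show "f ` {1..n} = V" using bij by (simp add: bij_betw_def)
  have inj: "f a = f b \<longleftrightarrow> a = b" if "a \<in> {1..n}" "b \<in> {1..n}" for a b
    by (rule inj_on_eq_iff[OF bij_betw_imp_inj_on[OF bij] that])
  fix l assume l: "l < n"
  \<comment> \<open>For \<open>Suc l = n\<close> the index of \<open>?j\<close> is beyond the end of
    the path; then \<open>?v\<close> has no neighbor left and the claim about \<open>?j\<close> is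
    vacuous.\<close>
  let ?T = "f ` {1..l}" and ?v = "f (Suc l)" and ?j = "f (Suc (Suc l))"
  have V: "f a \<in> V" if "a \<in> {1..n}" for a using bij that by (auto simp: bij_betw_def)
  have T: "f a \<in> ?T \<longleftrightarrow> a \<le> l" if "a \<in> {1..n}" for a
    using that inj l by (force simp: image_iff)
  have 1: "?v \<in> V - ?T" using V[of "Suc l"] T[of "Suc l"] l by simp
  have 2: "f ` {1..Suc l} = insert ?v ?T" by (simp add: atLeastAtMostSuc_conv)
  have 3: "?v \<in> D \<union> E `` ?T"
  proof (cases l)
    case (Suc m)
    then have "(f l, ?v) \<in> E" using edge[of l "Suc l"] l by simp
    then show ?thesis using T[of l] l Suc by auto
  qed (simp add: D)
  have 4: "m = ?j \<and> m \<notin> D \<union> E `` ?T" if m: "(?v, m) \<in> E" "m \<notin> ?T" for m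
  proof -
    obtain b where b: "b \<in> {1..n}" "m = f b" using EV(2)[OF m(1)] bij by (auto simp: bij_betw_def)
    have b': "b = Suc (Suc l)" using edge[of "Suc l" b] m b l T[of b] by auto
    have "m \<notin> D" using inj[of 1 b] b b' l by (auto simp: D)
    moreover have "m \<notin> E `` ?T"
    proof
      assume "m \<in> E `` ?T"
      then obtain a where "a \<in> {1..l}" "(f a, f b) \<in> E" using b by auto
      then show False using edge[of a b] b b' l by auto
    qed
    ultimately show ?thesis using b b' by simp
  qed
  show "\<exists>v j. v \<in> V - ?T \<and> f ` {1..Suc l} = insert v ?T \<and> v \<in> D \<union> E `` ?T \<and>
      (\<forall>m. (v, m) \<in> E \<longrightarrow> m \<notin> ?T \<longrightarrow> m = j \<and> m \<notin> D \<union> E `` ?T)"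
    using 1 2 3 4 by (intro exI[of _ ?v] exI[of _ ?j]) simp
qed simp

end

section \<open>Path algebras\<close>

lemma vwalk_Cons_Cons_iff:
  "vwalk (i # j # p) (with_proj Q) \<longleftrightarrow>
     i \<in> pverts Q \<and> (i, j) \<in> parcs Q \<and> vwalk (j # p) (with_proj Q)"
  by (auto simp: vwalk_def)

lemma vwalk_split:
  "l < length p \<Longrightarrow> vwalk p (with_proj Q) \<longleftrightarrow>
     vwalk (take (Suc l) p) (with_proj Q) \<and> vwalk (drop l p) (with_proj Q)"
proof (induction l arbitrary: p)
  case 0
  then show ?case by (cases p) (auto simp: vwalk_def)
next
  case (Suc l)
  then obtain i j q where p: "p = i # j # q"
    by (metis Suc_length_conv Suc_lessE length_Cons list.exhaust list.size(3) not_less_zero)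
  show ?case using Suc.IH[of "j # q"] Suc.prems unfolding p by (auto simp: vwalk_Cons_Cons_iff)
qed

lemma path_algebra_simps:
  "f \<in> carrier (path_algebra Q) \<longleftrightarrow>
     finite {p. f p \<noteq> 0} \<and> (\<forall>p. f p \<noteq> 0 \<longrightarrow> vwalk p (with_proj Q))"
  "(f \<otimes>\<^bsub>path_algebra Q\<^esub> g) p = (\<Sum>l<length p. f (take (Suc l) p) * g (drop l p))"
  "(f \<oplus>\<^bsub>path_algebra Q\<^esub> g) p = f p + g p"
  "\<zero>\<^bsub>path_algebra Q\<^esub> p = 0"
  "\<one>\<^bsub>path_algebra Q\<^esub> p = (if \<exists>i\<in>pverts Q. p = [i] then 1 else 0)"
  by (simp_all add: path_algebra_def)

text \<open>c times the unit: scaling becomes left multiplication inside the ring, so ideals absorb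
  it.\<close>

definition path_scalar :: "'v pair_pre_digraph \<Rightarrow> 'k::field \<Rightarrow> 'v list \<Rightarrow> 'k" where
  "path_scalar Q c = (\<lambda>p. if \<exists>i\<in>pverts Q. p = [i] then c else 0)"

lemma path_scalar_closed:
  assumes "finite (pverts Q)"
  shows "path_scalar Q c \<in> carrier (path_algebra Q)"
proof -
  have "{p. path_scalar Q c p \<noteq> 0} \<subseteq> (\<lambda>i. [i]) ` pverts Q" by (auto simp: path_scalar_def)
  then show ?thesis
    using assms by (auto simp: path_algebra_simps path_scalar_def vwalk_def intro: finite_subset)
qed

lemma path_scalar_mult:
  assumes "f \<in> carrier (path_algebra Q)"
  shows "(path_scalar Q c \<otimes>\<^bsub>path_algebra Q\<^esub> f) p = c * f p"
proof (cases p)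
  case Nil
  then have "f p = 0" using assms by (auto simp: path_algebra_simps vwalk_def)
  then show ?thesis using Nil by (simp add: path_algebra_simps)
next
  case (Cons i q)
  have "(\<Sum>l<length p. path_scalar Q c (take (Suc l) p) * f (drop l p))
      = (\<Sum>l<length p. if l = 0 then path_scalar Q c [i] * f p else 0)"
    using Cons by (intro sum.cong) (auto simp: path_scalar_def)
  also have "\<dots> = path_scalar Q c [i] * f p" using Cons by simp
  also have "\<dots> = c * f p"
    using assms Cons by (auto simp: path_scalar_def path_algebra_simps vwalk_def)
  finally show ?thesis by (simp add: path_algebra_simps)
qed

lemma path_algebra_mult_one:
  assumes "f \<in> carrier (path_algebra Q)"
  shows "(f \<otimes>\<^bsub>path_algebra Q\<^esub> \<one>\<^bsub>path_algebra Q\<^esub>) p = f p"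
proof (cases p rule: rev_cases)
  case Nil
  then have "f p = 0" using assms by (auto simp: path_algebra_simps vwalk_def)
  then show ?thesis using Nil by (simp add: path_algebra_simps)
next
  case (snoc q i)
  have single: "(\<exists>j\<in>pverts Q. drop l p = [j]) \<longleftrightarrow> l = length q \<and> i \<in> pverts Q" if "l < length p" for l
  proof
    assume "\<exists>j\<in>pverts Q. drop l p = [j]"
    then obtain j where j: "j \<in> pverts Q" "drop l p = [j]" by blast
    then have "length (drop l p) = 1" by simp
    then have "l = length q" using that snoc by simp
    then show "l = length q \<and> i \<in> pverts Q" using j snoc by simp
  qed (use snoc in simp)
  have "(f \<otimes>\<^bsub>path_algebra Q\<^esub> \<one>\<^bsub>path_algebra Q\<^esub>) p
      = (\<Sum>l<length p. if l = length q then (if i \<in> pverts Q then f p else 0) else 0)"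
    unfolding path_algebra_simps(2,5) using single snoc by (intro sum.cong) auto
  also have "\<dots> = (if i \<in> pverts Q then f p else 0)" using snoc by simp
  also have "\<dots> = f p" using assms snoc by (auto simp: path_algebra_simps vwalk_def)
  finally show ?thesis .
qed

lemma path_algebra_mult_closed:
  assumes f: "f \<in> carrier (path_algebra Q)" and g: "g \<in> carrier (path_algebra Q)"
  shows "f \<otimes>\<^bsub>path_algebra Q\<^esub> g \<in> carrier (path_algebra Q)"
proof -
  have nz: "\<exists>l<length p. f (take (Suc l) p) \<noteq> 0 \<and> g (drop l p) \<noteq> 0"
    if "(f \<otimes>\<^bsub>path_algebra Q\<^esub> g) p \<noteq> 0" for p
  proof (rule ccontr)
    assume "\<not> ?thesis"
    then have "(\<Sum>l<length p. f (take (Suc l) p) * g (drop l p)) = 0"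
      by (intro sum.neutral) auto
    with that show False by (simp add: path_algebra_simps)
  qed
  have "{p. (f \<otimes>\<^bsub>path_algebra Q\<^esub> g) p \<noteq> 0}
      \<subseteq> (\<lambda>(p, q). p @ tl q) ` ({p. f p \<noteq> 0} \<times> {q. g q \<noteq> 0})"
  proof
    fix p assume "p \<in> {p. (f \<otimes>\<^bsub>path_algebra Q\<^esub> g) p \<noteq> 0}"
    then obtain l where l: "f (take (Suc l) p) \<noteq> 0" "g (drop l p) \<noteq> 0" using nz by blast
    have "p = take (Suc l) p @ tl (drop l p)" by (simp add: tl_drop flip: drop_Suc)
    then show "p \<in> (\<lambda>(p, q). p @ tl q) ` ({p. f p \<noteq> 0} \<times> {q. g q \<noteq> 0})"
      using l by (intro image_eqI[of _ _ "(take (Suc l) p, drop l p)"]) auto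
  qed
  then have "finite {p. (f \<otimes>\<^bsub>path_algebra Q\<^esub> g) p \<noteq> 0}"
    using f g by (auto simp: path_algebra_simps(1) intro: finite_subset)
  moreover have "vwalk p (with_proj Q)" if "(f \<otimes>\<^bsub>path_algebra Q\<^esub> g) p \<noteq> 0" for p
    using nz[OF that] f g vwalk_split[of _ p Q] by (auto simp: path_algebra_simps(1))
  ultimately show ?thesis by (simp add: path_algebra_simps(1))
qed

text \<open>Both sides sum over the ways to cut \<open>p\<close> at two places. The left side
  chooses the later cut first, the right side records it relative to the earlier one.\<close>

lemma path_algebra_assoc:
  "((f \<otimes>\<^bsub>path_algebra Q\<^esub> g) \<otimes>\<^bsub>path_algebra Q\<^esub> h) p = (f \<otimes>\<^bsub>path_algebra Q\<^esub> (g \<otimes>\<^bsub>path_algebra Q\<^esub> h)) p"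
proof -
  let ?n = "length p"
  have "((f \<otimes>\<^bsub>path_algebra Q\<^esub> g) \<otimes>\<^bsub>path_algebra Q\<^esub> h) p
      = (\<Sum>l<?n. \<Sum>m<Suc l. f (take (Suc m) p) * g (take (Suc (l - m)) (drop m p)) * h (drop l p))"
    unfolding path_algebra_simps(2) sum_distrib_right
    by (intro sum.cong refl) (auto simp: drop_take min_def Suc_diff_le)
  also have "\<dots> = (\<Sum>(l, m)\<in>(SIGMA l:{..<?n}. {..<Suc l}).
      f (take (Suc m) p) * g (take (Suc (l - m)) (drop m p)) * h (drop l p))"
    by (rule sum.Sigma) auto
  also have "\<dots> = (\<Sum>(m, l)\<in>(SIGMA m:{..<?n}. {..<?n - m}).
      f (take (Suc m) p) * g (take (Suc l) (drop m p)) * h (drop (m + l) p))"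
    by (rule sum.reindex_bij_witness[of _ "\<lambda>(m, l). (m + l, m)" "\<lambda>(l, m). (m, l - m)"]) auto
  also have "\<dots> = (\<Sum>m<?n. \<Sum>l<?n - m.
      f (take (Suc m) p) * g (take (Suc l) (drop m p)) * h (drop (m + l) p))"
    by (rule sum.Sigma[symmetric]) auto
  also have "\<dots> = (f \<otimes>\<^bsub>path_algebra Q\<^esub> (g \<otimes>\<^bsub>path_algebra Q\<^esub> h)) p"
    unfolding path_algebra_simps(2) sum_distrib_left
    by (intro sum.cong refl) (auto simp: mult.assoc add.commute)
  finally show ?thesis .
qed

lemma path_algebra_ring:
  assumes fin: "finite (pverts Q)"
  shows "ring (path_algebra Q :: ('v list \<Rightarrow> 'k::field) ring)"
proof (rule ringI)
  let ?P = "path_algebra Q :: ('v list \<Rightarrow> 'k) ring"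
  have one: "\<one>\<^bsub>?P\<^esub> = path_scalar Q 1"
    by (auto simp: path_algebra_simps path_scalar_def)
  show "abelian_group ?P"
  proof (rule abelian_groupI)
    fix f g assume "f \<in> carrier ?P" "g \<in> carrier ?P"
    moreover have "{p. f p + g p \<noteq> 0} \<subseteq> {p. f p \<noteq> 0} \<union> {p. g p \<noteq> 0}" by auto
    ultimately show "f \<oplus>\<^bsub>?P\<^esub> g \<in> carrier ?P"
      unfolding path_algebra_simps(1,3) by (auto intro: finite_subset)
  next
    fix f assume "f \<in> carrier ?P"
    then show "\<exists>g\<in>carrier ?P. g \<oplus>\<^bsub>?P\<^esub> f = \<zero>\<^bsub>?P\<^esub>"
      by (intro bexI[of _ "\<lambda>p. - f p"]) (auto simp: path_algebra_simps)
  qed (auto simp: path_algebra_simps fun_eq_iff)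
  show "Group.monoid ?P"
  proof (rule monoidI)
    show "\<one>\<^bsub>?P\<^esub> \<in> carrier ?P" unfolding one by (rule path_scalar_closed[OF fin])
    fix f assume f: "f \<in> carrier ?P"
    show "\<one>\<^bsub>?P\<^esub> \<otimes>\<^bsub>?P\<^esub> f = f" unfolding one using path_scalar_mult[OF f] by (intro ext) simp
    show "f \<otimes>\<^bsub>?P\<^esub> \<one>\<^bsub>?P\<^esub> = f" using path_algebra_mult_one[OF f] by (intro ext) simp
  qed (auto intro: path_algebra_mult_closed path_algebra_assoc)
qed (auto simp: path_algebra_simps algebra_simps sum.distrib fun_eq_iff)

lemma path_elem_closed:
  "vwalk p (with_proj Q) \<Longrightarrow> path_elem p \<in> carrier (path_algebra Q)"
  by (auto simp: path_algebra_simps path_elem_def)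

text \<open>Only the cut at the last vertex of \<open>p\<close> can split a path into
  \<open>p\<close> and \<open>q\<close>; this vertex belongs to both parts, whence
  \<open>tl q\<close>.\<close>

lemma path_elem_mult:
  assumes "p \<noteq> []" "q \<noteq> []" "last p = hd q"
  shows "path_elem p \<otimes>\<^bsub>path_algebra Q\<^esub> path_elem q = (path_elem (p @ tl q) :: 'v list \<Rightarrow> 'k::field)"
proof
  fix r
  have iff: "take (Suc l) r = p \<and> drop l r = q \<longleftrightarrow> l = length p - 1 \<and> r = p @ tl q" if "l < length r" for l
  proof
    assume *: "take (Suc l) r = p \<and> drop l r = q"
    have "r = take (Suc l) r @ tl (drop l r)" by (simp add: tl_drop flip: drop_Suc)
    moreover have "length p = Suc l" using * that by auto
    ultimately show "l = length p - 1 \<and> r = p @ tl q" using * by simp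
  next
    assume *: "l = length p - 1 \<and> r = p @ tl q"
    have "drop (length p - 1) p = [last p]" using assms(1) by (metis append_butlast_last_id append_eq_conv_conj length_butlast)
    then show "take (Suc l) r = p \<and> drop l r = q" using * assms by simp
  qed
  have "path_elem p (take (Suc l) r) * path_elem q (drop l r)
      = (if l = length p - 1 then path_elem (p @ tl q) r else (0::'k))" if "l < length r" for l
  proof (cases "take (Suc l) r = p \<and> drop l r = q")
    case True
    then have "l = length p - 1" "r = p @ tl q" using iff[OF that] by blast+
    then have "(if l = length p - 1 then path_elem (p @ tl q) r else (0::'k)) = 1"
      by (simp only: path_elem_def if_True refl)
    then show ?thesis using True by (simp only: path_elem_def if_True refl mult_1)
  next
    case False
    then have "\<not> (l = length p - 1 \<and> r = p @ tl q)" using iff[OF that] by blast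
    then have "(if l = length p - 1 then path_elem (p @ tl q) r else (0::'k)) = 0"
      by (cases "l = length p - 1") (simp_all only: path_elem_def if_False if_True simp_thms)
    moreover have "path_elem p (take (Suc l) r) * path_elem q (drop l r) = (0::'k)"
      using False by (cases "take (Suc l) r = p") (simp_all add: path_elem_def)
    ultimately show ?thesis by simp
  qed
  then have "(path_elem p \<otimes>\<^bsub>path_algebra Q\<^esub> path_elem q) r
      = (\<Sum>l<length r. if l = length p - 1 then path_elem (p @ tl q) r else (0::'k))"
    unfolding path_algebra_simps(2) by (intro sum.cong) auto
  also have "\<dots> = (if length p - 1 < length r then path_elem (p @ tl q) r else 0)" by simp
  also have "\<dots> = path_elem (p @ tl q) r"
    using assms(1,2) by (cases p; cases q) (auto simp: path_elem_def)
  finally show "(path_elem p \<otimes>\<^bsub>path_algebra Q\<^esub> path_elem q) r = (path_elem (p @ tl q) r :: 'k)" .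
qed

section \<open>The zigzag algebra with vertex condition\<close>

locale zigzag_graph =
  fixes K :: "'k::field itself" and \<Gamma> :: "'v pair_pre_digraph" and C :: "'v set"
  assumes graph: "pair_graph \<Gamma>" and connected: "Digraph_Component.connected (with_proj \<Gamma>)"
    and C_verts: "C \<subseteq> pverts \<Gamma>" and C_nonempty: "C \<noteq> {}"
begin

abbreviation "V \<equiv> pverts \<Gamma>"
abbreviation "E \<equiv> parcs \<Gamma>"
abbreviation "Q \<equiv> zigzag_quiver \<Gamma>"
abbreviation "P \<equiv> path_algebra Q :: ('v list \<Rightarrow> 'k) ring"
abbreviation "I \<equiv> zigzag_ideal \<Gamma> :: ('v list \<Rightarrow> 'k) set"
abbreviation "Z \<equiv> zigzag_algebra \<Gamma> :: ('v list \<Rightarrow> 'k) set ring"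
abbreviation "X \<equiv> Idl\<^bsub>Z\<^esub> (zigzag_x \<Gamma> C)"
abbreviation "B \<equiv> zigzag_algebra_vertex_cond K \<Gamma> C"

lemma finite_verts: "finite V"
  using graph by (simp add: pair_graph_def pair_digraph_def pair_fin_digraph_def pair_fin_digraph_axioms_def)

lemma edge_verts: "(i, j) \<in> E \<Longrightarrow> i \<in> V" "(i, j) \<in> E \<Longrightarrow> j \<in> V"
  and edge_neq: "(i, j) \<in> E \<Longrightarrow> i \<noteq> j"
  and edge_sym: "(i, j) \<in> E \<Longrightarrow> (j, i) \<in> E"
proof -
  interpret pair_graph \<Gamma> by (rule graph)
  show "(i, j) \<in> E \<Longrightarrow> i \<in> V" "(i, j) \<in> E \<Longrightarrow> j \<in> V" by (rule in_arcsD1 in_arcsD2, assumption)+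
  show "(i, j) \<in> E \<Longrightarrow> i \<noteq> j" using pair_no_loops[of "(i, j)"] by simp
  show "(i, j) \<in> E \<Longrightarrow> (j, i) \<in> E"
    using pair_sym_arcs by (auto simp: symmetric_def sym_def)
qed

lemma connected_rtrancl: "u \<in> V \<Longrightarrow> v \<in> V \<Longrightarrow> (u, v) \<in> E\<^sup>*"
proof -
  interpret pair_graph \<Gamma> by (rule graph)
  assume "u \<in> V" "v \<in> V"
  then have "(u, v) \<in> rtrancl_on V E"
    using symmetric_connected_imp_strongly_connected[OF pair_sym_arcs connected]
    by (auto simp: strongly_connected_def reachable_def)
  then show "(u, v) \<in> E\<^sup>*" by (rule rtrancl_on_rtranclI)
qed

text \<open>As C is non-empty, a vertex outside C is not the only one. Thus a return path exists
  wherever an x-coefficient is allowed; in a one-vertex graph C is everything.\<close>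

lemma ex_neighbor:
  assumes "i \<in> V" "i \<notin> C" shows "\<exists>j. (i, j) \<in> E"
proof -
  obtain c where "c \<in> C" using C_nonempty by blast
  then have "(i, c) \<in> E\<^sup>*" "i \<noteq> c" using connected_rtrancl assms C_verts by auto
  then show ?thesis by (meson converse_rtranclE)
qed

lemma pverts_quiver [simp]: "pverts Q = V"
  by (simp add: zigzag_quiver_def)

lemma edge_card: "(i, j) \<in> E \<Longrightarrow> card V \<noteq> 1"
  using edge_verts edge_neq by (metis card_1_singletonE singletonD)

lemma quiver_eq: "card V \<noteq> 1 \<Longrightarrow> Q = \<Gamma>"
  by (simp add: zigzag_quiver_def)

lemma walk_edge: "(i, j) \<in> E \<Longrightarrow> vwalk [i, j] (with_proj Q)"
  using quiver_eq[OF edge_card] edge_verts by (auto simp: vwalk_def)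

lemma walk_back: "(i, j) \<in> E \<Longrightarrow> vwalk [i, j, i] (with_proj Q)"
  using quiver_eq[OF edge_card] edge_verts edge_sym by (auto simp: vwalk_def)

lemma P_ring: "ring P"
  by (rule path_algebra_ring) (simp add: finite_verts)

sublocale P: ring P by (rule P_ring)

definition path_ce :: "('v list \<Rightarrow> 'k) \<Rightarrow> 'v \<Rightarrow> 'k" where
  "path_ce f i = f [i]"

text \<open>The guard discards the loop of the one-vertex quiver, whose path [i, i] is not an arrow
  of \<Gamma>.\<close>

definition path_ca :: "('v list \<Rightarrow> 'k) \<Rightarrow> 'v \<Rightarrow> 'v \<Rightarrow> 'k" where
  "path_ca f i j = (if (i, j) \<in> E then f [i, j] else 0)"

text \<open>All return paths at i represent x_i, so their coefficients are added up. For one vertex,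
  where x_i is the loop instead, C is everything and the value is zero.\<close>

definition path_cx :: "('v list \<Rightarrow> 'k) \<Rightarrow> 'v \<Rightarrow> 'k" where
  "path_cx f i = (if i \<in> C then 0 else \<Sum>j | (i, j) \<in> E. f [i, j, i])"

lemma finite_neighbors: "finite {j. (i, j) \<in> E}"
  using finite_verts edge_verts(2) by (auto intro: finite_subset)

text \<open>The product rules are the convolution evaluated at lists of length one, two and three.
  All other paths are invisible to the coefficients, so this is no instance of
  \<open>zigzag_basis\<close>.\<close>

sublocale zigzag_coeffs P V C E path_ce path_ca path_cx
proof unfold_locales
  show "finite V" by (rule finite_verts)
  show "E \<subseteq> V \<times> V" using edge_verts by auto
  show "sym E" "irrefl E" using edge_sym edge_neq by (auto simp: sym_def irrefl_def)
next
  fix f i assume "f \<in> carrier P" "i \<notin> V"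
  then show "path_ce f i = 0" by (auto simp: path_ce_def path_algebra_simps vwalk_def)
next
  fix f i assume "f \<in> carrier P" "i \<notin> V \<or> i \<in> C"
  then show "path_cx f i = 0" using edge_verts by (auto simp: path_cx_def intro: sum.neutral)
next
  fix f g i j assume f: "f \<in> carrier P" and g: "g \<in> carrier P"
  show "path_ce (f \<oplus>\<^bsub>P\<^esub> g) i = path_ce f i + path_ce g i"
    "path_ca (f \<oplus>\<^bsub>P\<^esub> g) i j = path_ca f i j + path_ca g i j"
    "path_cx (f \<oplus>\<^bsub>P\<^esub> g) i = path_cx f i + path_cx g i"
    "path_ce (f \<otimes>\<^bsub>P\<^esub> g) i = path_ce f i * path_ce g i"
    "path_ca (f \<otimes>\<^bsub>P\<^esub> g) i j = path_ce f i * path_ca g i j + path_ca f i j * path_ce g j"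
    by (simp_all add: path_ce_def path_ca_def path_cx_def path_algebra_simps sum.distrib numeral_2_eq_2)
  assume i: "i \<notin> C"
  have "(\<Sum>j\<in>V. path_ca f i j * path_ca g j i) = (\<Sum>j | (i, j) \<in> E. path_ca f i j * path_ca g j i)"
    by (rule sum.mono_neutral_right) (use finite_verts edge_verts in \<open>auto simp: path_ca_def\<close>)
  also have "\<dots> = (\<Sum>j | (i, j) \<in> E. f [i, j] * g [j, i])"
    using edge_sym by (intro sum.cong) (auto simp: path_ca_def)
  finally show "path_cx (f \<otimes>\<^bsub>P\<^esub> g) i = path_ce f i * path_cx g i + path_cx f i * path_ce g i +
      (\<Sum>j\<in>V. path_ca f i j * path_ca g j i)"
    using i by (simp add: path_ce_def path_cx_def path_algebra_simps sum.distrib sum_distrib_left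
        sum_distrib_right lessThan_Suc eval_nat_numeral ac_simps)
next
  fix i j
  show "i \<in> V \<Longrightarrow> path_ce \<one>\<^bsub>P\<^esub> i = 1" "path_ca \<one>\<^bsub>P\<^esub> i j = 0" "path_cx \<one>\<^bsub>P\<^esub> i = 0"
    by (auto simp: path_ce_def path_ca_def path_cx_def path_algebra_simps)
next
  fix f i j assume "(i, j) \<notin> E"
  then show "path_ca f i j = 0" by (simp add: path_ca_def)
next
  fix e x :: "'v \<Rightarrow> 'k" and a :: "'v \<Rightarrow> 'v \<Rightarrow> 'k"
  assume e: "\<And>i. i \<notin> V \<Longrightarrow> e i = 0" and a: "\<And>i j. (i, j) \<notin> E \<Longrightarrow> a i j = 0"
    and x: "\<And>i. i \<notin> V \<or> i \<in> C \<Longrightarrow> x i = 0"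
  \<comment> \<open>The whole prescribed coefficient at x_i is put on one return path, through
    \<open>nb i\<close>.\<close>
  define nb where "nb i = (SOME j. (i, j) \<in> E)" for i
  have nb: "(i, nb i) \<in> E" if "i \<in> V" "i \<notin> C" for i
    unfolding nb_def using ex_neighbor[OF that] by (rule someI_ex)
  define f :: "'v list \<Rightarrow> 'k" where "f p = (case p of [i] \<Rightarrow> e i | [i, j] \<Rightarrow> a i j
    | [i, j, k] \<Rightarrow> if j = nb i \<and> k = i then x i else 0 | _ \<Rightarrow> 0)" for p
  have f_simps: "f [i] = e i" "f [i, j] = a i j" "f [i, j, i] = (if j = nb i then x i else 0)" for i j
    by (simp_all add: f_def)
  have f_nz: "(\<exists>i\<in>V. p = [i]) \<or> (\<exists>i j. (i, j) \<in> E \<and> p = [i, j]) \<or>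
      (\<exists>i\<in>V. p = [i, nb i, i] \<and> (i, nb i) \<in> E)" if "f p \<noteq> 0" for p
    using that e a x nb by (fastforce simp: f_def split: list.splits if_splits)
  have "{p. f p \<noteq> 0} \<subseteq> (\<lambda>i. [i]) ` V \<union> (\<lambda>(i, j). [i, j]) ` E \<union> (\<lambda>i. [i, nb i, i]) ` V"
    using f_nz by fastforce
  moreover have "finite E" using finite_verts edge_verts by (auto intro: finite_subset[of _ "V \<times> V"])
  ultimately have "finite {p. f p \<noteq> 0}" using finite_verts by (auto intro: finite_subset)
  moreover have "vwalk p (with_proj Q)" if "f p \<noteq> 0" for p
    using f_nz[OF that] walk_edge walk_back by (auto simp: vwalk_def)
  ultimately have "f \<in> carrier P" by (simp add: path_algebra_simps)
  moreover have "path_ce f = e" by (simp add: path_ce_def f_simps fun_eq_iff)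
  moreover have "path_ca f = a" using a by (auto simp: path_ca_def f_simps fun_eq_iff)
  moreover have "path_cx f = x"
  proof
    fix i
    show "path_cx f i = x i"
    proof (cases "i \<in> V \<and> i \<notin> C")
      case True
      then show ?thesis using finite_neighbors nb by (simp add: path_cx_def f_simps)
    next
      case False
      then show ?thesis using x edge_verts(1)[of i] by (auto simp: path_cx_def intro: sum.neutral)
    qed
  qed
  ultimately show "\<exists>f\<in>carrier P. path_ce f = e \<and> path_ca f = a \<and> path_cx f = x" by blast
qed

lemma P_uminus: "f \<in> carrier P \<Longrightarrow> \<ominus>\<^bsub>P\<^esub> f = (\<lambda>p. - f p)"
  by (rule P.minus_equality) (auto simp: path_algebra_simps fun_eq_iff)

lemma P_minus:
  "f \<in> carrier P \<Longrightarrow> g \<in> carrier P \<Longrightarrow> f \<ominus>\<^bsub>P\<^esub> g = (\<lambda>p. f p - g p)"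
  by (simp add: a_minus_def P_uminus fun_eq_iff path_algebra_simps)

section \<open>The defining ideal as common kernel of the coefficients\<close>

lemma relations_subset_kern: "zigzag_relations \<Gamma> \<subseteq> kern {}"
proof
  fix r :: "'v list \<Rightarrow> 'k" assume r: "r \<in> zigzag_relations \<Gamma>"
  \<comment> \<open>Among the paths with at least two arrows only i -> j -> i is seen by a
    coefficient.\<close>
  have longI: "path_elem p \<in> kern {}" if "vwalk p (with_proj Q)" "length p \<ge> 3" "\<And>i j. p \<noteq> [i, j, i]" for p
  proof -
    have "[i, j, i] \<noteq> p" for i j using that(3) by metis
    then show ?thesis
      using that(2) path_elem_closed[OF that(1)]
      by (auto simp: zigzag_kern_def path_ce_def path_ca_def path_cx_def path_elem_def)
  qed
  consider (one) "card V = 1" | (two) "card V = 2" | (many) "card V \<noteq> 1" "card V \<noteq> 2" by blast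
  then show "r \<in> kern {}"
  proof cases
    case one
    then obtain i where i: "i \<in> V" "r = path_elem [i, i, i]" using r by (auto simp: zigzag_relations_def)
    have w: "vwalk [i, i, i] (with_proj Q)" using one i by (auto simp: zigzag_quiver_def vwalk_def)
    have "(j, k) \<notin> E" for j k using edge_card[of j k] one by blast
    then show ?thesis
      using path_elem_closed[OF w]
      by (auto simp: i(2) zigzag_kern_def path_ce_def path_ca_def path_cx_def path_elem_def)
  next
    case two
    then obtain p where p: "vwalk p (with_proj \<Gamma>)" "vwalk_length p = 3" "r = path_elem p"
      using r by (auto simp: zigzag_relations_def)
    \<comment> \<open>Three arrows visit four vertices.\<close>
    have "r = path_elem p" "length p = 4" using p by auto
    moreover from this have "p \<noteq> [i, j, i]" for i j by auto
    moreover have "vwalk p (with_proj Q)" using p(1) two by (simp add: quiver_eq)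
    ultimately show ?thesis using longI[of p] by simp
  next
    case many
    then have Q: "Q = \<Gamma>" by (simp add: quiver_eq)
    from r many consider (a) i j k where "(i, j) \<in> E" "(j, k) \<in> E" "i \<noteq> k" "r = path_elem [i, j, k]"
      | (b) i j k where "(i, j) \<in> E" "(i, k) \<in> E" "r = path_elem [i, j, i] \<ominus>\<^bsub>P\<^esub> path_elem [i, k, i]"
      unfolding zigzag_relations_def by auto
    then show ?thesis
    proof cases
      case a
      have "vwalk [i, j, k] (with_proj Q)" using a edge_verts by (auto simp: Q vwalk_def)
      then show ?thesis using longI[of "[i, j, k]"] a by auto
    next
      case b
      have c: "path_elem [i, j, i] \<in> carrier P" "path_elem [i, k, i] \<in> carrier P"
        using b walk_back path_elem_closed by blast+
      \<comment> \<open>A return path at i adds 1 to the sum at i whichever neighbor it visits, so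
        the two paths of the relation cancel.\<close>
      have "(\<Sum>l | (m, l) \<in> E. path_elem [i, n, i] [m, l, m]) = (if m = i then 1 else (0::'k))"
        if "(i, n) \<in> E" for m n
      proof -
        have "(\<Sum>l | (m, l) \<in> E. path_elem [i, n, i] [m, l, m])
            = (\<Sum>l | (m, l) \<in> E. if l = n then if m = i then 1 else 0 else (0::'k))"
          by (intro sum.cong) (auto simp: path_elem_def)
        also have "\<dots> = (if m = i then 1 else 0)" using finite_neighbors[of m] that by simp
        finally show ?thesis .
      qed
      from this[OF b(1)] this[OF b(2)] have "path_cx r m = 0" for m
        by (simp add: path_cx_def b(3) P_minus[OF c] sum_subtractf)
      then show ?thesis
        using P.minus_closed[OF c] unfolding b(3)
        by (auto simp: zigzag_kern_def path_ce_def path_ca_def P_minus[OF c]) (auto simp: path_elem_def)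
    qed
  qed
qed

lemma kern_carrier: "kern {} \<subseteq> carrier P"
  unfolding zigzag_kern_def by blast

lemma zigzag_ideal_ideal: "ideal I P"
  unfolding zigzag_ideal_def
  using relations_subset_kern kern_carrier by (intro P.genideal_ideal) blast

sublocale I: ideal I P by (rule zigzag_ideal_ideal)

lemma zigzag_ideal_subset_kern: "I \<subseteq> kern {}"
  unfolding zigzag_ideal_def by (rule P.genideal_minimal[OF kern_ideal relations_subset_kern])

lemma relations_subset_ideal: "zigzag_relations \<Gamma> \<subseteq> I"
  unfolding zigzag_ideal_def
  using relations_subset_kern kern_carrier by (intro P.genideal_self) blast

lemma Z_ring: "ring Z"
  unfolding zigzag_algebra_def by (rule I.quotient_is_ring)

sublocale Z: ring Z by (rule Z_ring)

lemma zigzag_hom: "ring_hom_ring P Z ((+>\<^bsub>P\<^esub>) I)"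
  unfolding zigzag_algebra_def by (rule I.rcos_ring_hom_ring)

lemma coset_carrier: "f \<in> carrier P \<Longrightarrow> I +>\<^bsub>P\<^esub> f \<in> carrier Z"
  using ring_hom_ring.homh[OF zigzag_hom] by (rule ring_hom_closed)

lemma coset_eqD: "f \<in> carrier P \<Longrightarrow> I +>\<^bsub>P\<^esub> f = I +>\<^bsub>P\<^esub> g \<Longrightarrow> \<exists>r\<in>I. f = r \<oplus>\<^bsub>P\<^esub> g"
  using I.a_rcos_self[of f] by (auto simp: a_r_coset_def')

lemma path_elem_loop_in_kern:
  assumes "p \<in> (if card V = 1 then {[i, i] | i. i \<in> C} else {[i, j, i] | i j. i \<in> C \<and> (i, j) \<in> E})"
  shows "path_elem p \<in> kern {}"
proof (cases "card V = 1")
  case True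
  then obtain i where i: "i \<in> C" "p = [i, i]" using assms by auto
  have "vwalk p (with_proj Q)"
    using True i C_verts by (auto simp: zigzag_quiver_def vwalk_def)
  moreover have "(j, k) \<notin> E" for j k using edge_card[of j k] True by blast
  ultimately show ?thesis
    using path_elem_closed[of p Q]
    by (auto simp: i(2) zigzag_kern_def path_ce_def path_ca_def path_cx_def path_elem_def)
next
  case False
  then obtain i j where i: "i \<in> C" "(i, j) \<in> E" "p = [i, j, i]" using assms by auto
  then have "vwalk p (with_proj Q)" using walk_back by simp
  moreover have "path_cx (path_elem p) k = 0" for k
    using i by (auto simp: path_cx_def path_elem_def intro!: sum.neutral)
  ultimately show ?thesis
    using path_elem_closed[of p Q]
    by (auto simp: i(3) zigzag_kern_def path_ce_def path_ca_def path_elem_def)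
qed

lemma zigzag_x_subset: "zigzag_x \<Gamma> C \<subseteq> (+>\<^bsub>P\<^esub>) I ` kern {}"
  unfolding zigzag_x_def using path_elem_loop_in_kern by (intro image_subsetI imageI)

lemma X_ideal: "ideal X Z"
  using zigzag_x_subset kern_carrier coset_carrier by (intro Z.genideal_ideal) blast

sublocale X: ideal X Z by (rule X_ideal)

lemma X_subset: "X \<subseteq> (+>\<^bsub>P\<^esub>) I ` kern {}"
proof (rule Z.genideal_minimal[OF _ zigzag_x_subset])
  show "ideal ((+>\<^bsub>P\<^esub>) I ` kern {}) Z"
    unfolding zigzag_algebra_def by (rule P.ring_ideal_imp_quot_ideal[OF zigzag_ideal_ideal kern_ideal])
qed

text \<open>The algebra is a quotient of a quotient. This is the kernel of the composite map from
  the path algebra, so computations take place with paths instead of cosets of cosets.\<close>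

definition defining_ideal :: "('v list \<Rightarrow> 'k) set" where
  "defining_ideal = {f \<in> carrier P. I +>\<^bsub>P\<^esub> f \<in> X}"

lemma mem_defining_ideal: "f \<in> defining_ideal \<longleftrightarrow> f \<in> carrier P \<and> I +>\<^bsub>P\<^esub> f \<in> X"
  by (simp add: defining_ideal_def)

lemma defining_ideal: "ideal defining_ideal P"
  unfolding defining_ideal_def by (rule ring_hom_ring.ideal_vimage[OF zigzag_hom X_ideal])

sublocale N: ideal defining_ideal P by (rule defining_ideal)

text \<open>Generators have zero coefficients at both stages: f agrees modulo \<open>I\<close> with
  an element of \<open>kern {}\<close>, and \<open>I\<close> itself lies in
  \<open>kern {}\<close>.\<close>

lemma defining_ideal_subset_kern: "defining_ideal \<subseteq> kern {}"
proof
  fix f assume "f \<in> defining_ideal"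
  then have f: "f \<in> carrier P" "I +>\<^bsub>P\<^esub> f \<in> X" unfolding mem_defining_ideal by (rule conjunct1, rule conjunct2)
  from X_subset f(2) have "I +>\<^bsub>P\<^esub> f \<in> (+>\<^bsub>P\<^esub>) I ` kern {}" by (rule subsetD)
  then obtain g where g: "I +>\<^bsub>P\<^esub> f = I +>\<^bsub>P\<^esub> g" "g \<in> kern {}" by (rule imageE)
  obtain r where r: "r \<in> I" "f = r \<oplus>\<^bsub>P\<^esub> g" using coset_eqD[OF f(1) g(1)] by (rule bexE)
  interpret K: ideal "kern {}" P by (rule kern_ideal)
  show "f \<in> kern {}"
    unfolding r(2) by (rule K.a_closed[OF subsetD[OF zigzag_ideal_subset_kern r(1)] g(2)])
qed

lemma ideal_subset_defining_ideal: "I \<subseteq> defining_ideal"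
proof
  fix f assume f: "f \<in> I"
  then have "f \<in> carrier P" by (rule I.a_Hcarr)
  moreover have "I +>\<^bsub>P\<^esub> f = \<zero>\<^bsub>Z\<^esub>"
    using f by (simp add: I.a_rcos_const zigzag_algebra_def FactRing_def)
  ultimately show "f \<in> defining_ideal" unfolding mem_defining_ideal using X.zero_closed by simp
qed

lemma path_elem_loop_in_defining_ideal:
  assumes "p \<in> (if card V = 1 then {[i, i] | i. i \<in> C} else {[i, j, i] | i j. i \<in> C \<and> (i, j) \<in> E})"
  shows "path_elem p \<in> defining_ideal"
proof -
  have "zigzag_x \<Gamma> C \<subseteq> X"
    using zigzag_x_subset kern_carrier coset_carrier by (intro Z.genideal_self) blast
  moreover have "I +>\<^bsub>P\<^esub> path_elem p \<in> zigzag_x \<Gamma> C"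
    unfolding zigzag_x_def using assms by (rule imageI)
  ultimately show ?thesis
    using subsetD[OF kern_carrier path_elem_loop_in_kern[OF assms]]
    unfolding mem_defining_ideal by blast
qed

lemma path_elem_append_in_defining_ideal:
  assumes "path_elem p \<in> defining_ideal \<and> vwalk q (with_proj Q) \<or>
      path_elem q \<in> defining_ideal \<and> vwalk p (with_proj Q)"
    and "p \<noteq> []" "q \<noteq> []" "last p = hd q"
  shows "path_elem (p @ tl q) \<in> defining_ideal"
  using assms(1) path_elem_closed N.I_l_closed N.I_r_closed
  unfolding path_elem_mult[OF assms(2-4), of Q, symmetric] by blast

text \<open>Distinct neighbors j and k force at least three vertices, and there the difference is a
  defining relation; for j = k it is zero.\<close>

lemma back_path_diff_in_defining_ideal:
  assumes "(i, j) \<in> E" "(i, k) \<in> E"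
  shows "(\<lambda>p. path_elem [i, j, i] p - path_elem [i, k, i] p) \<in> defining_ideal"
proof (cases "j = k")
  case True
  then show ?thesis using N.zero_closed by (simp add: path_algebra_def)
next
  case False
  have "card {i, j, k} \<le> card V"
    using assms edge_verts finite_verts by (intro card_mono) auto
  then have "card V \<noteq> 1" "card V \<noteq> 2" using False assms edge_neq by auto
  then have "path_elem [i, j, i] \<ominus>\<^bsub>P\<^esub> path_elem [i, k, i] \<in> zigzag_relations \<Gamma>"
    using assms by (auto simp: zigzag_relations_def)
  then have "path_elem [i, j, i] \<ominus>\<^bsub>P\<^esub> path_elem [i, k, i] \<in> defining_ideal"
    using relations_subset_ideal ideal_subset_defining_ideal by blast
  then show ?thesis
    using P_minus[OF path_elem_closed[OF walk_back[OF assms(1)]] path_elem_closed[OF walk_back[OF assms(2)]]]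
    by simp
qed

lemma turn_in_defining_ideal:
  assumes "(i, j) \<in> E" "(j, k) \<in> E" "i \<noteq> k"
  shows "path_elem [i, j, k] \<in> defining_ideal"
proof -
  have "card {i, j, k} \<le> card V"
    using assms edge_verts finite_verts by (intro card_mono) auto
  then have "card V \<noteq> 1" "card V \<noteq> 2" using assms edge_neq by auto
  then have "path_elem [i, j, k] \<in> zigzag_relations \<Gamma>"
    using assms by (auto simp: zigzag_relations_def)
  then show ?thesis using relations_subset_ideal ideal_subset_defining_ideal by blast
qed

text \<open>With at least three vertices this is not one of the relations but follows from
  connectedness: some edge leaves {i, j}, so i -> j -> i or j -> i -> j can be rerouted through a
  third vertex.\<close>

lemma cube_in_defining_ideal:
  assumes ij: "(i, j) \<in> E"
  shows "path_elem [i, j, i, j] \<in> defining_ideal"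
proof (cases "card V = 2")
  case True
  have "vwalk [i, j, i, j] (with_proj \<Gamma>)" using assms edge_sym edge_verts by (auto simp: vwalk_def)
  then have "path_elem [i, j, i, j] \<in> zigzag_relations \<Gamma>"
    using True unfolding zigzag_relations_def by force
  then show ?thesis using relations_subset_ideal ideal_subset_defining_ideal by blast
next
  case False
  have "V \<noteq> {i, j}" using False edge_neq[OF ij] by auto
  then obtain v where v: "v \<in> V" "v \<noteq> i" "v \<noteq> j" using edge_verts[OF ij] by blast
  have "\<exists>k l. (k, l) \<in> E \<and> k \<in> {i, j} \<and> l \<notin> {i, j}"
  proof (rule ccontr)
    assume *: "\<not> ?thesis"
    have "(i, v) \<in> E\<^sup>*" using connected_rtrancl edge_verts[OF ij] v by blast
    then have "v \<in> {i, j}" by (induction rule: rtrancl_induct) (use * in auto)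
    then show False using v by simp
  qed
  then obtain k l where kl: "(k, l) \<in> E" "k \<in> {i, j}" "l \<notin> {i, j}" by blast
  have ji: "(j, i) \<in> E" using edge_sym[OF ij] .
  have e: "path_elem [i, j] \<in> carrier P" using path_elem_closed[OF walk_edge[OF ij]] .
  text \<open>Rerouting the middle of the path through \<open>l\<close> leaves the zero path \<open>l \<rightarrow> i \<rightarrow> j\<close> or \<open>i \<rightarrow> j \<rightarrow> l\<close>.\<close>
  show ?thesis
  proof (cases "k = i")
    case True
    then have il: "(i, l) \<in> E" using kl by simp
    have a: "(\<lambda>p. path_elem [i, j, i] p - path_elem [i, l, i] p) \<otimes>\<^bsub>P\<^esub> path_elem [i, j] \<in> defining_ideal"
      by (rule N.I_r_closed[OF back_path_diff_in_defining_ideal[OF ij il] e])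
    have b: "path_elem [i, l, i, j] \<in> defining_ideal"
      using path_elem_append_in_defining_ideal[of "[i, l]" "[l, i, j]"] walk_edge[OF il]
        turn_in_defining_ideal[OF edge_sym[OF il] ij] kl True by simp
    have eq: "(\<lambda>p. path_elem [i, j, i] p - path_elem [i, l, i] p) \<otimes>\<^bsub>P\<^esub> path_elem [i, j]
        \<oplus>\<^bsub>P\<^esub> path_elem [i, l, i, j] = path_elem [i, j, i, j]"
    proof -
      have "(path_elem [i, j, i] \<otimes>\<^bsub>P\<^esub> path_elem [i, j]) p = path_elem [i, j, i, j] p"
        "(path_elem [i, l, i] \<otimes>\<^bsub>P\<^esub> path_elem [i, j]) p = path_elem [i, l, i, j] p" for p
        by (simp_all add: path_elem_mult)
      then show ?thesis
        unfolding path_algebra_simps(2) by (simp add: fun_eq_iff path_algebra_simps(2,3) left_diff_distrib sum_subtractf)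
    qed
    show ?thesis using N.a_closed[OF a b] unfolding eq .
  next
    case False
    then have jl: "(j, l) \<in> E" using kl by simp
    have a: "path_elem [i, j] \<otimes>\<^bsub>P\<^esub> (\<lambda>p. path_elem [j, i, j] p - path_elem [j, l, j] p) \<in> defining_ideal"
      by (rule N.I_l_closed[OF back_path_diff_in_defining_ideal[OF ji jl] e])
    have b: "path_elem [i, j, l, j] \<in> defining_ideal"
      using path_elem_append_in_defining_ideal[of "[i, j, l]" "[l, j]"] walk_edge[OF edge_sym[OF jl]]
        turn_in_defining_ideal[OF ij jl] kl(3) by auto
    have eq: "path_elem [i, j] \<otimes>\<^bsub>P\<^esub> (\<lambda>p. path_elem [j, i, j] p - path_elem [j, l, j] p)
        \<oplus>\<^bsub>P\<^esub> path_elem [i, j, l, j] = path_elem [i, j, i, j]"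
    proof -
      have "(path_elem [i, j] \<otimes>\<^bsub>P\<^esub> path_elem [j, i, j]) p = path_elem [i, j, i, j] p"
        "(path_elem [i, j] \<otimes>\<^bsub>P\<^esub> path_elem [j, l, j]) p = path_elem [i, j, l, j] p" for p
        by (simp_all add: path_elem_mult)
      then show ?thesis
        unfolding path_algebra_simps(2) by (simp add: fun_eq_iff path_algebra_simps(2,3) right_diff_distrib sum_subtractf)
    qed
    show ?thesis using N.a_closed[OF a b] unfolding eq .
  qed
qed

text \<open>Three consecutive arrows contain a turn i -> j -> k with i \<noteq> k or have the form i
  -> j -> i -> j; both lie in the ideal, and so do the return paths at C. With one vertex, C is
  everything and already the loop lies in the ideal.\<close>

lemma path_elem_cases:
  assumes p: "vwalk p (with_proj Q)"
  shows "path_elem p \<in> defining_ideal \<or> (\<exists>i. p = [i]) \<or> (\<exists>i j. p = [i, j] \<and> (i, j) \<in> E) \<or>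
    (\<exists>i j. p = [i, j, i] \<and> (i, j) \<in> E \<and> i \<notin> C)"
proof (cases "card V = 1")
  case True
  then obtain v where V: "V = {v}" by (auto simp: card_1_singleton_iff)
  then have C: "C = {v}" using C_verts C_nonempty subset_singletonD by metis
  show ?thesis
  proof (cases "\<exists>i. p = [i]")
    case False
    then obtain i j q where pq: "p = i # j # q" using p
      by (metis vwalk_def list.exhaust)
    then have ij: "i = v" "j = v" and q: "vwalk (j # q) (with_proj Q)"
      using p V by (auto simp: vwalk_Cons_Cons_iff vwalk_def)
    have "path_elem [i, j] \<in> defining_ideal"
      using True C ij by (intro path_elem_loop_in_defining_ideal) auto
    then show ?thesis using path_elem_append_in_defining_ideal[of "[i, j]" "j # q"] q pq by simp
  qed blast
next
  case False
  then have Q: "Q = \<Gamma>" by (rule quiver_eq)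
  show ?thesis
  proof (cases "length p \<le> 2")
    case True
    then show ?thesis using p
      by (cases p rule: list.exhaust; cases "tl p") (auto simp: Q vwalk_def)
  next
    case long: False
    then obtain i j k q where pq: "p = i # j # k # q"
      by (cases p rule: list.exhaust; cases "tl p"; cases "tl (tl p)") auto
    have ij: "(i, j) \<in> E" and jk: "(j, k) \<in> E" and q: "vwalk (k # q) (with_proj Q)" "vwalk (j # k # q) (with_proj Q)"
      using p by (auto simp: pq Q vwalk_Cons_Cons_iff)
    show ?thesis
    proof (cases "i = k")
      case False
      then show ?thesis
        using path_elem_append_in_defining_ideal[of "[i, j, k]" "k # q"]
          turn_in_defining_ideal[OF ij jk] q(1) pq by simp
    next
      case ik: True
      show ?thesis
      proof (cases q)
        case Nil
        then show ?thesis
          using path_elem_loop_in_defining_ideal[of p] \<open>card V \<noteq> 1\<close> ij pq ik by auto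
      next
        case (Cons l q')
        have kl: "(k, l) \<in> E" and q': "vwalk (l # q') (with_proj Q)"
          using q(1) by (auto simp: Cons Q vwalk_Cons_Cons_iff)
        have "path_elem [i, j, k, l] \<in> defining_ideal"
        proof (cases "j = l")
          case True
          then show ?thesis using cube_in_defining_ideal[OF ij] ik by simp
        next
          case False
          then show ?thesis
            using path_elem_append_in_defining_ideal[of "[i, j]" "[j, k, l]"] walk_edge[OF ij]
              turn_in_defining_ideal[OF jk kl] by simp
        qed
        then show ?thesis
          using path_elem_append_in_defining_ideal[of "[i, j, k, l]" "l # q'"] q' pq Cons by simp
      qed
    qed
  qed
qed

text \<open>Elements of the kernel are reduced to zero by removing one path from the support at a time.\<close>

lemma kern_subset_defining_ideal: "kern {} \<subseteq> defining_ideal"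
proof
  fix f assume "f \<in> kern {}"
  then show "f \<in> defining_ideal"
  proof (induction "card {p. f p \<noteq> 0}" arbitrary: f rule: less_induct)
    case less
    have f: "f \<in> carrier P" using less.prems kern_carrier by blast
    then have fin: "finite {p. f p \<noteq> 0}" by (simp add: path_algebra_simps)
    \<comment> \<open>Subtracting c times g removes p from the support and adds nothing to it, so
      the induction hypothesis applies.\<close>
    have reduce: "f \<in> defining_ideal"
      if g: "g \<in> defining_ideal" and p: "f p \<noteq> 0" "f p = c * g p"
        and supp: "\<And>q. g q \<noteq> 0 \<Longrightarrow> f q \<noteq> 0" for g c p
    proof -
      interpret K: ideal "kern {}" P by (rule kern_ideal)
      let ?cg = "path_scalar Q c \<otimes>\<^bsub>P\<^esub> g"
      have gP: "g \<in> carrier P" using g N.a_subset by blast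
      have cg: "?cg \<in> defining_ideal"
        using N.I_l_closed[OF g] path_scalar_closed[of Q c] finite_verts by simp
      have cgP: "?cg \<in> carrier P" using cg N.a_subset by blast
      let ?f = "f \<ominus>\<^bsub>P\<^esub> ?cg"
      have val: "?f q = f q - c * g q" for q
        using P_minus[OF f cgP] path_scalar_mult[OF gP] by simp
      have "{q. ?f q \<noteq> 0} \<subseteq> {q. f q \<noteq> 0}" using supp by (auto simp: val)
      moreover have "p \<notin> {q. ?f q \<noteq> 0}" "p \<in> {q. f q \<noteq> 0}" using p by (simp_all add: val)
      ultimately have "card {q. ?f q \<noteq> 0} < card {q. f q \<noteq> 0}"
        using fin by (intro psubset_card_mono) auto
      moreover have "?f \<in> kern {}"
        unfolding a_minus_def
        by (intro K.a_closed K.a_inv_closed less.prems subsetD[OF defining_ideal_subset_kern cg])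
      ultimately have "?f \<in> defining_ideal" by (rule less.hyps)
      then have "?f \<oplus>\<^bsub>P\<^esub> ?cg \<in> defining_ideal" using cg N.a_closed by blast
      moreover have "?f \<oplus>\<^bsub>P\<^esub> ?cg = f"
        using path_scalar_mult[OF gP] by (simp add: fun_eq_iff path_algebra_simps(3) val)
      ultimately show ?thesis by simp
    qed
    show ?case
    proof (cases "\<exists>p. f p \<noteq> 0")
      case False
      then have "f = \<zero>\<^bsub>P\<^esub>" by (simp add: fun_eq_iff path_algebra_simps)
      then show ?thesis using N.zero_closed by simp
    next
      case True
      then obtain p where p: "f p \<noteq> 0" by blast
      then have w: "vwalk p (with_proj Q)" using f by (simp add: path_algebra_simps)
      have coeffs0: "path_ce f i = 0" "path_ca f i j = 0" "path_cx f i = 0" for i j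
        using less.prems by (auto simp: zigzag_kern_def)
      from path_elem_cases[OF w] consider "path_elem p \<in> defining_ideal" | i where "p = [i]"
        | i j where "p = [i, j]" "(i, j) \<in> E" | i j where "p = [i, j, i]" "(i, j) \<in> E" "i \<notin> C"
        by blast
      then show ?thesis
      proof cases
        case 1
        then show ?thesis
          by (rule reduce[OF _ p, of _ "f p"]) (use p in \<open>auto simp: path_elem_def split: if_splits\<close>)
      next
        case 2
        then show ?thesis using p coeffs0(1) by (simp add: path_ce_def)
      next
        case 3
        then show ?thesis using p coeffs0(2)[of i j] by (simp add: path_ca_def)
      next
        case 4
        \<comment> \<open>The coefficients of all return paths at i add up to zero, so f contains
          another one, through some k. The difference of the two paths removes p without enlarging
          the support.\<close>
        have "(\<Sum>l\<in>{l. (i, l) \<in> E} - {j}. f [i, l, i]) \<noteq> 0"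
          using coeffs0(3)[of i] 4 p sum.remove[of "{l. (i, l) \<in> E}" j "\<lambda>l. f [i, l, i]"] finite_neighbors
          by (auto simp: path_cx_def)
        then obtain k where k: "k \<in> {l. (i, l) \<in> E} - {j}" "f [i, k, i] \<noteq> 0" by (meson sum.neutral)
        then show ?thesis
          using p 4 by (intro reduce[OF back_path_diff_in_defining_ideal[OF 4(2), of k], of p "f p"])
            (auto simp: path_elem_def split: if_splits)
      qed
    qed
  qed
qed

text \<open>The composite of the two projections is onto with kernel \<open>kern {}\<close>, so
  \<open>zigzag_basis_hom_image\<close> with T = {} transports the coefficients from the path
  algebra.\<close>

lemma B_zigzag_basis:
  obtains ce and ca and cx :: "_ \<Rightarrow> 'v \<Rightarrow> 'k" where "zigzag_basis B V C E ce ca cx"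
proof -
  let ?h = "(\<lambda>z. X +>\<^bsub>Z\<^esub> z) \<circ> (\<lambda>f. I +>\<^bsub>P\<^esub> f)"
  have ring: "ring B" unfolding zigzag_algebra_vertex_cond_def by (rule X.quotient_is_ring)
  have hom: "?h \<in> ring_hom P B"
    using ring_hom_ring.homh[OF zigzag_hom] X.rcos_ring_hom
    unfolding zigzag_algebra_vertex_cond_def by (rule ring_hom_trans)
  have surj: "?h ` carrier P = carrier B"
  proof -
    have "(\<lambda>f. I +>\<^bsub>P\<^esub> f) ` carrier P = carrier Z"
      by (auto simp: zigzag_algebra_def FactRing_def A_RCOSETS_def')
    then show ?thesis
      unfolding image_comp[symmetric] by (auto simp: zigzag_algebra_vertex_cond_def FactRing_def A_RCOSETS_def')
  qed
  have ker: "?h f = \<zero>\<^bsub>B\<^esub> \<longleftrightarrow> f \<in> kern {}" if f: "f \<in> carrier P" for f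
  proof -
    have "?h f = \<zero>\<^bsub>B\<^esub> \<longleftrightarrow> X +>\<^bsub>Z\<^esub> (I +>\<^bsub>P\<^esub> f) = X"
      by (simp add: zigzag_algebra_vertex_cond_def FactRing_def)
    also have "\<dots> \<longleftrightarrow> I +>\<^bsub>P\<^esub> f \<in> X"
      using X.a_rcos_const X.a_rcos_self[OF coset_carrier[OF f]] by metis
    also have "\<dots> \<longleftrightarrow> f \<in> kern {}"
      using f defining_ideal_subset_kern kern_subset_defining_ideal mem_defining_ideal[of f] by blast
    finally show ?thesis .
  qed
  have "E \<inter> V \<times> V = E" using edge_verts by auto
  then show ?thesis
    using that by (rule_tac zigzag_basis_hom_image[OF ring hom surj ker]) simp_all
qed

end

theorem theorem2:
  fixes K :: "'k::field itself" and \<Gamma> :: "'v pair_pre_digraph" and C :: "'v set"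
  assumes "pair_graph \<Gamma>" and "Digraph_Component.connected (with_proj \<Gamma>)"
    and "C \<subseteq> pverts \<Gamma>" and "C \<noteq> {}"
  shows "quasi_hereditary (zigzag_algebra_vertex_cond K \<Gamma> C) \<longleftrightarrow>
    (\<exists>n\<ge>1. \<exists>f. graph_iso f (type_A n) \<Gamma> \<and> (C = {f 1} \<or> C = {f n}))"
proof -
  interpret zigzag_graph K \<Gamma> C by (rule zigzag_graph.intro) (rule assms)+
  obtain ce ca and cx :: "_ \<Rightarrow> 'v \<Rightarrow> 'k" where "zigzag_basis B V C E ce ca cx" by (rule B_zigzag_basis)
  then interpret B: zigzag_basis B V C E ce ca cx .
  have iso: "graph_iso f (type_A n) \<Gamma> \<longleftrightarrow> bij_betw f {1..n} V \<and>
      (\<forall>a\<in>{1..n}. \<forall>b\<in>{1..n}. (f a, f b) \<in> E \<longleftrightarrow> b = a + 1 \<or> a = b + 1)" for f and n :: nat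
    unfolding graph_iso_def type_A_def by auto
  show ?thesis
  proof
    assume "quasi_hereditary B"
    then obtain f and n :: nat where "n \<ge> 1" "bij_betw f {1..n} V"
      "\<And>a b. a \<in> {1..n} \<Longrightarrow> b \<in> {1..n} \<Longrightarrow> (f a, f b) \<in> E \<longleftrightarrow> b = a + 1 \<or> a = b + 1" "C = {f 1}"
      by (rule B.quasi_hereditary_imp_path[OF _ C_verts C_nonempty connected_rtrancl]) (assumption+, (rule that; assumption))
    then show "\<exists>n\<ge>1. \<exists>f. graph_iso f (type_A n) \<Gamma> \<and> (C = {f 1} \<or> C = {f n})"
      unfolding iso by blast
  next
    assume "\<exists>n\<ge>1. \<exists>f. graph_iso f (type_A n) \<Gamma> \<and> (C = {f 1} \<or> C = {f n})"
    then obtain n :: nat and f where n: "n \<ge> 1" and f: "bij_betw f {1..n} V"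
      and edge: "\<And>a b. a \<in> {1..n} \<Longrightarrow> b \<in> {1..n} \<Longrightarrow> (f a, f b) \<in> E \<longleftrightarrow> b = a + 1 \<or> a = b + 1"
      and C: "C = {f 1} \<or> C = {f n}"
      unfolding iso by (elim exE conjE) blast
    from C show "quasi_hereditary B"
    proof
      assume "C = {f 1}"
      then show ?thesis
        by (rule B.quasi_hereditary_of_path[OF n f, rotated]) (rule edge)
    next
      assume C: "C = {f n}"
      \<comment> \<open>Numbering the path from its other end reduces this case to the previous
        one.\<close>
      let ?g = "\<lambda>a. f (n + 1 - a)"
      show ?thesis
      proof (rule B.quasi_hereditary_of_path[OF n, of ?g])
        have "bij_betw (\<lambda>a. n + 1 - a) {1..n} {1..n}"
          by (rule bij_betw_byWitness[of _ "\<lambda>a. n + 1 - a"]) auto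
        from bij_betw_trans[OF this f] show "bij_betw ?g {1..n} V" by (simp add: comp_def)
        show "(?g a, ?g b) \<in> E \<longleftrightarrow> b = a + 1 \<or> a = b + 1" if "a \<in> {1..n}" "b \<in> {1..n}" for a b
        proof -
          have "n + 1 - a \<in> {1..n}" "n + 1 - b \<in> {1..n}" using that by auto
          note edge[OF this]
          also have "n + 1 - b = n + 1 - a + 1 \<or> n + 1 - a = n + 1 - b + 1 \<longleftrightarrow> b = a + 1 \<or> a = b + 1"
            using that unfolding atLeastAtMost_iff by arith
          finally show ?thesis .
        qed
        show "C = {?g 1}" using C by simp
      qed
    qed
  qed
qed

end
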